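(* Let $(X,d,\varphi)$ be an irreducible Smale space with periodic orbits $P,Q$ such that $P\cap Q=\varnothing$, and let $d'\in\mathrm{sM}_d(X,\varphi)$. The algebras $\overline{\rho_s}(\Lambda_{s,d'}(Q,\alpha_s))$ and $\overline{\rho_u}(\Lambda_{u,d'}(P,\alpha_u))$ commute modulo the Schatten ideal $\mathcal L^p(\mathscr H\otimes\ell^2(\mathbb Z))$ (that is, every commutator $[x,y]$ with $x$ in the first and $y$ in the second lies in this ideal), for every $$p>\frac{2h(\varphi)\lceil\log_{\lambda_{X,d'}}3\rceil}{\log2}.$$
   Context: **Smale spaces.** All Smale spaces have infinite underlying space. A Smale space $(X,d,\varphi)$ is a compact metric space $(X,d)$ with a homeomorphism $\varphi:X\to X$, constants $\varepsilon_X>0$, $\lambda_X>1$ and a continuous map $[\cdot,\cdot]:\{(x,y)\in X\times X:d(x,y)\le\varepsilon_X\}\to X$ satisfying $[x,x]=x$, $[x,[y,z]]=[x,z]$, $[[x,y],z]=[x,z]$, $\varphi([x,y])=[\varphi(x),\varphi(y)]$ whenever both sides are defined, and such that, writing for $0<\varepsilon\le\varepsilon_X$ $$X^s(x,\varepsilon)=\{y:d(x,y)<\varepsilon,\ [x,y]=y\},\qquad X^u(x,\varepsilon)=\{y:d(x,y)<\varepsilon,\ [y,x]=y\},$$ one has $d(\varphi(y),\varphi(z))\le\lambda_X^{-1}d(y,z)$ for $y,z\in X^s(x,\varepsilon)$ and $d(\varphi^{-1}(y),\varphi^{-1}(z))\le\lambda_X^{-1}d(y,z)$ for $y,z\in X^u(x,\varepsilon)$.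 Fix $0<\varepsilon_X'\le\varepsilon_X/2$ such that $d(x,y)\le\varepsilon_X'$ implies $d(x,[x,y]),d(y,[x,y])<\varepsilon_X/2$. It is irreducible if for all non-empty open $U,V\subset X$ there is $n\in\mathbb N$ with $\varphi^n(U)\cap V\ne\varnothing$. It is self-similar if $\varphi,\varphi^{-1}$ are both $\lambda_X$-Lipschitz. $\mathrm{sM}_d(X,\varphi)$ is the (non-empty) set of metrics $d'$ inducing the same topology as $d$ for which $(X,d',\varphi)$ is a self-similar Smale space, with contraction constant $\lambda_{X,d'}>1$. $h(\varphi)$ is the topological entropy. **Groupoids.** $X^s(x)=\{y:\lim_{n\to+\infty}d(\varphi^n(x),\varphi^n(y))=0\}$, $X^u(x)=\{y:\lim_{n\to-\infty}d(\varphi^n(x),\varphi^n(y))=0\}$, $X^s(P)=\bigcup_{p\in P}X^s(p)$, $X^u(Q)=\bigcup_{q\in Q}X^u(q)$. Set $G^s(Q)=\{(v,w):v,w\in X^u(Q),\ w\in X^s(v)\}$, $G^u(P)=\{(v,w):v,w\in X^s(P),\ w\in X^u(v)\}$ with equivalence-relation groupoid structure. For $(v,w)\in G^s(Q)$, an integer $N\ge0$ with $\varphi^N(w)\in X^s(\varphi^N(v),\varepsilon_X'/2)$ and $\eta\in(0,\varepsilon_X/2]$ with $\varphi^N(X^u(w,\eta))\subset X^u(\varphi^N(w),\varepsilon_X'/2)$, let $h^s(z)=\varphi^{-N}[\varphi^N(z),\varphi^N(v)]$ and $V^s(v,w,h^s,\eta,N)=\{(h^s(z),z):z\in X^u(w,\eta)\}$.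 These sets form a base of a second countable, locally compact, Hausdorff étale topology on $G^s(Q)$ (independent of the choice of $d'\in\mathrm{sM}_d(X,\varphi)$ used in place of $d$). $G^u(P)$ is topologised likewise with $h^u(z)=\varphi^N[\varphi^{-N}(v),\varphi^{-N}(z)]$, $z\in X^s(w,\eta)$. **Groupoid metrics.** Let $d'\in\mathrm{sM}_d(X,\varphi)$; all local sets and constants ($\lambda=\lambda_{X,d'}$, $\varepsilon_X'$) refer to $d'$. For $a=(a_1,a_2)\in G^s(Q)$ let $N_a\ge0$ be least with $\varphi^{N_a}(a_2)\in X^s(\varphi^{N_a}(a_1),\varepsilon_X'/2)$ and, for $n\ge1$, with $m=\max\{N_a,n\}$, let $V_n(a)=\{(\varphi^{-m}[\varphi^m(z),\varphi^m(a_1)],z):z\in X^u(a_2,\lambda^{-m}\varepsilon_X'/4)\}$. Put $k(a,1)=1$ and $k(a,n+1)=\max\{N_a,1\}+n\lceil\log_\lambda3\rceil$ for $n\ge1$, $\mathcal U_0=\{G^s(Q)\}$, $\mathcal U_n=\{V_{k(a,n)}(a):a\in G^s(Q)\}$ for $n\geq 1$, $\rho_{s,d'}(a,b)=\inf\{2^{-n}:\exists U\in\mathcal U_n,\ a,b\in U\}$ and $D_{s,d'}(a,b)=\inf\{\sum_{i=1}^{n-1}\rho_{s,d'}(c_i,c_{i+1}):c_1=a,\ c_n=b\}$, the infimum over finite chains in $G^s(Q)$. This is a metric generating the topology of $G^s(Q)$. $D_{u,d'}$ on $G^u(P)$ is defined in the same way after interchanging stable/unstable and $\varphi,\varphi^{-1}$: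 $N_a$ is least with $\varphi^{-N_a}(a_2)\in X^u(\varphi^{-N_a}(a_1),\varepsilon_X'/2)$ and $V_n(a)=\{(\varphi^m[\varphi^{-m}(a_1),\varphi^{-m}(z)],z):z\in X^s(a_2,\lambda^{-m}\varepsilon_X'/4)\}$. **Algebras and representations.** Let $\mathscr H=\ell^2(X^s(P)\cap X^u(Q))$. $C_c(G^s(Q))$ is a $*$-algebra with $(f\cdot g)(v,w)=\sum_zf(v,z)g(z,w)$, $f^*(v,w)=\overline{f(w,v)}$, faithfully represented on $\mathscr H$ by $(\rho_s(f)\xi)(v)=\sum_{(v,z)\in G^s(Q)}f(v,z)\xi(z)$. $\mathcal S(Q)\subset\mathcal B(\mathscr H)$ is the norm closure of its image; $\mathcal U(P)\subset\mathcal B(\mathscr H)$ is defined in the same way from $G^u(P)$. $\alpha_s,\alpha_u$ are given by $f\mapsto f\circ(\varphi\times\varphi)^{-1}$, implemented by the unitary $u\delta_x=\delta_{\varphi(x)}$. $\mathcal R^s(Q)=\mathcal S(Q)\rtimes_{\alpha_s}\mathbb Z$, $\mathcal R^u(P)=\mathcal U(P)\rtimes_{\alpha_u}\mathbb Z$ (canonical unitaries also written $u$). With $\mathrm{Lip}_c$ denoting compactly supported complex Lipschitz functions, $\Lambda_{s,d'}(Q,\alpha_s)\subset\mathcal R^s(Q)$ is the $*$-subalgebra of finite sums $\sum_ja_ju^j$, $a_j\in\mathrm{Lip}_c(G^s(Q),D_{s,d'})$; $\Lambda_{u,d'}(P,\alpha_u)\subset\mathcal R^u(P)$ is defined analogously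 with $\mathrm{Lip}_c(G^u(P),D_{u,d'})$. Let $B\delta_n=\delta_{n-1}$ on $\ell^2(\mathbb Z)$. The representations of $\mathcal R^s(Q)$ and $\mathcal R^u(P)$ on $\mathscr H\otimes\ell^2(\mathbb Z)$ are given by $\overline{\rho_s}(a)=\bigoplus_{n\in\mathbb Z}\alpha_s^n(a)$, $\overline{\rho_s}(u)=1\otimes B$ for $a\in\mathcal S(Q)$, and $\overline{\rho_u}(b)=b\otimes1$, $\overline{\rho_u}(u)=u\otimes B^*$ for $b\in\mathcal U(P)$. For $p>0$, $\mathcal L^p(H)$ is the ideal of compact operators on $H$ with singular value sequence in $\ell^p$. *)

theory Defs
  imports "HOL-Analysis.Analysis"
begin

section \<open>Smale spaces\<close>

text \<open>
  The underlying space is the whole type \<^typ>\<open>'a\<close>; the metric is an explicit function, because two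
  metrics on the same space occur. The bracket is a total function, constrained only at pairs of
  distance at most \<open>seps\<close>. The field \<open>seps'\<close> is the auxiliary constant \<open>\<epsilon>'\<^sub>X\<close>.
\<close>

record 'a smale_data =
  sdist :: "'a \<Rightarrow> 'a \<Rightarrow> real"
  smap :: "'a \<Rightarrow> 'a"
  sbr :: "'a \<Rightarrow> 'a \<Rightarrow> 'a"
  seps :: real
  slam :: real
  seps' :: real

definition mtop :: "('a \<Rightarrow> 'a \<Rightarrow> real) \<Rightarrow> 'a topology" where
  "mtop d = Metric_space.mtopology UNIV d"

definition loc_s :: "'a smale_data \<Rightarrow> 'a \<Rightarrow> real \<Rightarrow> 'a set" where
  "loc_s X x e = {y. sdist X x y < e \<and> sbr X x y = y}"

definition loc_u :: "'a smale_data \<Rightarrow> 'a \<Rightarrow> real \<Rightarrow> 'a set" where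
  "loc_u X x e = {y. sdist X x y < e \<and> sbr X y x = y}"

definition smale_space :: "'a smale_data \<Rightarrow> bool" where
  "smale_space X \<longleftrightarrow>
     (let d = sdist X; f = smap X; b = sbr X; e = seps X; l = slam X; e' = seps' X in
       Metric_space UNIV d \<and> compact_space (mtop d) \<and> infinite (UNIV :: 'a set) \<and>
       homeomorphic_map (mtop d) (mtop d) f \<and>
       e > 0 \<and> l > 1 \<and>
       continuous_map (subtopology (prod_topology (mtop d) (mtop d)) {(x, y). d x y \<le> e})
         (mtop d) (\<lambda>(x, y). b x y) \<and>
       (\<forall>x. b x x = x) \<and>
       (\<forall>x y z. d y z \<le> e \<and> d x (b y z) \<le> e \<and> d x z \<le> e \<longrightarrow> b x (b y z) = b x z) \<and>
       (\<forall>x y z. d x y \<le> e \<and> d (b x y) z \<le> e \<and> d x z \<le> e \<longrightarrow> b (b x y) z = b x z) \<and>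
       (\<forall>x y. d x y \<le> e \<and> d (f x) (f y) \<le> e \<longrightarrow> f (b x y) = b (f x) (f y)) \<and>
       (\<forall>r x y z. 0 < r \<and> r \<le> e \<and> y \<in> loc_s X x r \<and> z \<in> loc_s X x r \<longrightarrow>
          d (f y) (f z) \<le> inverse l * d y z) \<and>
       (\<forall>r x y z. 0 < r \<and> r \<le> e \<and> y \<in> loc_u X x r \<and> z \<in> loc_u X x r \<longrightarrow>
          d (inv f y) (inv f z) \<le> inverse l * d y z) \<and>
       0 < e' \<and> e' \<le> e / 2 \<and>
       (\<forall>x y. d x y \<le> e' \<longrightarrow> d x (b x y) < e / 2 \<and> d y (b x y) < e / 2))"

definition irreducible_smale :: "'a smale_data \<Rightarrow> bool" where
  "irreducible_smale X \<longleftrightarrow>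
     (\<forall>U V. openin (mtop (sdist X)) U \<and> openin (mtop (sdist X)) V \<and> U \<noteq> {} \<and> V \<noteq> {} \<longrightarrow>
        (\<exists>n::nat. (smap X ^^ n) ` U \<inter> V \<noteq> {}))"

definition self_similar :: "'a smale_data \<Rightarrow> bool" where
  "self_similar X \<longleftrightarrow> smale_space X \<and>
     (\<forall>x y. sdist X (smap X x) (smap X y) \<le> slam X * sdist X x y) \<and>
     (\<forall>x y. sdist X (inv (smap X) x) (inv (smap X) y) \<le> slam X * sdist X x y)"

text \<open>The metrics \<open>sM\<^sub>d(X, \<phi>)\<close>, for the homeomorphism and the topology carried by \<open>X\<close>.\<close>

definition sM :: "'a smale_data \<Rightarrow> ('a \<Rightarrow> 'a \<Rightarrow> real) set" where
  "sM X = {d'. Metric_space UNIV d' \<and> mtop d' = mtop (sdist X) \<and>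
     (\<exists>X'. sdist X' = d' \<and> smap X' = smap X \<and> self_similar X')}"

definition periodic_orbit :: "('a \<Rightarrow> 'a) \<Rightarrow> 'a set \<Rightarrow> bool" where
  "periodic_orbit f P \<longleftrightarrow> (\<exists>x k. 0 < k \<and> (f ^^ k) x = x \<and> P = {(f ^^ n) x |n. True})"

subsection \<open>Topological entropy\<close>

text \<open>
  Bowen's definition by \<open>(n, \<epsilon>)\<close>-separated sets. The limit as \<open>\<epsilon>\<close> tends to \<open>0\<close> is a supremum since
  the growth rate is monotone in \<open>\<epsilon>\<close>.
\<close>

definition separated_set :: "'a smale_data \<Rightarrow> nat \<Rightarrow> real \<Rightarrow> 'a set \<Rightarrow> bool" where
  "separated_set X n e E \<longleftrightarrow>
     (\<forall>x\<in>E. \<forall>y\<in>E. x \<noteq> y \<longrightarrow> (\<exists>i<n. sdist X ((smap X ^^ i) x) ((smap X ^^ i) y) > e))"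

definition separated_number :: "'a smale_data \<Rightarrow> nat \<Rightarrow> real \<Rightarrow> nat" where
  "separated_number X n e = (SUP E \<in> {E. finite E \<and> separated_set X n e E}. card E)"

definition entropy :: "'a smale_data \<Rightarrow> ereal" where
  "entropy X =
     (SUP e \<in> {0<..}. limsup (\<lambda>n. ereal (ln (real (separated_number X n e)) / real n)))"

section \<open>The groupoids and their metrics\<close>

definition glob_s :: "'a smale_data \<Rightarrow> 'a \<Rightarrow> 'a set" where
  "glob_s X x = {y. (\<lambda>n. sdist X ((smap X ^^ n) x) ((smap X ^^ n) y)) \<longlonglongrightarrow> 0}"

definition glob_u :: "'a smale_data \<Rightarrow> 'a \<Rightarrow> 'a set" where
  "glob_u X x = {y. (\<lambda>n. sdist X ((inv (smap X) ^^ n) x) ((inv (smap X) ^^ n) y)) \<longlonglongrightarrow> 0}"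

definition G_s :: "'a smale_data \<Rightarrow> 'a set \<Rightarrow> ('a \<times> 'a) set" where
  "G_s X Q = {(v, w). v \<in> (\<Union>q\<in>Q. glob_u X q) \<and> w \<in> (\<Union>q\<in>Q. glob_u X q) \<and> w \<in> glob_s X v}"

text \<open>The graph \<open>{(h\<^sup>s(z), z)}\<close> over \<open>X\<^sup>u(w, \<eta>)\<close> of the holonomy map \<open>h\<^sup>s(z) = \<phi>\<^sup>-\<^sup>N[\<phi>\<^sup>N(z), \<phi>\<^sup>N(v)]\<close>.\<close>

definition holonomy_s :: "'a smale_data \<Rightarrow> 'a \<Rightarrow> 'a \<Rightarrow> real \<Rightarrow> nat \<Rightarrow> ('a \<times> 'a) set" where
  "holonomy_s X v w \<eta> N =
     (\<lambda>z. ((inv (smap X) ^^ N) (sbr X ((smap X ^^ N) z) ((smap X ^^ N) v)), z)) ` loc_u X w \<eta>"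

definition top_s :: "'a smale_data \<Rightarrow> 'a set \<Rightarrow> ('a \<times> 'a) topology" where
  "top_s X Q = topology_generated_by
     {holonomy_s X v w \<eta> N |v w \<eta> N. (v, w) \<in> G_s X Q \<and>
        (smap X ^^ N) w \<in> loc_s X ((smap X ^^ N) v) (seps' X / 2) \<and>
        0 < \<eta> \<and> \<eta> \<le> seps X / 2 \<and>
        (smap X ^^ N) ` loc_u X w \<eta> \<subseteq> loc_u X ((smap X ^^ N) w) (seps' X / 2)}"

definition N_s :: "'a smale_data \<Rightarrow> 'a \<times> 'a \<Rightarrow> nat" where
  "N_s X a =
     (LEAST N. (smap X ^^ N) (snd a) \<in> loc_s X ((smap X ^^ N) (fst a)) (seps' X / 2))"

definition V_s :: "'a smale_data \<Rightarrow> nat \<Rightarrow> 'a \<times> 'a \<Rightarrow> ('a \<times> 'a) set" where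
  "V_s X n a = (let m = max (N_s X a) n in
     holonomy_s X (fst a) (snd a) (inverse (slam X ^ m) * seps' X / 4) m)"

text \<open>The value at \<open>n = 0\<close> is never used.\<close>

definition k_s :: "'a smale_data \<Rightarrow> 'a \<times> 'a \<Rightarrow> nat \<Rightarrow> nat" where
  "k_s X a n = (if n \<le> 1 then 1
     else max (N_s X a) 1 + (n - 1) * nat \<lceil>log (slam X) 3\<rceil>)"

definition cover_s :: "'a smale_data \<Rightarrow> 'a set \<Rightarrow> nat \<Rightarrow> ('a \<times> 'a) set set" where
  "cover_s X Q n = (if n = 0 then {G_s X Q} else {V_s X (k_s X a n) a |a. a \<in> G_s X Q})"

definition quasi_s :: "'a smale_data \<Rightarrow> 'a set \<Rightarrow> 'a \<times> 'a \<Rightarrow> 'a \<times> 'a \<Rightarrow> real" where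
  "quasi_s X Q a b = Inf {inverse (2 ^ n) |n. \<exists>U\<in>cover_s X Q n. a \<in> U \<and> b \<in> U}"

definition D_s :: "'a smale_data \<Rightarrow> 'a set \<Rightarrow> 'a \<times> 'a \<Rightarrow> 'a \<times> 'a \<Rightarrow> real" where
  "D_s X Q a b = Inf {(\<Sum>i<length c - 1. quasi_s X Q (c ! i) (c ! Suc i)) |c.
     c \<noteq> [] \<and> set c \<subseteq> G_s X Q \<and> hd c = a \<and> last c = b}"

text \<open>
  Interchanging stable and unstable and \<open>\<phi>\<close>, \<open>\<phi>\<^sup>-\<^sup>1\<close> amounts to passing to the Smale space with
  homeomorphism \<open>\<phi>\<^sup>-\<^sup>1\<close> and bracket \<open>(x, y) \<mapsto> [y, x]\<close>. All objects attached to \<open>G\<^sup>u(P)\<close> are those of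
  the flipped space; the lemmas below spell them out.
\<close>

definition flip :: "'a smale_data \<Rightarrow> 'a smale_data" where
  "flip X = X\<lparr>smap := inv (smap X), sbr := \<lambda>x y. sbr X y x\<rparr>"

definition G_u :: "'a smale_data \<Rightarrow> 'a set \<Rightarrow> ('a \<times> 'a) set" where
  "G_u X P = G_s (flip X) P"

definition top_u :: "'a smale_data \<Rightarrow> 'a set \<Rightarrow> ('a \<times> 'a) topology" where
  "top_u X P = top_s (flip X) P"

definition D_u :: "'a smale_data \<Rightarrow> 'a set \<Rightarrow> 'a \<times> 'a \<Rightarrow> 'a \<times> 'a \<Rightarrow> real" where
  "D_u X P = D_s (flip X) P"

lemma smale_space_bij: "smale_space X \<Longrightarrow> bij (smap X)"
proof -
  assume "smale_space X"
  then have *: "Metric_space UNIV (sdist X)"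
    "homeomorphic_map (mtop (sdist X)) (mtop (sdist X)) (smap X)"
    by (simp_all add: smale_space_def Let_def)
  have "topspace (mtop (sdist X)) = UNIV"
    using *(1) by (simp add: mtop_def Metric_space.topspace_mtopology)
  with *(2) show ?thesis
    using homeomorphic_imp_surjective_map homeomorphic_imp_injective_map by (metis bij_def)
qed

lemma flip_sel:
  "sdist (flip X) = sdist X" "smap (flip X) = inv (smap X)" "sbr (flip X) = (\<lambda>x y. sbr X y x)"
  "seps (flip X) = seps X" "slam (flip X) = slam X" "seps' (flip X) = seps' X"
  by (simp_all add: flip_def)

lemma loc_flip: "loc_s (flip X) = loc_u X" "loc_u (flip X) = loc_s X"
  by (auto simp: loc_s_def loc_u_def flip_sel fun_eq_iff)

lemma glob_flip:
  assumes "bij (smap X)"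
  shows "glob_s (flip X) = glob_u X" "glob_u (flip X) = glob_s X"
  using assms by (auto simp: glob_s_def glob_u_def flip_sel fun_eq_iff inv_inv_eq)

lemma G_u_eq:
  assumes "bij (smap X)"
  shows "G_u X P =
    {(v, w). v \<in> (\<Union>p\<in>P. glob_s X p) \<and> w \<in> (\<Union>p\<in>P. glob_s X p) \<and> w \<in> glob_u X v}"
  by (simp add: G_u_def G_s_def glob_flip[OF assms])

lemma holonomy_flip:
  assumes "bij (smap X)"
  shows "holonomy_s (flip X) v w \<eta> N =
    (\<lambda>z. ((smap X ^^ N) (sbr X ((inv (smap X) ^^ N) v) ((inv (smap X) ^^ N) z)), z)) ` loc_s X w \<eta>"
  by (simp add: holonomy_s_def flip_sel loc_flip inv_inv_eq[OF assms])

lemma N_flip: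
  "N_s (flip X) a =
    (LEAST N. (inv (smap X) ^^ N) (snd a) \<in> loc_u X ((inv (smap X) ^^ N) (fst a)) (seps' X / 2))"
  by (simp add: N_s_def flip_sel loc_flip)

section \<open>Operators on \<open>\<ell>\<^sup>2\<close>\<close>

text \<open>
  \<open>\<ell>\<^sup>2(I)\<close> consists of functions on the whole type vanishing off \<open>I\<close>. An operator on \<open>\<ell>\<^sup>2(I)\<close> is a map
  of functions of which only the values on \<open>\<ell>\<^sup>2(I)\<close> matter.
\<close>

type_synonym 'b opr = "('b \<Rightarrow> complex) \<Rightarrow> ('b \<Rightarrow> complex)"

definition l2 :: "'b set \<Rightarrow> ('b \<Rightarrow> complex) set" where
  "l2 I = {\<xi>. (\<forall>x. x \<notin> I \<longrightarrow> \<xi> x = 0) \<and> (\<lambda>x. (cmod (\<xi> x))\<^sup>2) summable_on I}"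

definition l2_norm :: "('b \<Rightarrow> complex) \<Rightarrow> real" where
  "l2_norm \<xi> = sqrt (\<Sum>\<^sub>\<infinity>x. (cmod (\<xi> x))\<^sup>2)"

definition l2_inner :: "('b \<Rightarrow> complex) \<Rightarrow> ('b \<Rightarrow> complex) \<Rightarrow> complex" where
  "l2_inner \<xi> \<eta> = (\<Sum>\<^sub>\<infinity>x. cnj (\<xi> x) * \<eta> x)"

definition bounded_opr :: "'b set \<Rightarrow> 'b opr \<Rightarrow> bool" where
  "bounded_opr I T \<longleftrightarrow> T ` l2 I \<subseteq> l2 I \<and>
     (\<forall>\<xi>\<in>l2 I. \<forall>\<eta>\<in>l2 I. T (\<lambda>x. \<xi> x + \<eta> x) = (\<lambda>x. T \<xi> x + T \<eta> x)) \<and>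
     (\<forall>c. \<forall>\<xi>\<in>l2 I. T (\<lambda>x. c * \<xi> x) = (\<lambda>x. c * T \<xi> x)) \<and>
     (\<exists>C. \<forall>\<xi>\<in>l2 I. l2_norm (T \<xi>) \<le> C * l2_norm \<xi>)"

definition compact_opr :: "'b set \<Rightarrow> 'b opr \<Rightarrow> bool" where
  "compact_opr I T \<longleftrightarrow> bounded_opr I T \<and>
     (\<forall>\<xi> :: nat \<Rightarrow> 'b \<Rightarrow> complex. (\<forall>n. \<xi> n \<in> l2 I \<and> l2_norm (\<xi> n) \<le> 1) \<longrightarrow>
        (\<exists>r \<eta>. strict_mono r \<and> \<eta> \<in> l2 I \<and>
           (\<lambda>n. l2_norm (\<lambda>x. T (\<xi> (r n)) x - \<eta> x)) \<longlonglongrightarrow> 0))"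

definition adjoint_opr :: "'b set \<Rightarrow> 'b opr \<Rightarrow> 'b opr \<Rightarrow> bool" where
  "adjoint_opr I T A \<longleftrightarrow> bounded_opr I A \<and>
     (\<forall>\<xi>\<in>l2 I. \<forall>\<eta>\<in>l2 I. l2_inner (A \<xi>) \<eta> = l2_inner \<xi> (T \<eta>))"

text \<open>
  The squares of the positive terms of \<open>s\<close> are the non-zero eigenvalues of \<open>T\<^sup>*T\<close>, in decreasing order
  and with multiplicity: the corresponding \<open>e\<^sub>n\<close> are orthonormal eigenvectors, and \<open>T\<^sup>*T\<close> vanishes on
  the orthogonal complement of their span. If there are only finitely many, \<open>s\<close> is padded by zeros,
  for which \<open>e\<^sub>n = 0\<close>.
\<close>

definition singular_values :: "'b set \<Rightarrow> 'b opr \<Rightarrow> (nat \<Rightarrow> real) \<Rightarrow> bool" where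
  "singular_values I T s \<longleftrightarrow> decseq s \<and> (\<forall>n. 0 \<le> s n) \<and>
     (\<exists>A e. adjoint_opr I T A \<and> (\<forall>n. e n \<in> l2 I) \<and>
        (\<forall>m n. l2_inner (e m) (e n) = (if m = n \<and> s n > 0 then 1 else 0)) \<and>
        (\<forall>n. A (T (e n)) = (\<lambda>x. complex_of_real ((s n)\<^sup>2) * e n x)) \<and>
        (\<forall>\<eta>\<in>l2 I. (\<forall>n. l2_inner (e n) \<eta> = 0) \<longrightarrow> A (T \<eta>) = (\<lambda>_. 0)))"

definition schatten :: "'b set \<Rightarrow> real \<Rightarrow> 'b opr set" where
  "schatten I p = {T. compact_opr I T \<and>
     (\<exists>s. singular_values I T s \<and> summable (\<lambda>n. s n powr p))}"

definition commutator :: "'b opr \<Rightarrow> 'b opr \<Rightarrow> 'b opr" where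
  "commutator S T = (\<lambda>\<xi> x. S (T \<xi>) x - T (S \<xi>) x)"

section \<open>Algebras and representations\<close>

definition ipow :: "('c \<Rightarrow> 'c) \<Rightarrow> int \<Rightarrow> 'c \<Rightarrow> 'c" where
  "ipow f j = (if 0 \<le> j then f ^^ nat j else inv f ^^ nat (- j))"

text \<open>The index set of \<open>\<H> = \<ell>\<^sup>2(X\<^sup>s(P) \<inter> X\<^sup>u(Q))\<close>.\<close>

definition hpts :: "'a smale_data \<Rightarrow> 'a set \<Rightarrow> 'a set \<Rightarrow> 'a set" where
  "hpts X P Q = (\<Union>p\<in>P. glob_s X p) \<inter> (\<Union>q\<in>Q. glob_u X q)"

text \<open>
  Compactly supported functions on \<open>G\<close>, for the topology \<open>\<T>\<close>, which are Lipschitz for \<open>D\<close>; they are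
  extended by zero.
\<close>

definition Lip_c ::
  "('g set) \<Rightarrow> 'g topology \<Rightarrow> ('g \<Rightarrow> 'g \<Rightarrow> real) \<Rightarrow> ('g \<Rightarrow> complex) set" where
  "Lip_c G \<T> D = {f. (\<forall>a. a \<notin> G \<longrightarrow> f a = 0) \<and>
     compactin \<T> (\<T> closure_of {a \<in> G. f a \<noteq> 0}) \<and>
     (\<exists>C. \<forall>a\<in>G. \<forall>b\<in>G. cmod (f a - f b) \<le> C * D a b)}"

text \<open>The representation of functions on an equivalence relation \<open>G\<close> on \<open>\<ell>\<^sup>2(I)\<close>.\<close>

definition rho :: "'a set \<Rightarrow> ('a \<times> 'a) set \<Rightarrow> ('a \<times> 'a \<Rightarrow> complex) \<Rightarrow> 'a opr" where
  "rho I G f = (\<lambda>\<xi> v. if v \<in> I then (\<Sum>\<^sub>\<infinity>z\<in>{z. (v, z) \<in> G}. f (v, z) * \<xi> z) else 0)"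

text \<open>\<open>u \<delta>\<^sub>x = \<delta>\<^bsub>\<phi>(x)\<^esub>\<close>, and the automorphism that \<open>u\<close> implements.\<close>

definition uop :: "('a \<Rightarrow> 'a) \<Rightarrow> 'a opr" where
  "uop f = (\<lambda>\<xi> x. \<xi> (inv f x))"

definition alpha :: "('a \<Rightarrow> 'a) \<Rightarrow> 'a opr \<Rightarrow> 'a opr" where
  "alpha f T = uop f \<circ> T \<circ> inv (uop f)"

lemma inv_uop:
  assumes "bij f"
  shows "inv (uop f) = (\<lambda>\<xi>. \<xi> \<circ> f)"
proof (rule inv_equality)
  show "(uop f \<xi>) \<circ> f = \<xi>" for \<xi>
    using assms by (auto simp: uop_def fun_eq_iff bij_def)
  show "uop f (\<xi> \<circ> f) = \<xi>" for \<xi>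
    using assms by (auto simp: uop_def fun_eq_iff bij_def surj_f_inv_f)
qed

lemma alpha_rho:
  assumes f: "bij f" and I: "\<And>x. f x \<in> I \<longleftrightarrow> x \<in> I"
    and G: "\<And>v w. (f v, f w) \<in> G \<longleftrightarrow> (v, w) \<in> G"
  shows "alpha f (rho I G g) = rho I G (\<lambda>(v, w). g (inv f v, inv f w))"
proof (intro ext)
  fix \<xi> v
  define v' where "v' = inv f v"
  have v: "v = f v'" using f by (simp add: v'_def bij_def surj_f_inv_f)
  have inv: "inv f (f x) = x" for x using f by (simp add: bij_def)
  have inv': "f (inv f x) = x" for x using f by (simp add: bij_def surj_f_inv_f)
  have G': "(v', inv f z) \<in> G \<longleftrightarrow> (v, z) \<in> G" for z
    using G[of v' "inv f z"] unfolding inv' v by simp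
  have bij: "bij_betw f {z. (v', z) \<in> G} {z. (v, z) \<in> G}"
    by (rule bij_betw_byWitness[where f' = "inv f"]) (auto simp: inv inv' G' v G)
  have "(\<Sum>\<^sub>\<infinity>z\<in>{z. (v, z) \<in> G}. g (v', inv f z) * \<xi> z) =
        (\<Sum>\<^sub>\<infinity>z\<in>{z. (v', z) \<in> G}. g (v', z) * \<xi> (f z))"
    using infsum_reindex_bij_betw[OF bij, of "\<lambda>z. g (v', inv f z) * \<xi> z"] by (simp add: inv)
  moreover have "v' \<in> I \<longleftrightarrow> v \<in> I" by (simp add: v I)
  moreover have "alpha f T \<xi> v = T (\<xi> \<circ> f) v'" for T
    unfolding alpha_def inv_uop[OF f] by (simp add: uop_def v'_def)
  ultimately show "alpha f (rho I G g) \<xi> v = rho I G (\<lambda>(v, w). g (inv f v, inv f w)) \<xi> v"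
    by (simp add: rho_def flip: v'_def)
qed

text \<open>
  A finite sum \<open>\<Sum>\<^sub>j a\<^sub>j u\<^sup>j\<close> in the crossed product \<open>A \<rtimes> \<int>\<close> is the finitely supported family \<open>j \<mapsto> a\<^sub>j\<close>
  of its (unique) coefficients, elements of \<open>A \<subseteq> B(\<H>)\<close>.
\<close>

definition fin_sums :: "'a opr set \<Rightarrow> (int \<Rightarrow> 'a opr) set" where
  "fin_sums A = {a. finite {j. a j \<noteq> (\<lambda>_ _. 0)} \<and> (\<forall>j. a j \<in> A)}"

definition Lambda_s ::
  "'a smale_data \<Rightarrow> 'a set \<Rightarrow> 'a set \<Rightarrow> (int \<Rightarrow> 'a opr) set" where
  "Lambda_s X P Q =
     fin_sums (rho (hpts X P Q) (G_s X Q) ` Lip_c (G_s X Q) (top_s X Q) (D_s X Q))"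

definition Lambda_u ::
  "'a smale_data \<Rightarrow> 'a set \<Rightarrow> 'a set \<Rightarrow> (int \<Rightarrow> 'a opr) set" where
  "Lambda_u X P Q =
     fin_sums (rho (hpts X P Q) (G_u X P) ` Lip_c (G_u X P) (top_u X P) (D_u X P))"

text \<open>
  \<open>\<H> \<otimes> \<ell>\<^sup>2(\<int>)\<close> is \<open>\<ell>\<^sup>2(I \<times> \<int>)\<close>, with \<open>\<delta>\<^sub>x \<otimes> \<delta>\<^sub>n = \<delta>\<^bsub>(x, n)\<^esub>\<close>. The operators \<open>T \<otimes> 1\<close>, \<open>1 \<otimes> R\<close> and
  \<open>\<Oplus>\<^sub>n T\<^sub>n\<close> on it are as follows.
\<close>

definition amp_left :: "'a opr \<Rightarrow> ('a \<times> int) opr" where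
  "amp_left T = (\<lambda>\<xi> (x, n). T (\<lambda>y. \<xi> (y, n)) x)"

definition amp_right :: "int opr \<Rightarrow> ('a \<times> int) opr" where
  "amp_right R = (\<lambda>\<xi> (x, n). R (\<lambda>m. \<xi> (x, m)) n)"

definition dsum :: "(int \<Rightarrow> 'a opr) \<Rightarrow> ('a \<times> int) opr" where
  "dsum T = (\<lambda>\<xi> (x, n). T n (\<lambda>y. \<xi> (y, n)) x)"

text \<open>\<open>B \<delta>\<^sub>n = \<delta>\<^bsub>n-1\<^esub>\<close> and its adjoint.\<close>

definition Bop :: "int opr" where
  "Bop = (\<lambda>\<xi> n. \<xi> (n + 1))"

definition Bop_adj :: "int opr" where
  "Bop_adj = (\<lambda>\<xi> n. \<xi> (n - 1))"

text \<open>\<open>\<Sum>\<^sub>j a\<^sub>j u\<^sup>j \<mapsto> \<Sum>\<^sub>j \<pi>(a\<^sub>j) U\<^sup>j\<close>\<close>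

definition integrated ::
  "('a opr \<Rightarrow> ('a \<times> int) opr) \<Rightarrow> ('a \<times> int) opr \<Rightarrow> (int \<Rightarrow> 'a opr) \<Rightarrow> ('a \<times> int) opr" where
  "integrated \<pi> U a = (\<lambda>\<xi> x. \<Sum>j | a j \<noteq> (\<lambda>_ _. 0). \<pi> (a j) (ipow U j \<xi>) x)"

definition rhobar_s :: "'a smale_data \<Rightarrow> (int \<Rightarrow> 'a opr) \<Rightarrow> ('a \<times> int) opr" where
  "rhobar_s X = integrated (\<lambda>a. dsum (\<lambda>n. ipow (alpha (smap X)) n a)) (amp_right Bop)"

definition rhobar_u :: "'a smale_data \<Rightarrow> (int \<Rightarrow> 'a opr) \<Rightarrow> ('a \<times> int) opr" where
  "rhobar_u X = integrated amp_left (amp_left (uop (smap X)) \<circ> amp_right Bop_adj)"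

end

theory Submission
  imports Defs
begin

text \<open>
  In the crossed products, \<open>1 \<otimes> B\<^sup>j\<close> commutes with \<open>b \<otimes> 1\<close>, and \<open>u\<^sup>k \<otimes> B\<^sup>-\<^sup>k\<close> commutes with
  \<open>\<Oplus>\<^sub>n \<alpha>\<^sup>n(a)\<close>. Hence the commutator of \<open>a u\<^sup>j\<close> and \<open>b u\<^sup>k\<close> is \<open>\<Oplus>\<^sub>n [\<alpha>\<^sup>n(a), b]\<close> followed by a permutation
  of the basis of \<open>\<H> \<otimes> \<ell>\<^sup>2(\<int>)\<close> (\<open>commutator_apply\<close>), and the theorem is a statement about the sparse
  matrices \<open>[\<alpha>\<^sup>n(\<rho>\<^sub>s(f)), \<rho>\<^sub>u(g)]\<close> for compactly supported Lipschitz functions \<open>f\<close> and \<open>g\<close>. The entry of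
  this matrix at \<open>(v, w)\<close> compares two ways around a rectangle: from \<open>w\<close> along an unstable side to \<open>z\<close> and
  along a stable side to \<open>v\<close>, or first along a stable side to \<open>z'\<close> and then along an unstable side to \<open>v\<close>.
  Write \<open>L = \<lceil>log\<^sub>\<lambda> 3\<rceil>\<close>. Three facts control the matrices (\<open>block_kernel_bounds\<close>).

  For very negative \<open>n\<close> they vanish: the points in the support of \<open>f\<close> approach \<open>Q\<close> uniformly in backward
  time, those in the support of \<open>g\<close> approach \<open>P\<close> uniformly in forward time, and \<open>P\<close> and \<open>Q\<close> are disjoint
  (\<open>supports_disjoint\<close>).

  For large \<open>n\<close> the entries are \<open>O(2\<^sup>-\<^sup>n\<^sup>/\<^sup>L)\<close>. If one of the two ways around exists, then so does the other,
  since the bracket completes the rectangle (\<open>orbit_bracket\<close>), and it is unique by expansiveness. The two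
  stable sides, moved back by \<open>\<phi>\<^sup>-\<^sup>n\<close>, are pairs of points whose orbits stay close up to time \<open>n\<close>, so they lie in a
  common set of the cover number \<open>n / L\<close> (\<open>close_in_V_s\<close>); their distance in the groupoid metric is therefore
  \<open>O(2\<^sup>-\<^sup>n\<^sup>/\<^sup>L)\<close>, and so is the difference of the values of \<open>f\<close>. Exchanging stable and unstable, the
  same holds for \<open>g\<close> at the unstable sides (\<open>rectangle_estimate\<close>).

  The number of non-zero rows is \<open>O(e\<^sup>n\<^sup>h)\<close> for every \<open>h\<close> above the entropy: the corners \<open>z\<close> fall into
  finitely many classes such that the orbits of a class are pairwise close outside a time interval of length
  \<open>n + O(1)\<close>, so by expansiveness they are separated within that interval (\<open>count_orbits\<close>, \<open>separated_growth\<close>).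

  On the operator side, the singular value number \<open>k\<close> is at most \<open>\<surd>2\<close> times the norm of the operator after
  erasing a set of at most \<open>(k + 1) / 2\<close> rows (\<open>singular_value_le\<close>). Erasing the rows of all blocks up to \<open>n\<close>
  shows that the singular values are summable to the power \<open>p\<close> as soon as \<open>e\<^sup>h 2\<^sup>-\<^sup>p\<^sup>/\<^sup>L < 1\<close>. That singular
  values exist is the spectral theorem for compact operators, proved by successive maximisation
  (\<open>compact_opr_singular_values\<close>).

  Local stable and unstable sets enter almost only through the relations \<open>fclose\<close> and \<open>bclose\<close>, saying that two
  orbits stay close from some time on or up to some time: below the scale \<open>\<epsilon>'\<^sub>X\<close> they characterise these
  sets (\<open>fclose_imp_stable\<close>) and, unlike brackets, they can be composed by the triangle inequality.
\<close>

section \<open>Square-summable functions\<close>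

lemma l2_summable:
  assumes "\<xi> \<in> l2 J"
  shows "(\<lambda>x. (cmod (\<xi> x))\<^sup>2) summable_on UNIV"
proof -
  have "(\<lambda>x. (cmod (\<xi> x))\<^sup>2) summable_on J \<longleftrightarrow> (\<lambda>x. (cmod (\<xi> x))\<^sup>2) summable_on UNIV"
    by (rule summable_on_cong_neutral) (use assms in \<open>auto simp: l2_def\<close>)
  then show ?thesis using assms by (simp add: l2_def)
qed

lemma l2_vanish: "\<xi> \<in> l2 J \<Longrightarrow> x \<notin> J \<Longrightarrow> \<xi> x = 0"
  by (simp add: l2_def)

lemma l2_norm_ge_0 [simp]: "0 \<le> l2_norm \<xi>"
  unfolding l2_norm_def by (simp add: infsum_nonneg)

lemma l2_norm_sq: "(l2_norm \<xi>)\<^sup>2 = (\<Sum>\<^sub>\<infinity>x. (cmod (\<xi> x))\<^sup>2)"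
  unfolding l2_norm_def by (simp add: infsum_nonneg)

lemma sum_le_l2_norm_sq:
  assumes "\<xi> \<in> l2 J" "finite F"
  shows "(\<Sum>x\<in>F. (cmod (\<xi> x))\<^sup>2) \<le> (l2_norm \<xi>)\<^sup>2"
  unfolding l2_norm_sq using assms l2_summable by (intro finite_sum_le_infsum) auto

lemma L2_set_le_l2_norm:
  assumes "\<xi> \<in> l2 J" "finite F"
  shows "L2_set (\<lambda>x. cmod (\<xi> x)) F \<le> l2_norm \<xi>"
  using sum_le_l2_norm_sq[OF assms] unfolding L2_set_def by (simp add: real_le_lsqrt)

lemma l2_boundedI:
  assumes "\<And>x. x \<notin> J \<Longrightarrow> \<xi> x = 0"
    and "\<And>F. finite F \<Longrightarrow> L2_set (\<lambda>x. cmod (\<xi> x)) F \<le> B"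
  shows "\<xi> \<in> l2 J" "l2_norm \<xi> \<le> B"
proof -
  have B: "0 \<le> B" using assms(2)[of "{}"] by simp
  have *: "(\<Sum>x\<in>F. (cmod (\<xi> x))\<^sup>2) \<le> B\<^sup>2" if "finite F" for F
    using assms(2)[OF that] B unfolding L2_set_def
    by (simp add: real_sqrt_le_iff' sum_nonneg)
  have s: "(\<lambda>x. (cmod (\<xi> x))\<^sup>2) summable_on UNIV"
    by (rule nonneg_bdd_above_summable_on) (auto intro!: bdd_aboveI2[where M = "B\<^sup>2"] *)
  then show "\<xi> \<in> l2 J"
    unfolding l2_def using assms(1) by (auto intro: summable_on_subset)
  show "l2_norm \<xi> \<le> B"
    unfolding l2_norm_def using infsum_le_finite_sums[OF s, of "B\<^sup>2"] *
    by (simp add: real_le_lsqrt B)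
qed

lemma cmod_le_l2_norm: "\<xi> \<in> l2 J \<Longrightarrow> cmod (\<xi> x) \<le> l2_norm \<xi>"
  using L2_set_le_l2_norm[of \<xi> J "{x}"] by simp

text \<open>
  Both parts reduce to Minkowski's inequality on finite sets.
\<close>

lemma
  assumes "\<xi> \<in> l2 J" "\<eta> \<in> l2 J"
  shows l2_add: "(\<lambda>x. \<xi> x + \<eta> x) \<in> l2 J"
    and l2_norm_triangle: "l2_norm (\<lambda>x. \<xi> x + \<eta> x) \<le> l2_norm \<xi> + l2_norm \<eta>"
proof -
  have *: "L2_set (\<lambda>x. cmod (\<xi> x + \<eta> x)) F \<le> l2_norm \<xi> + l2_norm \<eta>" if "finite F" for F
  proof -
    have "L2_set (\<lambda>x. cmod (\<xi> x + \<eta> x)) F \<le> L2_set (\<lambda>x. cmod (\<xi> x) + cmod (\<eta> x)) F"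
      by (rule L2_set_mono) (auto intro: norm_triangle_ineq)
    also have "\<dots> \<le> L2_set (\<lambda>x. cmod (\<xi> x)) F + L2_set (\<lambda>x. cmod (\<eta> x)) F"
      by (rule L2_set_triangle_ineq)
    also have "\<dots> \<le> l2_norm \<xi> + l2_norm \<eta>"
      using L2_set_le_l2_norm that assms by (intro add_mono) blast+
    finally show ?thesis .
  qed
  show "(\<lambda>x. \<xi> x + \<eta> x) \<in> l2 J" "l2_norm (\<lambda>x. \<xi> x + \<eta> x) \<le> l2_norm \<xi> + l2_norm \<eta>"
    using assms by (auto intro!: l2_boundedI[OF _ *] simp: l2_vanish)
qed

lemma l2_scale: "\<xi> \<in> l2 J \<Longrightarrow> (\<lambda>x. c * \<xi> x) \<in> l2 J"
  unfolding l2_def by (auto simp: norm_mult power_mult_distrib intro: summable_on_cmult_right)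

lemma l2_norm_scale: "l2_norm (\<lambda>x. c * \<xi> x) = cmod c * l2_norm \<xi>"
  unfolding l2_norm_def
  by (simp add: norm_mult power_mult_distrib infsum_cmult_right' real_sqrt_mult)

lemma l2_diff: "\<xi> \<in> l2 J \<Longrightarrow> \<eta> \<in> l2 J \<Longrightarrow> (\<lambda>x. \<xi> x - \<eta> x) \<in> l2 J"
  using l2_add[OF _ l2_scale[of \<eta> J "-1"]] by simp

lemma l2_norm_minus_commute: "l2_norm (\<lambda>x. \<xi> x - \<eta> x) = l2_norm (\<lambda>x. \<eta> x - \<xi> x)"
  unfolding l2_norm_def by (simp add: norm_minus_commute)

lemma l2_norm_diff_triangle:
  assumes "\<xi> \<in> l2 J" "\<eta> \<in> l2 J" "\<zeta> \<in> l2 J"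
  shows "l2_norm (\<lambda>x. \<xi> x - \<zeta> x) \<le> l2_norm (\<lambda>x. \<xi> x - \<eta> x) + l2_norm (\<lambda>x. \<eta> x - \<zeta> x)"
  using l2_norm_triangle[OF l2_diff[OF assms(1,2)] l2_diff[OF assms(2,3)]] by simp

lemma l2_norm_triangle_sub:
  assumes "\<xi> \<in> l2 J" "\<eta> \<in> l2 J"
  shows "\<bar>l2_norm \<xi> - l2_norm \<eta>\<bar> \<le> l2_norm (\<lambda>x. \<xi> x - \<eta> x)"
  using l2_norm_triangle[OF assms(2) l2_diff[OF assms]]
    l2_norm_triangle[OF assms(1) l2_diff[OF assms(2,1)]] l2_norm_minus_commute[of \<xi> \<eta>]
  by simp

lemma l2_zero [simp]: "(\<lambda>_. 0) \<in> l2 J"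
  by (simp add: l2_def)

lemma l2_norm_zero [simp]: "l2_norm (\<lambda>_. 0) = 0"
  by (simp add: l2_norm_def)

lemma l2_norm_eq_0: "\<xi> \<in> l2 J \<Longrightarrow> l2_norm \<xi> = 0 \<longleftrightarrow> \<xi> = (\<lambda>_. 0)"
  using cmod_le_l2_norm[of \<xi> J] by auto

lemma l2_diff_eq_0: "\<xi> \<in> l2 J \<Longrightarrow> \<eta> \<in> l2 J \<Longrightarrow> l2_norm (\<lambda>x. \<xi> x - \<eta> x) = 0 \<longleftrightarrow> \<xi> = \<eta>"
  by (subst l2_norm_eq_0[OF l2_diff]) (auto simp: fun_eq_iff)

subsection \<open>The inner product\<close>

lemma l2_inner_abs_summable:
  assumes "\<xi> \<in> l2 J" "\<eta> \<in> l2 J"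
  shows "(\<lambda>x. cmod (cnj (\<xi> x) * \<eta> x)) summable_on UNIV"
proof (rule abs_summable_product)
  show "(\<lambda>x. cmod (cnj (\<xi> x) * cnj (\<xi> x))) summable_on UNIV"
    "(\<lambda>x. cmod (\<eta> x * \<eta> x)) summable_on UNIV"
    using assms[THEN l2_summable] by (simp_all add: norm_mult power2_eq_square)
qed

lemmas l2_inner_summable = l2_inner_abs_summable[THEN abs_summable_summable]

lemma l2_inner_commute: "l2_inner \<eta> \<xi> = cnj (l2_inner \<xi> \<eta>)"
  unfolding l2_inner_def infsum_cnj[symmetric] by (simp add: mult.commute)

lemma l2_inner_add_right:
  assumes "\<zeta> \<in> l2 J" "\<xi> \<in> l2 J" "\<eta> \<in> l2 J"
  shows "l2_inner \<zeta> (\<lambda>x. \<xi> x + \<eta> x) = l2_inner \<zeta> \<xi> + l2_inner \<zeta> \<eta>"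
  unfolding l2_inner_def using assms
  by (simp add: distrib_left infsum_add l2_inner_summable)

lemma l2_inner_scale_right: "l2_inner \<zeta> (\<lambda>x. c * \<xi> x) = c * l2_inner \<zeta> \<xi>"
proof -
  have "(\<lambda>x. cnj (\<zeta> x) * (c * \<xi> x)) = (\<lambda>x. c * (cnj (\<zeta> x) * \<xi> x))"
    by (simp add: fun_eq_iff)
  then show ?thesis
    unfolding l2_inner_def by (simp only: infsum_cmult_right')
qed

lemma l2_inner_scale_left: "l2_inner (\<lambda>x. c * \<xi> x) \<zeta> = cnj c * l2_inner \<xi> \<zeta>"
  by (subst (1 2) l2_inner_commute) (simp add: l2_inner_scale_right)

lemma l2_inner_diff_right:
  assumes "\<zeta> \<in> l2 J" "\<xi> \<in> l2 J" "\<eta> \<in> l2 J"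
  shows "l2_inner \<zeta> (\<lambda>x. \<xi> x - \<eta> x) = l2_inner \<zeta> \<xi> - l2_inner \<zeta> \<eta>"
  using l2_inner_add_right[OF assms(1,2) l2_scale[OF assms(3), of "-1"]]
    l2_inner_scale_right[of \<zeta> "-1" \<eta>] by simp

lemma l2_inner_diff_left:
  assumes "\<zeta> \<in> l2 J" "\<xi> \<in> l2 J" "\<eta> \<in> l2 J"
  shows "l2_inner (\<lambda>x. \<xi> x - \<eta> x) \<zeta> = l2_inner \<xi> \<zeta> - l2_inner \<eta> \<zeta>"
  by (subst (1 2 3) l2_inner_commute) (simp add: l2_inner_diff_right[OF assms])

lemma l2_inner_zero [simp]: "l2_inner \<xi> (\<lambda>_. 0) = 0" "l2_inner (\<lambda>_. 0) \<xi> = 0"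
  by (simp_all add: l2_inner_def)

lemma l2_inner_self:
  assumes "\<xi> \<in> l2 J"
  shows "l2_inner \<xi> \<xi> = complex_of_real ((l2_norm \<xi>)\<^sup>2)"
proof -
  have "l2_inner \<xi> \<xi> = (\<Sum>\<^sub>\<infinity>x. complex_of_real ((cmod (\<xi> x))\<^sup>2))"
    unfolding l2_inner_def by (simp add: complex_norm_square mult.commute del: of_real_power)
  also have "\<dots> = complex_of_real (\<Sum>\<^sub>\<infinity>x. (cmod (\<xi> x))\<^sup>2)"
    using l2_summable[OF assms] by (intro infsumI has_sum_of_real has_sum_infsum)
  finally show ?thesis by (simp only: l2_norm_sq)
qed

lemma l2_Cauchy_Schwarz:
  assumes "\<xi> \<in> l2 J" "\<eta> \<in> l2 J"
  shows "cmod (l2_inner \<xi> \<eta>) \<le> l2_norm \<xi> * l2_norm \<eta>"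
proof -
  have "cmod (l2_inner \<xi> \<eta>) \<le> (\<Sum>\<^sub>\<infinity>x. cmod (cnj (\<xi> x) * \<eta> x))"
    unfolding l2_inner_def by (rule norm_infsum_bound[OF l2_inner_abs_summable[OF assms]])
  also have "\<dots> \<le> l2_norm \<xi> * l2_norm \<eta>"
  proof (rule infsum_le_finite_sums[OF l2_inner_abs_summable[OF assms]])
    fix F :: "'a set" assume F: "finite F"
    have "(\<Sum>x\<in>F. cmod (cnj (\<xi> x) * \<eta> x)) = (\<Sum>x\<in>F. \<bar>cmod (\<xi> x)\<bar> * \<bar>cmod (\<eta> x)\<bar>)"
      by (simp add: norm_mult)
    also have "\<dots> \<le> L2_set (\<lambda>x. cmod (\<xi> x)) F * L2_set (\<lambda>x. cmod (\<eta> x)) F"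
      by (rule L2_set_mult_ineq)
    also have "\<dots> \<le> l2_norm \<xi> * l2_norm \<eta>"
      using assms F by (intro mult_mono L2_set_le_l2_norm) auto
    finally show "(\<Sum>x\<in>F. cmod (cnj (\<xi> x) * \<eta> x)) \<le> l2_norm \<xi> * l2_norm \<eta>" .
  qed
  finally show ?thesis .
qed

lemma l2_norm_diff_sq:
  assumes "\<xi> \<in> l2 J" "\<eta> \<in> l2 J"
  shows "(l2_norm (\<lambda>x. \<xi> x - \<eta> x))\<^sup>2 = (l2_norm \<xi>)\<^sup>2 - 2 * Re (l2_inner \<xi> \<eta>) + (l2_norm \<eta>)\<^sup>2"
proof -
  have "complex_of_real ((l2_norm (\<lambda>x. \<xi> x - \<eta> x))\<^sup>2) =
      l2_inner (\<lambda>x. \<xi> x - \<eta> x) (\<lambda>x. \<xi> x - \<eta> x)"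
    by (simp only: l2_inner_self[OF l2_diff[OF assms]])
  also have "\<dots> = l2_inner \<xi> \<xi> - l2_inner \<eta> \<xi> - (l2_inner \<xi> \<eta> - l2_inner \<eta> \<eta>)"
    using assms by (simp add: l2_inner_diff_right[OF l2_diff] l2_inner_diff_left)
  finally have "Re (complex_of_real ((l2_norm (\<lambda>x. \<xi> x - \<eta> x))\<^sup>2)) =
      Re (l2_inner \<xi> \<xi> - cnj (l2_inner \<xi> \<eta>) - (l2_inner \<xi> \<eta> - l2_inner \<eta> \<eta>))"
    by (simp only: l2_inner_commute[of \<eta> \<xi>])
  then show ?thesis using assms by (simp add: l2_inner_self del: of_real_power)
qed

definition basis_vec :: "'b \<Rightarrow> 'b \<Rightarrow> complex" where
  "basis_vec x = (\<lambda>y. if y = x then 1 else 0)"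

lemma basis_vec_inner [simp]: "l2_inner (basis_vec x) \<xi> = \<xi> x"
proof -
  have "l2_inner (basis_vec x) \<xi> = (\<Sum>\<^sub>\<infinity>y\<in>{x}. cnj (basis_vec x y) * \<xi> y)"
    unfolding l2_inner_def by (rule infsum_cong_neutral) (auto simp: basis_vec_def)
  then show ?thesis by (simp add: basis_vec_def)
qed

lemma finite_support_l2:
  assumes "finite F" "F \<subseteq> J" "\<And>x. x \<notin> F \<Longrightarrow> \<xi> x = 0"
  shows "\<xi> \<in> l2 J"
proof -
  have "finite {x \<in> J. (cmod (\<xi> x))\<^sup>2 \<noteq> 0}"
    using assms(1) by (rule rev_finite_subset) (use assms(3) in auto)
  then show ?thesis
    using assms unfolding l2_def by (auto intro!: finite_nonzero_values_imp_summable_on)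
qed

lemma basis_vec_l2: "x \<in> J \<Longrightarrow> basis_vec x \<in> l2 J"
  by (rule finite_support_l2[of "{x}"]) (auto simp: basis_vec_def)

lemma l2_sum: "finite A \<Longrightarrow> (\<And>i. i \<in> A \<Longrightarrow> f i \<in> l2 J) \<Longrightarrow> (\<lambda>x. \<Sum>i\<in>A. f i x) \<in> l2 J"
  by (induction A rule: finite_induct) (auto intro: l2_add)

lemma l2_inner_sum_right:
  assumes "finite A" "\<zeta> \<in> l2 J" "\<And>i. i \<in> A \<Longrightarrow> f i \<in> l2 J"
  shows "l2_inner \<zeta> (\<lambda>x. \<Sum>i\<in>A. f i x) = (\<Sum>i\<in>A. l2_inner \<zeta> (f i))"
  using assms(1,3)
proof (induction A rule: finite_induct)
  case (insert a A)
  then have "l2_inner \<zeta> (\<lambda>x. f a x + (\<Sum>i\<in>A. f i x)) = l2_inner \<zeta> (f a) + l2_inner \<zeta> (\<lambda>x. \<Sum>i\<in>A. f i x)"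
    using assms(2) by (intro l2_inner_add_right) (auto intro: l2_sum)
  with insert show ?case by simp
qed simp

text \<open>
  Expand the square of the norm of \<open>\<xi> - \<Sum>\<^sub>i \<langle>e\<^sub>i, \<xi>\<rangle> e\<^sub>i\<close>.
\<close>

lemma Bessel:
  assumes "finite A" "\<xi> \<in> l2 J" and e: "\<And>i. i \<in> A \<Longrightarrow> e i \<in> l2 J"
    and on: "\<And>i j. i \<in> A \<Longrightarrow> j \<in> A \<Longrightarrow> l2_inner (e i) (e j) = (if i = j then 1 else 0)"
  shows "(\<Sum>i\<in>A. (cmod (l2_inner (e i) \<xi>))\<^sup>2) \<le> (l2_norm \<xi>)\<^sup>2"
proof -
  define \<pi> where "\<pi> = (\<lambda>x. \<Sum>i\<in>A. l2_inner (e i) \<xi> * e i x)"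
  define s where "s = (\<Sum>i\<in>A. (cmod (l2_inner (e i) \<xi>))\<^sup>2)"
  have \<pi>: "\<pi> \<in> l2 J" unfolding \<pi>_def using assms by (intro l2_sum l2_scale)
  have inner: "l2_inner \<zeta> \<pi> = (\<Sum>i\<in>A. l2_inner (e i) \<xi> * l2_inner \<zeta> (e i))" if "\<zeta> \<in> l2 J" for \<zeta>
    unfolding \<pi>_def using that assms
    by (subst l2_inner_sum_right) (auto simp: l2_scale l2_inner_scale_right)
  have "l2_inner \<xi> \<pi> = (\<Sum>i\<in>A. l2_inner (e i) \<xi> * cnj (l2_inner (e i) \<xi>))"
    using inner[OF assms(2)] by (simp add: l2_inner_commute[of \<xi> "e i" for i])
  also have "\<dots> = complex_of_real s"
    unfolding s_def by (simp add: complex_norm_square del: of_real_power)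
  finally have 1: "l2_inner \<xi> \<pi> = complex_of_real s" .
  have ei: "l2_inner (e i) \<pi> = l2_inner (e i) \<xi>" if "i \<in> A" for i
  proof -
    have "l2_inner (e i) \<pi> = (\<Sum>j\<in>A. l2_inner (e j) \<xi> * (if i = j then 1 else 0))"
      using inner[OF e[OF that]] on that by simp
    then show ?thesis using that assms(1) by (simp add: if_distrib cong: if_cong)
  qed
  have "l2_inner \<pi> \<pi> = (\<Sum>i\<in>A. l2_inner (e i) \<xi> * cnj (l2_inner (e i) \<pi>))"
    using inner[OF \<pi>] by (simp add: l2_inner_commute[of \<pi> "e i" for i])
  also have "\<dots> = complex_of_real s"
    unfolding s_def by (simp add: complex_norm_square ei del: of_real_power)
  finally have "(l2_norm \<pi>)\<^sup>2 = s"
    unfolding l2_inner_self[OF \<pi>] of_real_eq_iff .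
  with l2_norm_diff_sq[OF assms(2) \<pi>] 1 have "(l2_norm (\<lambda>x. \<xi> x - \<pi> x))\<^sup>2 = (l2_norm \<xi>)\<^sup>2 - s"
    by simp
  then show ?thesis
    unfolding s_def[symmetric] using zero_le_power2[of "l2_norm (\<lambda>x. \<xi> x - \<pi> x)"] by linarith
qed

section \<open>Compact operators have singular values\<close>

lemma bounded_opr_l2: "bounded_opr J T \<Longrightarrow> \<xi> \<in> l2 J \<Longrightarrow> T \<xi> \<in> l2 J"
  by (auto simp: bounded_opr_def)

lemma bounded_opr_add:
  "bounded_opr J T \<Longrightarrow> \<xi> \<in> l2 J \<Longrightarrow> \<eta> \<in> l2 J \<Longrightarrow> T (\<lambda>x. \<xi> x + \<eta> x) = (\<lambda>x. T \<xi> x + T \<eta> x)"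
  by (simp add: bounded_opr_def)

lemma bounded_opr_scale: "bounded_opr J T \<Longrightarrow> \<xi> \<in> l2 J \<Longrightarrow> T (\<lambda>x. c * \<xi> x) = (\<lambda>x. c * T \<xi> x)"
  by (simp add: bounded_opr_def)

lemma bounded_opr_zero: "bounded_opr J T \<Longrightarrow> T (\<lambda>_. 0) = (\<lambda>_. 0)"
  using bounded_opr_scale[of J T "\<lambda>_. 0" 0] by simp

lemma bounded_opr_diff:
  assumes "bounded_opr J T" "\<xi> \<in> l2 J" "\<eta> \<in> l2 J"
  shows "T (\<lambda>x. \<xi> x - \<eta> x) = (\<lambda>x. T \<xi> x - T \<eta> x)"
  using bounded_opr_add[OF assms(1,2) l2_scale[OF assms(3), of "-1"]]
    bounded_opr_scale[OF assms(1,3), of "-1"] by simp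

lemma bounded_opr_sum:
  assumes "bounded_opr J T" "finite A" "\<And>i. i \<in> A \<Longrightarrow> f i \<in> l2 J"
  shows "T (\<lambda>x. \<Sum>i\<in>A. f i x) = (\<lambda>x. \<Sum>i\<in>A. T (f i) x)"
  using assms(2,3)
proof (induction A rule: finite_induct)
  case (insert a A)
  then have "T (\<lambda>x. f a x + (\<Sum>i\<in>A. f i x)) = (\<lambda>x. T (f a) x + T (\<lambda>x. \<Sum>i\<in>A. f i x) x)"
    by (intro bounded_opr_add[OF assms(1)] l2_sum) auto
  with insert show ?case by simp
qed (simp add: bounded_opr_zero[OF assms(1)])

lemma bounded_opr_bound:
  assumes "bounded_opr J T"
  obtains C where "0 \<le> C" "\<And>\<xi>. \<xi> \<in> l2 J \<Longrightarrow> l2_norm (T \<xi>) \<le> C * l2_norm \<xi>"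
proof -
  obtain C where C: "\<And>\<xi>. \<xi> \<in> l2 J \<Longrightarrow> l2_norm (T \<xi>) \<le> C * l2_norm \<xi>"
    using assms unfolding bounded_opr_def by blast
  have "l2_norm (T \<xi>) \<le> max C 0 * l2_norm \<xi>" if "\<xi> \<in> l2 J" for \<xi>
    using C[OF that] by (rule order_trans) (simp add: mult_right_mono)
  then show thesis by (intro that[of "max C 0"]) auto
qed

text \<open>
  As a linear combination of basis vectors, a truncation can be passed through a linear operator termwise.
\<close>

definition truncate_on :: "'b set \<Rightarrow> ('b \<Rightarrow> complex) \<Rightarrow> 'b \<Rightarrow> complex" where
  "truncate_on F \<xi> = (\<lambda>x. \<Sum>y\<in>F. \<xi> y * basis_vec y x)"

lemma truncate_on_eq: "finite F \<Longrightarrow> truncate_on F \<xi> x = (if x \<in> F then \<xi> x else 0)"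
  by (simp add: truncate_on_def basis_vec_def if_distrib cong: if_cong)

lemma truncate_on_l2: "finite F \<Longrightarrow> F \<subseteq> J \<Longrightarrow> truncate_on F \<xi> \<in> l2 J"
  unfolding truncate_on_def by (intro l2_sum l2_scale basis_vec_l2) auto

lemma l2_norm_truncate_on:
  assumes "finite F"
  shows "l2_norm (truncate_on F \<xi>) = L2_set (\<lambda>x. cmod (\<xi> x)) F"
proof -
  have "(\<Sum>\<^sub>\<infinity>x. (cmod (truncate_on F \<xi> x))\<^sup>2) = (\<Sum>\<^sub>\<infinity>x\<in>F. (cmod (\<xi> x))\<^sup>2)"
    by (rule infsum_cong_neutral) (auto simp: truncate_on_eq[OF assms])
  then show ?thesis unfolding l2_norm_def L2_set_def using assms by simp
qed

lemma l2_inner_truncate_on: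
  assumes "finite F"
  shows "l2_inner \<zeta> (truncate_on F \<eta>) = (\<Sum>x\<in>F. cnj (\<zeta> x) * \<eta> x)"
proof -
  have "l2_inner \<zeta> (truncate_on F \<eta>) = (\<Sum>\<^sub>\<infinity>x\<in>F. cnj (\<zeta> x) * \<eta> x)"
    unfolding l2_inner_def by (rule infsum_cong_neutral) (auto simp: truncate_on_eq[OF assms])
  then show ?thesis using assms by simp
qed

lemma truncate_on_dense:
  assumes "\<xi> \<in> l2 J" "0 < \<epsilon>"
  obtains F where "finite F" "F \<subseteq> J" "l2_norm (\<lambda>x. \<xi> x - truncate_on F \<xi> x) \<le> \<epsilon>"
proof -
  obtain F where F: "finite F" and
    le: "dist (\<Sum>x\<in>F. (cmod (\<xi> x))\<^sup>2) (\<Sum>\<^sub>\<infinity>x. (cmod (\<xi> x))\<^sup>2) \<le> \<epsilon>\<^sup>2"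
    using infsum_finite_approximation[OF l2_summable[OF assms(1)], of "\<epsilon>\<^sup>2"] assms(2) by auto
  let ?F = "F \<inter> J"
  have F': "finite ?F" using F by simp
  have J: "truncate_on ?F \<xi> \<in> l2 J" by (rule truncate_on_l2) (use F in auto)
  have eq: "(\<Sum>x\<in>?F. (cmod (\<xi> x))\<^sup>2) = (\<Sum>x\<in>F. (cmod (\<xi> x))\<^sup>2)"
    using F l2_vanish[OF assms(1)] by (intro sum.mono_neutral_left) auto
  have "l2_norm (\<lambda>x. \<xi> x - truncate_on ?F \<xi> x) \<le> \<epsilon>"
  proof (rule l2_boundedI(2)[where J = J])
    show "\<xi> x - truncate_on ?F \<xi> x = 0" if "x \<notin> J" for x
      using that assms(1) by (simp add: truncate_on_eq[OF F'] l2_vanish)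
    fix G :: "'a set" assume G: "finite G"
    have "(\<Sum>x\<in>G. (cmod (\<xi> x - truncate_on ?F \<xi> x))\<^sup>2) = (\<Sum>x\<in>G - ?F. (cmod (\<xi> x))\<^sup>2)"
      using G by (intro sum.mono_neutral_cong_right) (auto simp: truncate_on_eq[OF F'])
    moreover have "(\<Sum>x\<in>G - ?F. (cmod (\<xi> x))\<^sup>2) + (\<Sum>x\<in>?F. (cmod (\<xi> x))\<^sup>2)
        = (\<Sum>x\<in>(G - ?F) \<union> ?F. (cmod (\<xi> x))\<^sup>2)"
      by (rule sum.union_disjoint[symmetric]) (use G F in auto)
    moreover have "\<dots> \<le> (\<Sum>\<^sub>\<infinity>x. (cmod (\<xi> x))\<^sup>2)"
      using G F l2_summable[OF assms(1)] by (intro finite_sum_le_infsum) auto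
    moreover have "(\<Sum>\<^sub>\<infinity>x. (cmod (\<xi> x))\<^sup>2) \<le> (\<Sum>x\<in>F. (cmod (\<xi> x))\<^sup>2) + \<epsilon>\<^sup>2"
      using le by (simp add: dist_real_def)
    ultimately have "(\<Sum>x\<in>G. (cmod (\<xi> x - truncate_on ?F \<xi> x))\<^sup>2) \<le> \<epsilon>\<^sup>2"
      using eq by linarith
    then show "L2_set (\<lambda>x. cmod (\<xi> x - truncate_on ?F \<xi> x)) G \<le> \<epsilon>"
      unfolding L2_set_def using assms(2) by (simp add: real_le_lsqrt)
  qed
  then show thesis using that[of ?F] F by auto
qed

text \<open>
  The coordinates of \<open>A \<xi>\<close> are forced: they are the inner products of \<open>\<xi>\<close> with the images of the basis
  vectors. Testing \<open>A \<xi>\<close> against its own truncations bounds its norm, and the adjoint relation, clear for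
  finitely supported vectors, extends to all of \<open>l2 J\<close> by density.
\<close>

theorem adjoint_exists:
  assumes T: "bounded_opr J T"
  obtains A where "adjoint_opr J T A"
proof -
  obtain C where C: "0 \<le> C" "\<And>\<xi>. \<xi> \<in> l2 J \<Longrightarrow> l2_norm (T \<xi>) \<le> C * l2_norm \<xi>"
    using bounded_opr_bound[OF T] by blast
  define A where "A = (\<lambda>\<xi> x. if x \<in> J then l2_inner (T (basis_vec x)) \<xi> else 0)"
  have Tb: "T (basis_vec x) \<in> l2 J" if "x \<in> J" for x
    by (intro bounded_opr_l2[OF T] basis_vec_l2 that)
  have trunc: "l2_inner \<xi> (T (truncate_on F \<eta>)) = l2_inner (A \<xi>) (truncate_on F \<eta>)"
    if "finite F" "F \<subseteq> J" "\<xi> \<in> l2 J" for \<xi> \<eta> F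
  proof -
    have "T (truncate_on F \<eta>) = (\<lambda>x. \<Sum>y\<in>F. \<eta> y * T (basis_vec y) x)"
      unfolding truncate_on_def using that basis_vec_l2[of _ J]
      by (subst bounded_opr_sum[OF T])
        (auto intro!: l2_scale sum.cong simp: bounded_opr_scale[OF T] subset_iff fun_eq_iff)
    then have "l2_inner \<xi> (T (truncate_on F \<eta>)) = (\<Sum>y\<in>F. \<eta> y * l2_inner \<xi> (T (basis_vec y)))"
      using that Tb by (simp add: l2_inner_sum_right[of F \<xi> J] l2_scale l2_inner_scale_right subset_iff)
    also have "\<dots> = l2_inner (A \<xi>) (truncate_on F \<eta>)"
      unfolding l2_inner_truncate_on[OF that(1)] using that(2)
      by (intro sum.cong) (auto simp: A_def l2_inner_commute[of \<xi> "T (basis_vec y)" for y])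
    finally show ?thesis .
  qed
  have A_l2: "A \<xi> \<in> l2 J" and A_bound: "l2_norm (A \<xi>) \<le> C * l2_norm \<xi>" if \<xi>: "\<xi> \<in> l2 J" for \<xi>
  proof -
    have *: "L2_set (\<lambda>x. cmod (A \<xi> x)) F \<le> C * l2_norm \<xi>" if F: "finite F" for F
    proof -
      let ?F = "F \<inter> J"
      define q where "q = L2_set (\<lambda>x. cmod (A \<xi> x)) ?F"
      have F': "finite ?F" using F by simp
      have q: "l2_norm (truncate_on ?F (A \<xi>)) = q"
        unfolding q_def by (rule l2_norm_truncate_on[OF F'])
      have L: "truncate_on ?F (A \<xi>) \<in> l2 J" by (rule truncate_on_l2[OF F']) auto
      have "q\<^sup>2 = (\<Sum>x\<in>?F. (cmod (A \<xi> x))\<^sup>2)"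
        unfolding q_def L2_set_def by (simp add: sum_nonneg)
      then have "complex_of_real (q\<^sup>2) = (\<Sum>x\<in>?F. cnj (A \<xi> x) * A \<xi> x)"
        by (simp add: complex_norm_square mult.commute del: of_real_power)
      also have "\<dots> = l2_inner (A \<xi>) (truncate_on ?F (A \<xi>))"
        by (simp add: l2_inner_truncate_on[OF F'])
      also have "\<dots> = l2_inner \<xi> (T (truncate_on ?F (A \<xi>)))"
        using trunc[OF F' _ \<xi>] by simp
      finally have "q\<^sup>2 = cmod (l2_inner \<xi> (T (truncate_on ?F (A \<xi>))))"
        by (metis abs_of_nonneg norm_of_real zero_le_power2)
      also have "\<dots> \<le> l2_norm \<xi> * l2_norm (T (truncate_on ?F (A \<xi>)))"
        by (rule l2_Cauchy_Schwarz[OF \<xi> bounded_opr_l2[OF T L]])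
      also have "\<dots> \<le> l2_norm \<xi> * (C * q)"
        using C(2)[OF L] unfolding q by (intro mult_left_mono) auto
      finally have "q * q \<le> (C * l2_norm \<xi>) * q"
        by (simp add: power2_eq_square mult_ac)
      then have "q \<le> C * l2_norm \<xi>"
        using C(1) by (cases "q = 0") (auto simp: q_def mult_le_cancel_right L2_set_nonneg less_le)
      moreover have "L2_set (\<lambda>x. cmod (A \<xi> x)) F = q"
        unfolding q_def L2_set_def using F by (intro arg_cong[of _ _ sqrt] sum.mono_neutral_right) (auto simp: A_def)
      ultimately show ?thesis by simp
    qed
    have out: "A \<xi> x = 0" if "x \<notin> J" for x using that by (simp add: A_def)
    show "A \<xi> \<in> l2 J" "l2_norm (A \<xi>) \<le> C * l2_norm \<xi>"
      using l2_boundedI[OF out *] by blast+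
  qed
  have bA: "bounded_opr J A"
    unfolding bounded_opr_def
  proof (intro conjI ballI allI)
    show "A ` l2 J \<subseteq> l2 J" using A_l2 by auto
    show "A (\<lambda>x. \<xi> x + \<eta> x) = (\<lambda>x. A \<xi> x + A \<eta> x)" if "\<xi> \<in> l2 J" "\<eta> \<in> l2 J" for \<xi> \<eta>
      using that by (auto simp: A_def fun_eq_iff l2_inner_add_right[OF Tb])
    show "A (\<lambda>x. c * \<xi> x) = (\<lambda>x. c * A \<xi> x)" if "\<xi> \<in> l2 J" for \<xi> c
      by (auto simp: A_def fun_eq_iff l2_inner_scale_right)
    show "\<exists>C. \<forall>\<xi>\<in>l2 J. l2_norm (A \<xi>) \<le> C * l2_norm \<xi>"
      using A_bound by blast
  qed
  have "l2_inner (A \<xi>) \<eta> = l2_inner \<xi> (T \<eta>)" if \<xi>: "\<xi> \<in> l2 J" and \<eta>: "\<eta> \<in> l2 J" for \<xi> \<eta>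
  proof -
    define D where "D = cmod (l2_inner (A \<xi>) \<eta> - l2_inner \<xi> (T \<eta>))"
    have *: "D \<le> 2 * C * l2_norm \<xi> * \<epsilon>" if "0 < \<epsilon>" for \<epsilon>
    proof -
      obtain F where F: "finite F" "F \<subseteq> J" "l2_norm (\<lambda>x. \<eta> x - truncate_on F \<eta> x) \<le> \<epsilon>"
        by (rule truncate_on_dense[OF \<eta> \<open>0 < \<epsilon>\<close>])
      let ?t = "truncate_on F \<eta>" and ?d = "\<lambda>x. \<eta> x - truncate_on F \<eta> x"
      have t: "?t \<in> l2 J" by (rule truncate_on_l2[OF F(1,2)])
      have d: "?d \<in> l2 J" by (rule l2_diff[OF \<eta> t])
      have "l2_inner (A \<xi>) \<eta> - l2_inner \<xi> (T \<eta>) = l2_inner (A \<xi>) ?d - l2_inner \<xi> (T ?d)"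
        using trunc[OF F(1,2) \<xi>, of \<eta>] \<xi> \<eta> t A_l2
        by (simp add: bounded_opr_diff[OF T] l2_inner_diff_right[of _ J] bounded_opr_l2[OF T])
      then have "D \<le> cmod (l2_inner (A \<xi>) ?d) + cmod (l2_inner \<xi> (T ?d))"
        unfolding D_def using norm_triangle_ineq4 by simp
      also have "\<dots> \<le> l2_norm (A \<xi>) * l2_norm ?d + l2_norm \<xi> * l2_norm (T ?d)"
        using \<xi> d A_l2 bounded_opr_l2[OF T] by (intro add_mono l2_Cauchy_Schwarz) auto
      also have "\<dots> \<le> (C * l2_norm \<xi>) * \<epsilon> + l2_norm \<xi> * (C * \<epsilon>)"
        using A_bound[OF \<xi>] F(3) C(1) order_trans[OF C(2)[OF d] mult_left_mono[OF F(3) C(1)]]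
        by (intro add_mono mult_mono) auto
      finally show ?thesis by (simp add: algebra_simps)
    qed
    have "D \<le> 0"
    proof (rule ccontr)
      assume D: "\<not> D \<le> 0"
      \<comment> \<open>the choice \<open>\<epsilon> = D / (2 (B + 1))\<close> gives \<open>D \<le> D / 2\<close>\<close>
      define B where "B = 2 * C * l2_norm \<xi>"
      have "0 \<le> B" unfolding B_def using C by simp
      moreover have "D \<le> B * (D / (2 * (B + 1)))"
        using *[of "D / (2 * (B + 1))"] D \<open>0 \<le> B\<close> unfolding B_def by simp
      ultimately have "D * (2 * (B + 1)) \<le> B * D"
        by (simp add: field_simps)
      then show False using D \<open>0 \<le> B\<close> by (auto simp: algebra_simps)
         (smt (verit) mult_nonneg_nonneg)
    qed
    then show ?thesis unfolding D_def by simp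
  qed
  with bA show thesis by (intro that[of A]) (auto simp: adjoint_opr_def)
qed

lemma adjoint_inner:
  "adjoint_opr J T A \<Longrightarrow> \<xi> \<in> l2 J \<Longrightarrow> \<eta> \<in> l2 J \<Longrightarrow> l2_inner (A \<xi>) \<eta> = l2_inner \<xi> (T \<eta>)"
  by (simp add: adjoint_opr_def)

text \<open>
  The singular vectors of \<open>T\<close> are eigenvectors of \<open>A \<circ> T = T\<^sup>*T\<close>. They are constructed one after the other, each
  maximising \<open>\<parallel>T \<xi>\<parallel>\<close> on the unit ball of the orthogonal complement of its predecessors.
\<close>

locale compact_with_adjoint =
  fixes J :: "'b set" and T A :: "'b opr"
  assumes cT: "compact_opr J T" and adj: "adjoint_opr J T A"
begin

lemma bT: "bounded_opr J T"
  using cT by (simp add: compact_opr_def)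

lemma bA: "bounded_opr J A"
  using adj by (simp add: adjoint_opr_def)

lemmas T_l2 = bounded_opr_l2[OF bT] and A_l2 = bounded_opr_l2[OF bA]

lemma square_l2: "\<xi> \<in> l2 J \<Longrightarrow> A (T \<xi>) \<in> l2 J"
  by (intro T_l2 A_l2)

lemma square_inner: "\<xi> \<in> l2 J \<Longrightarrow> \<eta> \<in> l2 J \<Longrightarrow> l2_inner (A (T \<xi>)) \<eta> = l2_inner (T \<xi>) (T \<eta>)"
  by (rule adjoint_inner[OF adj T_l2])

lemma square_diff:
  "\<xi> \<in> l2 J \<Longrightarrow> \<eta> \<in> l2 J \<Longrightarrow> A (T (\<lambda>x. \<xi> x - \<eta> x)) = (\<lambda>x. A (T \<xi>) x - A (T \<eta>) x)"
  by (simp add: bounded_opr_diff[OF bT] bounded_opr_diff[OF bA] T_l2)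

definition perp :: "('b \<Rightarrow> complex) set \<Rightarrow> ('b \<Rightarrow> complex) set" where
  "perp F = {\<xi> \<in> l2 J. \<forall>f\<in>F. l2_inner f \<xi> = 0}"

text \<open>
  The norm of the restriction of \<open>T\<close> to the orthogonal complement of \<open>F\<close>.
\<close>

definition opn :: "('b \<Rightarrow> complex) set \<Rightarrow> real" where
  "opn F = Sup {l2_norm (T \<xi>) |\<xi>. \<xi> \<in> perp F \<and> l2_norm \<xi> \<le> 1}"

lemma perp_l2: "\<xi> \<in> perp F \<Longrightarrow> \<xi> \<in> l2 J"
  by (simp add: perp_def)

lemma perp_scale: "\<xi> \<in> perp F \<Longrightarrow> (\<lambda>x. c * \<xi> x) \<in> perp F"
  by (simp add: perp_def l2_scale l2_inner_scale_right)

lemma zero_perp: "(\<lambda>_. 0) \<in> perp F"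
  by (simp add: perp_def)

lemma opn_set:
  "{l2_norm (T \<xi>) |\<xi>. \<xi> \<in> perp F \<and> l2_norm \<xi> \<le> 1} \<noteq> {}"
  "bdd_above {l2_norm (T \<xi>) |\<xi>. \<xi> \<in> perp F \<and> l2_norm \<xi> \<le> 1}"
proof -
  show "{l2_norm (T \<xi>) |\<xi>. \<xi> \<in> perp F \<and> l2_norm \<xi> \<le> 1} \<noteq> {}"
    using zero_perp[of F] by (auto intro!: exI[of _ "\<lambda>_. 0"])
  obtain C where C: "0 \<le> C" "\<And>\<xi>. \<xi> \<in> l2 J \<Longrightarrow> l2_norm (T \<xi>) \<le> C * l2_norm \<xi>"
    using bounded_opr_bound[OF bT] by blast
  have "l2_norm (T \<xi>) \<le> C" if "\<xi> \<in> perp F" "l2_norm \<xi> \<le> 1" for \<xi>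
    using C(2)[OF perp_l2[OF that(1)]] mult_left_mono[OF that(2) C(1)] by simp
  then show "bdd_above {l2_norm (T \<xi>) |\<xi>. \<xi> \<in> perp F \<and> l2_norm \<xi> \<le> 1}"
    by (intro bdd_aboveI[of _ C]) auto
qed

lemma opn_nonneg: "0 \<le> opn F"
proof -
  have "l2_norm (T (\<lambda>_. 0)) \<le> opn F"
    unfolding opn_def by (rule cSup_upper[OF _ opn_set(2)]) (use zero_perp in auto)
  then show ?thesis using l2_norm_ge_0 order_trans by blast
qed

lemma opn_bound:
  assumes "\<xi> \<in> perp F"
  shows "l2_norm (T \<xi>) \<le> opn F * l2_norm \<xi>"
proof (cases "l2_norm \<xi> = 0")
  case True
  then have "\<xi> = (\<lambda>_. 0)" using l2_norm_eq_0[OF perp_l2[OF assms]] by simp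
  then show ?thesis by (simp add: bounded_opr_zero[OF bT])
next
  case False
  define n where "n = l2_norm \<xi>"
  have n: "0 < n" using False l2_norm_ge_0[of \<xi>] unfolding n_def by linarith
  let ?\<eta> = "\<lambda>x. complex_of_real (1 / n) * \<xi> x"
  have "l2_norm ?\<eta> = 1" unfolding l2_norm_scale using n by (simp add: n_def norm_divide)
  then have "l2_norm (T ?\<eta>) \<le> opn F"
    unfolding opn_def using perp_scale[OF assms, of "complex_of_real (1 / n)"]
    by (intro cSup_upper[OF _ opn_set(2)] CollectI exI[of _ ?\<eta>]) simp
  also have "T ?\<eta> = (\<lambda>x. complex_of_real (1 / n) * T \<xi> x)"
    by (rule bounded_opr_scale[OF bT perp_l2[OF assms]])
  finally show ?thesis
    unfolding l2_norm_scale using n by (simp add: n_def[symmetric] norm_divide field_simps)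
qed

lemma opn_antimono: "F \<subseteq> F' \<Longrightarrow> opn F' \<le> opn F"
  unfolding opn_def by (intro cSup_subset_mono opn_set) (auto simp: perp_def)

text \<open>
  A maximising sequence for \<open>\<parallel>T \<xi>\<parallel>\<close> on the unit ball of an invariant subspace consists of approximate
  eigenvectors of \<open>T\<^sup>*T\<close>; compactness turns it into an eigenvector.
\<close>

lemma maximiser_exists:
  assumes inv: "\<And>\<xi>. \<xi> \<in> perp F \<Longrightarrow> A (T \<xi>) \<in> perp F" and F: "F \<subseteq> l2 J" and pos: "0 < opn F"
  shows "\<exists>e \<in> perp F. l2_norm e = 1 \<and> A (T e) = (\<lambda>x. complex_of_real ((opn F)\<^sup>2) * e x)"
proof -
  define s where "s = opn F"
  have s: "0 < s" using pos by (simp add: s_def)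
  have "\<exists>\<xi>. \<xi> \<in> perp F \<and> l2_norm \<xi> \<le> 1 \<and> s - inverse (real (Suc k)) < l2_norm (T \<xi>)" for k
    using less_cSupD[OF opn_set(1), of "s - inverse (real (Suc k))" F]
    unfolding s_def[unfolded opn_def] by fastforce
  then obtain \<xi> where \<xi>: "\<And>k. \<xi> k \<in> perp F" "\<And>k. l2_norm (\<xi> k) \<le> 1"
    "\<And>k. s - inverse (real (Suc k)) < l2_norm (T (\<xi> k))" by metis
  have "\<forall>k. \<xi> k \<in> l2 J \<and> l2_norm (\<xi> k) \<le> 1" using \<xi> perp_l2 by blast
  then obtain r \<zeta> where r: "strict_mono r" and \<zeta>: "\<zeta> \<in> l2 J"
    and lim: "(\<lambda>n. l2_norm (\<lambda>x. T (\<xi> (r n)) x - \<zeta> x)) \<longlonglongrightarrow> 0"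
    using cT unfolding compact_opr_def by blast
  define a where "a k = \<xi> (r k)" for k
  define t where "t k = l2_norm (T (a k))" for k
  have a: "a k \<in> perp F" "a k \<in> l2 J" "l2_norm (a k) \<le> 1" for k
    unfolding a_def by (rule \<xi>(1), rule perp_l2[OF \<xi>(1)], rule \<xi>(2))
  have t_le: "t k \<le> s * l2_norm (a k)" for k
    unfolding t_def s_def by (rule opn_bound[OF a(1)])
  have t_s: "t k \<le> s" for k
    using t_le[of k] mult_left_mono[OF a(3)[of k], of s] s by linarith
  have t: "t \<longlonglongrightarrow> s"
  proof (rule tendsto_sandwich[of "\<lambda>k. s - inverse (real (Suc k))" _ _ "\<lambda>_. s"])
    have "s - inverse (real (Suc k)) \<le> t k" for k
    proof -
      have "inverse (real (Suc (r k))) \<le> inverse (real (Suc k))"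
        using seq_suble[OF r, of k] by (simp add: field_simps)
      then show ?thesis using \<xi>(3)[of "r k"] unfolding t_def a_def by linarith
    qed
    then show "\<forall>\<^sub>F k in sequentially. s - inverse (real (Suc k)) \<le> t k" by simp
    show "(\<lambda>k. s - inverse (real (Suc k))) \<longlonglongrightarrow> s"
      using tendsto_diff[OF tendsto_const LIMSEQ_inverse_real_of_nat, of s] by simp
  qed (use t_s in auto)
  define \<psi> where "\<psi> = A \<zeta>"
  have \<psi>: "\<psi> \<in> l2 J" unfolding \<psi>_def by (rule A_l2[OF \<zeta>])
  define e where "e = (\<lambda>x. complex_of_real (1 / s\<^sup>2) * \<psi> x)"
  have e: "e \<in> l2 J" unfolding e_def by (rule l2_scale[OF \<psi>])
  have se: "(\<lambda>x. complex_of_real (s\<^sup>2) * e x) = \<psi>" using s by (simp add: e_def fun_eq_iff)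
  define sa where "sa k = (\<lambda>x. complex_of_real (s\<^sup>2) * a k x)" for k
  have sa: "sa k \<in> l2 J" for k unfolding sa_def by (rule l2_scale[OF a(2)])
  have Ha: "A (T (a k)) \<in> l2 J" for k by (rule square_l2[OF a(2)])
  obtain C where C: "0 \<le> C" "\<And>\<xi>. \<xi> \<in> l2 J \<Longrightarrow> l2_norm (A \<xi>) \<le> C * l2_norm \<xi>"
    using bounded_opr_bound[OF bA] by blast
  obtain C' where C': "0 \<le> C'" "\<And>\<xi>. \<xi> \<in> l2 J \<Longrightarrow> l2_norm (T \<xi>) \<le> C' * l2_norm \<xi>"
    using bounded_opr_bound[OF bT] by blast
  have conv1: "(\<lambda>k. l2_norm (\<lambda>x. A (T (a k)) x - \<psi> x)) \<longlonglongrightarrow> 0"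
  proof (rule tendsto_sandwich[of "\<lambda>_. 0" _ _ "\<lambda>k. C * l2_norm (\<lambda>x. T (a k) x - \<zeta> x)"])
    have "l2_norm (\<lambda>x. A (T (a k)) x - \<psi> x) \<le> C * l2_norm (\<lambda>x. T (a k) x - \<zeta> x)" for k
      using C(2)[OF l2_diff[OF T_l2[OF a(2)[of k]] \<zeta>]]
      unfolding \<psi>_def by (simp add: bounded_opr_diff[OF bA T_l2[OF a(2)] \<zeta>])
    then show "\<forall>\<^sub>F k in sequentially. l2_norm (\<lambda>x. A (T (a k)) x - \<psi> x) \<le> C * l2_norm (\<lambda>x. T (a k) x - \<zeta> x)"
      by simp
    show "(\<lambda>k. C * l2_norm (\<lambda>x. T (a k) x - \<zeta> x)) \<longlonglongrightarrow> 0"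
      using tendsto_mult_right_zero[OF lim] by (simp add: a_def)
  qed auto
  \<comment> \<open>maximality gives \<open>\<parallel>T\<^sup>*T a\<parallel> \<le> s \<parallel>T a\<parallel>\<close>, so that \<open>\<parallel>T\<^sup>*T a - s\<^sup>2 a\<parallel>\<^sup>2 \<le> s\<^sup>2 (s\<^sup>2 - \<parallel>T a\<parallel>\<^sup>2)\<close>\<close>
  have conv2: "(\<lambda>k. l2_norm (\<lambda>x. A (T (a k)) x - sa k x)) \<longlonglongrightarrow> 0"
  proof (rule tendsto_sandwich[of "\<lambda>_. 0" _ _ "\<lambda>k. sqrt (s\<^sup>2 * (s\<^sup>2 - (t k)\<^sup>2))"])
    have "l2_norm (\<lambda>x. A (T (a k)) x - sa k x) \<le> sqrt (s\<^sup>2 * (s\<^sup>2 - (t k)\<^sup>2))" for k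
    proof -
      define h where "h = l2_norm (A (T (a k)))"
      have "complex_of_real (h\<^sup>2) = l2_inner (T (a k)) (T (A (T (a k))))"
        unfolding h_def by (simp only: l2_inner_self[OF Ha, symmetric] square_inner[OF a(2) Ha])
      then have "h\<^sup>2 = cmod (l2_inner (T (a k)) (T (A (T (a k)))))"
        by (metis abs_of_nonneg norm_of_real zero_le_power2)
      also have "\<dots> \<le> t k * l2_norm (T (A (T (a k))))"
        unfolding t_def by (rule l2_Cauchy_Schwarz[OF T_l2[OF a(2)] T_l2[OF Ha]])
      also have "\<dots> \<le> t k * (s * h)"
        unfolding h_def s_def by (intro mult_left_mono opn_bound inv a) (simp add: t_def)
      finally have "h * h \<le> (s * t k) * h" by (simp add: power2_eq_square mult_ac)
      then have "h \<le> s * t k"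
        using s by (cases "h = 0") (auto simp: h_def t_def mult_le_cancel_right less_le)
      then have h2: "h\<^sup>2 \<le> s\<^sup>2 * (t k)\<^sup>2"
        unfolding power_mult_distrib[symmetric] by (rule power_mono) (simp add: h_def)
      have "l2_inner (A (T (a k))) (sa k) = complex_of_real (s\<^sup>2 * (t k)\<^sup>2)"
        unfolding sa_def l2_inner_scale_right square_inner[OF a(2) a(2)] t_def
        by (simp only: l2_inner_self[OF T_l2[OF a(2)]] of_real_mult)
      then have "(l2_norm (\<lambda>x. A (T (a k)) x - sa k x))\<^sup>2 = h\<^sup>2 - 2 * (s\<^sup>2 * (t k)\<^sup>2) + (l2_norm (sa k))\<^sup>2"
        unfolding l2_norm_diff_sq[OF Ha sa] h_def by simp
      also have "l2_norm (sa k) = s\<^sup>2 * l2_norm (a k)"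
        unfolding sa_def l2_norm_scale by (simp add: norm_power)
      also have "(s\<^sup>2 * l2_norm (a k))\<^sup>2 \<le> (s\<^sup>2 * 1)\<^sup>2"
        using a(3)[of k] by (intro power_mono mult_left_mono) auto
      finally have "(l2_norm (\<lambda>x. A (T (a k)) x - sa k x))\<^sup>2 \<le> s\<^sup>2 * (s\<^sup>2 - (t k)\<^sup>2)"
        using h2 by (simp add: algebra_simps power2_eq_square)
      then show ?thesis by (rule real_le_rsqrt)
    qed
    then show "\<forall>\<^sub>F k in sequentially. l2_norm (\<lambda>x. A (T (a k)) x - sa k x) \<le> sqrt (s\<^sup>2 * (s\<^sup>2 - (t k)\<^sup>2))"
      by simp
    have "(\<lambda>k. sqrt (s\<^sup>2 * (s\<^sup>2 - (t k)\<^sup>2))) \<longlonglongrightarrow> sqrt (s\<^sup>2 * (s\<^sup>2 - s\<^sup>2))"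
      by (intro tendsto_intros t)
    then show "(\<lambda>k. sqrt (s\<^sup>2 * (s\<^sup>2 - (t k)\<^sup>2))) \<longlonglongrightarrow> 0" by simp
  qed auto
  \<comment> \<open>the images converge by compactness, hence so do the vectors themselves\<close>
  have conv3: "(\<lambda>k. l2_norm (\<lambda>x. sa k x - \<psi> x)) \<longlonglongrightarrow> 0"
  proof (rule tendsto_sandwich[of "\<lambda>_. 0" _ _
      "\<lambda>k. l2_norm (\<lambda>x. A (T (a k)) x - sa k x) + l2_norm (\<lambda>x. A (T (a k)) x - \<psi> x)"])
    have "l2_norm (\<lambda>x. sa k x - \<psi> x) \<le>
        l2_norm (\<lambda>x. A (T (a k)) x - sa k x) + l2_norm (\<lambda>x. A (T (a k)) x - \<psi> x)" for k
      using l2_norm_diff_triangle[OF sa Ha \<psi>, of k k] l2_norm_minus_commute[of "sa k"] by simp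
    then show "\<forall>\<^sub>F k in sequentially. l2_norm (\<lambda>x. sa k x - \<psi> x) \<le>
        l2_norm (\<lambda>x. A (T (a k)) x - sa k x) + l2_norm (\<lambda>x. A (T (a k)) x - \<psi> x)" by simp
    show "(\<lambda>k. l2_norm (\<lambda>x. A (T (a k)) x - sa k x) + l2_norm (\<lambda>x. A (T (a k)) x - \<psi> x)) \<longlonglongrightarrow> 0"
      using tendsto_add[OF conv2 conv1] by simp
  qed auto
  have conv: "(\<lambda>k. l2_norm (\<lambda>x. a k x - e x)) \<longlonglongrightarrow> 0"
  proof -
    have "(\<lambda>x. a k x - e x) = (\<lambda>x. complex_of_real (1 / s\<^sup>2) * (sa k x - \<psi> x))" for k
      using s by (simp add: e_def sa_def fun_eq_iff algebra_simps)
    then have "l2_norm (\<lambda>x. a k x - e x) = (1 / s\<^sup>2) * l2_norm (\<lambda>x. sa k x - \<psi> x)" for k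
      unfolding l2_norm_scale by (simp only: l2_norm_scale) (simp add: norm_divide norm_power)
    then show ?thesis using tendsto_mult_right_zero[OF conv3, of "1 / s\<^sup>2"] by simp
  qed
  have "l2_inner f e = 0" if "f \<in> F" for f
  proof -
    have f: "f \<in> l2 J" using that F by auto
    have "cmod (l2_inner f e) \<le> l2_norm f * l2_norm (\<lambda>x. a k x - e x)" for k
    proof -
      have "l2_inner f (a k) = 0" using a(1)[of k] that by (simp add: perp_def)
      then have "cmod (l2_inner f e) = cmod (l2_inner f (\<lambda>x. a k x - e x))"
        by (simp add: l2_inner_diff_right[OF f a(2) e])
      then show ?thesis using l2_Cauchy_Schwarz[OF f l2_diff[OF a(2) e]] by simp
    qed
    then have "cmod (l2_inner f e) \<le> 0"
      using tendsto_mult_right_zero[OF conv, of "l2_norm f"]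
      by (intro LIMSEQ_le_const) auto
    then show ?thesis by simp
  qed
  then have e_perp: "e \<in> perp F" using e by (simp add: perp_def)
  have lim_a: "(\<lambda>k. l2_norm (a k)) \<longlonglongrightarrow> l2_norm e"
  proof (rule LIM_zero_cancel, rule tendsto_rabs_zero_cancel,
      rule tendsto_sandwich[of "\<lambda>_. 0" _ _ "\<lambda>k. l2_norm (\<lambda>x. a k x - e x)"])
    show "\<forall>\<^sub>F k in sequentially. \<bar>l2_norm (a k) - l2_norm e\<bar> \<le> l2_norm (\<lambda>x. a k x - e x)"
      using l2_norm_triangle_sub[OF a(2) e] by simp
  qed (use conv in auto)
  have "(\<lambda>k. l2_norm (a k)) \<longlonglongrightarrow> 1"
  proof (rule tendsto_sandwich[of "\<lambda>k. t k / s" _ _ "\<lambda>_. 1"])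
    show "\<forall>\<^sub>F k in sequentially. t k / s \<le> l2_norm (a k)"
      using t_le s by (simp add: field_simps)
    show "(\<lambda>k. t k / s) \<longlonglongrightarrow> 1" using tendsto_divide[OF t tendsto_const, of s] s by simp
  qed (use a(3) in auto)
  then have norm_e: "l2_norm e = 1" using lim_a LIMSEQ_unique by blast
  have "A (T e) = (\<lambda>x. complex_of_real (s\<^sup>2) * e x)"
  proof -
    have He: "A (T e) \<in> l2 J" by (rule square_l2[OF e])
    have "l2_norm (\<lambda>x. A (T e) x - \<psi> x) \<le>
        C * (C' * l2_norm (\<lambda>x. a k x - e x)) + l2_norm (\<lambda>x. A (T (a k)) x - \<psi> x)" for k
    proof -
      have "l2_norm (\<lambda>x. A (T e) x - \<psi> x) \<le>
          l2_norm (\<lambda>x. A (T e) x - A (T (a k)) x) + l2_norm (\<lambda>x. A (T (a k)) x - \<psi> x)"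
        by (rule l2_norm_diff_triangle[OF He Ha \<psi>])
      also have "l2_norm (\<lambda>x. A (T e) x - A (T (a k)) x) = l2_norm (A (T (\<lambda>x. a k x - e x)))"
        unfolding square_diff[OF a(2) e] by (rule l2_norm_minus_commute)
      also have "\<dots> \<le> C * l2_norm (T (\<lambda>x. a k x - e x))"
        by (intro C(2) T_l2 l2_diff a e)
      also have "\<dots> \<le> C * (C' * l2_norm (\<lambda>x. a k x - e x))"
        by (intro mult_left_mono C C'(2) l2_diff a e)
      finally show ?thesis by simp
    qed
    moreover have "(\<lambda>k. C * (C' * l2_norm (\<lambda>x. a k x - e x)) + l2_norm (\<lambda>x. A (T (a k)) x - \<psi> x)) \<longlonglongrightarrow> 0"
      using tendsto_add[OF tendsto_mult_right_zero[OF tendsto_mult_right_zero[OF conv]] conv1] by simp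
    ultimately have "l2_norm (\<lambda>x. A (T e) x - \<psi> x) \<le> 0"
      by (intro LIMSEQ_le_const) auto
    then have "l2_norm (\<lambda>x. A (T e) x - \<psi> x) = 0" using l2_norm_ge_0 order_antisym by blast
    then show ?thesis unfolding se using l2_diff_eq_0[OF He \<psi>] by simp
  qed
  with e_perp norm_e show ?thesis unfolding s_def by blast
qed

text \<open>
  Once \<open>T\<close> vanishes on the complement of \<open>F\<close>, the zero vector is chosen, and so it is from then on.
\<close>

definition next_vec :: "('b \<Rightarrow> complex) set \<Rightarrow> 'b \<Rightarrow> complex" where
  "next_vec F = (SOME e. e \<in> perp F \<and> l2_norm e = (if 0 < opn F then 1 else 0) \<and>
     A (T e) = (\<lambda>x. complex_of_real ((opn F)\<^sup>2) * e x))"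

primrec chosen :: "nat \<Rightarrow> ('b \<Rightarrow> complex) set" where
  "chosen 0 = {}"
| "chosen (Suc n) = insert (next_vec (chosen n)) (chosen n)"

definition evec :: "nat \<Rightarrow> 'b \<Rightarrow> complex" where "evec n = next_vec (chosen n)"

definition sval :: "nat \<Rightarrow> real" where "sval n = opn (chosen n)"

text \<open>
  The orthogonal complement of a set of eigenvectors with real eigenvalues is invariant under \<open>T\<^sup>*T\<close>, which
  is what the next maximisation needs.
\<close>

definition eigen_set :: "('b \<Rightarrow> complex) set \<Rightarrow> bool" where
  "eigen_set F \<longleftrightarrow> (\<forall>f\<in>F. f \<in> l2 J \<and> (\<exists>\<mu>. A (T f) = (\<lambda>x. complex_of_real \<mu> * f x)))"

lemma next_vec:
  assumes "eigen_set F"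
  shows "next_vec F \<in> perp F" "l2_norm (next_vec F) = (if 0 < opn F then 1 else 0)"
    "A (T (next_vec F)) = (\<lambda>x. complex_of_real ((opn F)\<^sup>2) * next_vec F x)"
proof -
  have "A (T \<xi>) \<in> perp F" if \<xi>: "\<xi> \<in> perp F" for \<xi>
  proof -
    have "l2_inner f (A (T \<xi>)) = 0" if f: "f \<in> F" for f
    proof -
      have fJ: "f \<in> l2 J" using f assms by (simp add: eigen_set_def)
      obtain \<mu> where \<mu>: "A (T f) = (\<lambda>x. complex_of_real \<mu> * f x)"
        using f assms by (auto simp: eigen_set_def)
      have "l2_inner f (A (T \<xi>)) = cnj (l2_inner (T \<xi>) (T f))"
        using square_inner[OF perp_l2[OF \<xi>] fJ] l2_inner_commute[of f "A (T \<xi>)"] by simp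
      also have "\<dots> = l2_inner (T f) (T \<xi>)"
        using l2_inner_commute[of "T f" "T \<xi>"] by simp
      also have "\<dots> = l2_inner (A (T f)) \<xi>"
        using square_inner[OF fJ perp_l2[OF \<xi>]] by simp
      also have "\<dots> = 0"
        unfolding \<mu> l2_inner_scale_left using \<xi> f by (simp add: perp_def)
      finally show ?thesis .
    qed
    then show ?thesis using square_l2[OF perp_l2[OF \<xi>]] by (simp add: perp_def)
  qed
  moreover have "F \<subseteq> l2 J" using assms by (auto simp: eigen_set_def)
  ultimately have ex: "\<exists>e. e \<in> perp F \<and> l2_norm e = (if 0 < opn F then 1 else 0) \<and>
      A (T e) = (\<lambda>x. complex_of_real ((opn F)\<^sup>2) * e x)"
  proof (cases "0 < opn F")
    case False
    then show ?thesis
      using opn_nonneg[of F] by (intro exI[of _ "\<lambda>_. 0"])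
        (simp add: zero_perp bounded_opr_zero[OF bT] bounded_opr_zero[OF bA])
  qed (use maximiser_exists[of F] in auto)
  show "next_vec F \<in> perp F" "l2_norm (next_vec F) = (if 0 < opn F then 1 else 0)"
    "A (T (next_vec F)) = (\<lambda>x. complex_of_real ((opn F)\<^sup>2) * next_vec F x)"
    using someI_ex[OF ex] unfolding next_vec_def by blast+
qed

lemma eigen_chosen: "eigen_set (chosen n)"
proof (induction n)
  case (Suc n)
  have "next_vec (chosen n) \<in> l2 J" by (rule perp_l2[OF next_vec(1)[OF Suc]])
  with Suc next_vec(3)[OF Suc] show ?case
    unfolding eigen_set_def chosen.simps by blast
qed (simp add: eigen_set_def)

lemmas evec_perp = next_vec(1)[OF eigen_chosen, folded evec_def]
  and evec_norm = next_vec(2)[OF eigen_chosen, folded evec_def sval_def]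
  and evec_eigen = next_vec(3)[OF eigen_chosen, folded evec_def sval_def]

lemma chosen_eq: "chosen n = evec ` {..<n}"
  by (induction n) (auto simp: evec_def lessThan_Suc)

lemma sval_nonneg: "0 \<le> sval n"
  by (simp add: sval_def opn_nonneg)

lemma decseq_sval: "decseq sval"
  unfolding decseq_def sval_def chosen_eq by (auto intro!: opn_antimono)

lemma evec_l2: "evec n \<in> l2 J"
  by (rule perp_l2[OF evec_perp])

lemma evec_orth: "l2_inner (evec m) (evec n) = (if m = n \<and> sval n > 0 then 1 else 0)"
proof -
  have *: "l2_inner (evec i) (evec j) = 0" if "i < j" for i j
    using evec_perp[of j] that by (auto simp: perp_def chosen_eq)
  have "l2_inner (evec m) (evec n) = 0" if "m \<noteq> n"
    using *[of m n] *[of n m] l2_inner_commute[of "evec m" "evec n"] that by (cases "m < n") auto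
  moreover have "l2_inner (evec n) (evec n) = (if sval n > 0 then 1 else 0)"
    by (simp add: l2_inner_self[OF evec_l2] evec_norm)
  ultimately show ?thesis by (cases "m = n") auto
qed

lemma T_evec_inner: "l2_inner (T (evec m)) (T (evec n)) = (if m = n then complex_of_real ((sval n)\<^sup>2) else 0)"
  using sval_nonneg[of n]
  by (auto simp: square_inner[OF evec_l2 evec_l2, symmetric] evec_eigen l2_inner_scale_left evec_orth)

text \<open>
  The vectors \<open>T e\<^sub>n\<close> are orthogonal with norms \<open>s\<^sub>n\<close>; if these stayed above some \<open>c > 0\<close>, no subsequence of
  \<open>T e\<^sub>n\<close> could converge.
\<close>

lemma sval_tendsto_0: "sval \<longlonglongrightarrow> 0"
proof -
  obtain c where lim: "sval \<longlonglongrightarrow> c" and c: "\<And>n. c \<le> sval n"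
    using decseq_convergent[OF decseq_sval, of 0] sval_nonneg by blast
  have c0: "0 \<le> c" using lim sval_nonneg by (intro LIMSEQ_le_const) auto
  have "\<forall>n. evec n \<in> l2 J \<and> l2_norm (evec n) \<le> 1" using evec_l2 evec_norm by simp
  then obtain r \<zeta> where r: "strict_mono r" and \<zeta>: "\<zeta> \<in> l2 J"
    and conv: "(\<lambda>n. l2_norm (\<lambda>x. T (evec (r n)) x - \<zeta> x)) \<longlonglongrightarrow> 0"
    using cT unfolding compact_opr_def by blast
  have Te: "T (evec n) \<in> l2 J" for n by (rule T_l2[OF evec_l2])
  have "c \<le> l2_norm (\<lambda>x. T (evec (r k)) x - \<zeta> x) + l2_norm (\<lambda>x. T (evec (r (Suc k))) x - \<zeta> x)" for k
  proof -
    have "r k \<noteq> r (Suc k)" using r by (simp add: strict_mono_eq)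
    then have "(l2_norm (\<lambda>x. T (evec (r k)) x - T (evec (r (Suc k))) x))\<^sup>2 =
        (sval (r k))\<^sup>2 + (l2_norm (T (evec (r (Suc k)))))\<^sup>2"
      unfolding l2_norm_diff_sq[OF Te Te]
      using T_evec_inner[of "r k" "r k", unfolded l2_inner_self[OF Te]]
      by (simp add: T_evec_inner del: of_real_power)
    then have "c\<^sup>2 \<le> (l2_norm (\<lambda>x. T (evec (r k)) x - T (evec (r (Suc k))) x))\<^sup>2"
      using power_mono[OF c[of "r k"] c0, of 2]
        zero_le_power2[of "l2_norm (T (evec (r (Suc k))))"] by linarith
    then have "c \<le> l2_norm (\<lambda>x. T (evec (r k)) x - T (evec (r (Suc k))) x)"
      by (rule power2_le_imp_le) simp
    also have "\<dots> \<le> l2_norm (\<lambda>x. T (evec (r k)) x - \<zeta> x) + l2_norm (\<lambda>x. \<zeta> x - T (evec (r (Suc k))) x)"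
      by (rule l2_norm_diff_triangle[OF Te \<zeta> Te])
    finally show ?thesis using l2_norm_minus_commute[of \<zeta>] by simp
  qed
  moreover have "(\<lambda>k. l2_norm (\<lambda>x. T (evec (r k)) x - \<zeta> x) + l2_norm (\<lambda>x. T (evec (r (Suc k))) x - \<zeta> x)) \<longlonglongrightarrow> 0"
    using tendsto_add[OF conv LIMSEQ_Suc[OF conv]] by simp
  ultimately have "c \<le> 0" by (intro LIMSEQ_le_const) auto
  with c0 lim show ?thesis by simp
qed

text \<open>
  A vector orthogonal to all \<open>e\<^sub>n\<close> satisfies \<open>\<parallel>T \<eta>\<parallel> \<le> s\<^sub>n \<parallel>\<eta>\<parallel>\<close> for every \<open>n\<close>, hence \<open>T \<eta> = 0\<close>.
\<close>

lemma singular_values_sval: "singular_values J T sval"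
  unfolding singular_values_def
proof (intro conjI exI[of _ A] exI[of _ evec] allI ballI impI)
  fix \<eta> assume \<eta>: "\<eta> \<in> l2 J" and orth: "\<forall>n. l2_inner (evec n) \<eta> = 0"
  have "\<eta> \<in> perp (chosen n)" for n using \<eta> orth by (auto simp: perp_def chosen_eq)
  then have "l2_norm (T \<eta>) \<le> sval n * l2_norm \<eta>" for n
    unfolding sval_def by (rule opn_bound)
  moreover have "(\<lambda>n. sval n * l2_norm \<eta>) \<longlonglongrightarrow> 0"
    using tendsto_mult_left_zero[OF sval_tendsto_0] .
  ultimately have "l2_norm (T \<eta>) \<le> 0" by (intro LIMSEQ_le_const) auto
  then have "T \<eta> = (\<lambda>_. 0)"
    using l2_norm_eq_0[OF T_l2[OF \<eta>]] l2_norm_ge_0 order_antisym by blast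
  then show "A (T \<eta>) = (\<lambda>_. 0)" by (simp add: bounded_opr_zero[OF bA])
qed (simp_all add: decseq_sval sval_nonneg adj evec_l2 evec_orth evec_eigen)

end

theorem compact_opr_singular_values:
  assumes "compact_opr J T"
  obtains s where "singular_values J T s"
proof -
  obtain A where "adjoint_opr J T A"
    using assms by (auto simp: compact_opr_def elim: adjoint_exists)
  with assms interpret compact_with_adjoint J T A by unfold_locales
  show thesis by (rule that[OF singular_values_sval])
qed

section \<open>A Schatten criterion for matrices\<close>

text \<open>
  The vectors \<open>f\<^sub>i = T e\<^sub>i / s\<^sub>i\<close>, \<open>i \<le> n\<close>, are orthonormal. Off \<open>S\<close> each of them has norm at most
  \<open>\<epsilon> / s\<^sub>n\<close>, while by Bessel's inequality their masses on \<open>S\<close> add up to at most \<open>card S\<close>, which is at most half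
  their number.
\<close>

lemma singular_value_le:
  assumes bT: "bounded_opr J T" and sv: "singular_values J T s"
    and S: "finite S" "S \<subseteq> J" "2 * card S \<le> Suc n" and \<epsilon>: "0 \<le> \<epsilon>"
    and tail: "\<And>\<xi> F. \<xi> \<in> l2 J \<Longrightarrow> finite F \<Longrightarrow> F \<inter> S = {} \<Longrightarrow>
      L2_set (\<lambda>x. cmod (T \<xi> x)) F \<le> \<epsilon> * l2_norm \<xi>"
  shows "s n \<le> sqrt 2 * \<epsilon>"
proof (cases "s n = 0")
  case True
  then show ?thesis using \<epsilon> by simp
next
  case False
  obtain A e where dec: "decseq s" and pos: "\<And>n. 0 \<le> s n" and adj: "adjoint_opr J T A"
    and e: "\<And>n. e n \<in> l2 J"
    and on: "\<And>m n. l2_inner (e m) (e n) = (if m = n \<and> s n > 0 then 1 else 0)"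
    and eig: "\<And>n. A (T (e n)) = (\<lambda>x. complex_of_real ((s n)\<^sup>2) * e n x)"
    using sv unfolding singular_values_def by blast
  have sn: "0 < s n" using False pos[of n] by linarith
  have si: "s n \<le> s i" if "i \<le> n" for i using dec that by (simp add: decseqD)
  have si0: "0 < s i" if "i \<le> n" for i using si[OF that] sn by linarith
  define f where "f i = (\<lambda>x. complex_of_real (1 / s i) * T (e i) x)" for i
  have Te: "T (e i) \<in> l2 J" for i by (rule bounded_opr_l2[OF bT e])
  have f: "f i \<in> l2 J" for i unfolding f_def by (rule l2_scale[OF Te])
  have Te_inner: "l2_inner (T (e i)) (T (e j)) = complex_of_real ((s i)\<^sup>2) * l2_inner (e i) (e j)" for i j
    using adjoint_inner[OF adj Te e, of i j] by (simp add: eig l2_inner_scale_left)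
  have f_on: "l2_inner (f i) (f j) = (if i = j then 1 else 0)" if "i \<le> n" "j \<le> n" for i j
    using si0[OF that(1)] si0[OF that(2)] unfolding f_def l2_inner_scale_left l2_inner_scale_right
    by (simp add: Te_inner on power2_eq_square)
  have e1: "l2_norm (e i) = 1" if "i \<le> n" for i
    using l2_inner_self[OF e, of i] on[of i i] si0[OF that]
    by (simp del: of_real_power) (metis l2_norm_ge_0 of_real_eq_1_iff power2_eq_1_iff
        abs_of_nonneg abs_1 abs_minus_cancel)
  have bound: "1 \<le> (\<Sum>x\<in>S. (cmod (f i x))\<^sup>2) + (\<epsilon> / s n)\<^sup>2" if i: "i \<le> n" for i
  proof -
    have "complex_of_real ((l2_norm (f i))\<^sup>2) = 1"
      using l2_inner_self[OF f, of i] f_on[OF i i] by simp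
    then have "1 = (l2_norm (f i))\<^sup>2" by (metis of_real_eq_1_iff)
    also have "\<dots> \<le> (\<Sum>x\<in>S. (cmod (f i x))\<^sup>2) + (\<epsilon> / s n)\<^sup>2"
      unfolding l2_norm_sq
    proof (rule infsum_le_finite_sums[OF l2_summable[OF f]])
      fix F :: "'a set" assume F: "finite F"
      have "L2_set (\<lambda>x. cmod (f i x)) (F - S) = (1 / s i) * L2_set (\<lambda>x. cmod (T (e i) x)) (F - S)"
        unfolding f_def using si0[OF i] by (subst L2_set_right_distrib) (auto simp: norm_divide)
      also have "\<dots> \<le> (1 / s i) * \<epsilon>"
        using tail[OF e, of "F - S" i] F si0[OF i] e1[OF i] by (intro mult_left_mono) auto
      also have "\<dots> \<le> \<epsilon> / s n"
        using si[OF i] sn \<epsilon> by (simp add: divide_left_mono)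
      finally have "(L2_set (\<lambda>x. cmod (f i x)) (F - S))\<^sup>2 \<le> (\<epsilon> / s n)\<^sup>2"
        by (intro power_mono) (auto simp: L2_set_nonneg)
      then have 1: "(\<Sum>x\<in>F - S. (cmod (f i x))\<^sup>2) \<le> (\<epsilon> / s n)\<^sup>2"
        by (simp add: L2_set_def sum_nonneg)
      have "(\<Sum>x\<in>F. (cmod (f i x))\<^sup>2) = (\<Sum>x\<in>F \<inter> S. (cmod (f i x))\<^sup>2) + (\<Sum>x\<in>F - S. (cmod (f i x))\<^sup>2)"
        by (rule sum.Int_Diff[OF F])
      also have "(\<Sum>x\<in>F \<inter> S. (cmod (f i x))\<^sup>2) \<le> (\<Sum>x\<in>S. (cmod (f i x))\<^sup>2)"
        using S(1) by (intro sum_mono2) auto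
      finally show "(\<Sum>x\<in>F. (cmod (f i x))\<^sup>2) \<le> (\<Sum>x\<in>S. (cmod (f i x))\<^sup>2) + (\<epsilon> / s n)\<^sup>2"
        using 1 by linarith
    qed
    finally show ?thesis .
  qed
  have "(\<Sum>i\<le>n. (cmod (f i x))\<^sup>2) \<le> 1" if "x \<in> S" for x
  proof -
    have b: "basis_vec x \<in> l2 J" using that S(2) by (auto intro: basis_vec_l2)
    have "complex_of_real ((l2_norm (basis_vec x))\<^sup>2) = 1"
      unfolding l2_inner_self[OF b, symmetric] basis_vec_inner by (simp add: basis_vec_def)
    then have n1: "(l2_norm (basis_vec x))\<^sup>2 = 1" by (metis of_real_eq_1_iff)
    have "(\<Sum>i\<le>n. (cmod (f i x))\<^sup>2) = (\<Sum>i\<le>n. (cmod (l2_inner (f i) (basis_vec x)))\<^sup>2)"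
      by (simp add: l2_inner_commute[of "f i" "basis_vec x" for i])
    also have "\<dots> \<le> (l2_norm (basis_vec x))\<^sup>2"
      using f f_on by (intro Bessel[OF _ b]) auto
    finally show ?thesis using n1 by simp
  qed
  then have "(\<Sum>x\<in>S. \<Sum>i\<le>n. (cmod (f i x))\<^sup>2) \<le> card S"
    using sum_mono[of S "\<lambda>x. \<Sum>i\<le>n. (cmod (f i x))\<^sup>2" "\<lambda>_. 1"] by simp
  moreover have "(\<Sum>i\<le>n. 1) \<le> (\<Sum>i\<le>n. (\<Sum>x\<in>S. (cmod (f i x))\<^sup>2) + (\<epsilon> / s n)\<^sup>2)"
    using bound by (intro sum_mono) auto
  ultimately have "real (Suc n) \<le> card S + Suc n * (\<epsilon> / s n)\<^sup>2"
    using sum.swap[of "\<lambda>x i. (cmod (f i x))\<^sup>2" "{..n}" S] by (simp add: sum.distrib)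
  moreover have "2 * real (card S) \<le> Suc n" using S(3) by linarith
  ultimately have "real (Suc n) * 1 \<le> real (Suc n) * (2 * (\<epsilon> / s n)\<^sup>2)"
    by (simp add: algebra_simps)
  then have "1 \<le> 2 * (\<epsilon> / s n)\<^sup>2" by (subst (asm) mult_le_cancel_left_pos) auto
  then have "(s n)\<^sup>2 \<le> 2 * \<epsilon>\<^sup>2" using sn by (simp add: power_divide field_simps)
  then have "s n \<le> sqrt (2 * \<epsilon>\<^sup>2)" by (rule real_le_rsqrt)
  then show ?thesis using \<epsilon> by (simp add: real_sqrt_mult)
qed

text \<open>
  Tychonoff's theorem for a countable product of discs, which is metrisable and hence sequentially compact.
\<close>

lemma pointwise_convergent_subseq:
  fixes f :: "nat \<Rightarrow> 'b \<Rightarrow> complex"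
  assumes U: "countable U" and bd: "\<And>k x. cmod (f k x) \<le> R"
  obtains r g where "strict_mono r" "\<And>x. x \<in> U \<Longrightarrow> (\<lambda>k. f (r k) x) \<longlonglongrightarrow> g x"
proof -
  define F where "F k = (\<lambda>i. f k (from_nat_into U i))" for k
  let ?K = "PiE UNIV (\<lambda>_::nat. cball (0::complex) R)"
  have "compact ?K"
    using compactin_PiE[of "\<lambda>_::nat. euclidean" UNIV "\<lambda>_. cball (0::complex) R"]
    by (simp add: euclidean_product_topology)
  then have "seq_compact ?K" by (rule compact_imp_seq_compact)
  moreover have "\<forall>k. F k \<in> ?K" using bd by (auto simp: F_def)
  ultimately obtain l r where r: "strict_mono r" and l: "(F \<circ> r) \<longlonglongrightarrow> l"
    unfolding seq_compact_def by blast
  have "(\<lambda>k. f (r k) x) \<longlonglongrightarrow> l (to_nat_on U x)" if "x \<in> U" for x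
  proof -
    have "continuous_on UNIV (\<lambda>h :: nat \<Rightarrow> complex. h (to_nat_on U x))"
      by (rule continuous_on_product_coordinates)
    from continuous_on_tendsto_compose[OF this l]
    have "(\<lambda>k. (F \<circ> r) k (to_nat_on U x)) \<longlonglongrightarrow> l (to_nat_on U x)" by simp
    then show ?thesis using U that by (simp add: F_def)
  qed
  with r show thesis by (intro that[of r "\<lambda>x. l (to_nat_on U x)"])
qed

text \<open>
  A subsequence of the images converges at each of the countably many points of \<open>\<Union>\<^sub>N S\<^sub>N\<close>, off which all images
  vanish; the uniformly small tails turn this into convergence in norm.
\<close>

lemma compact_opr_if_small_tails:
  assumes bT: "bounded_opr J T"
    and S: "\<And>N. finite (S N)" and \<epsilon>: "\<epsilon> \<longlonglongrightarrow> 0"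
    and tail: "\<And>N \<xi> F. \<xi> \<in> l2 J \<Longrightarrow> finite F \<Longrightarrow> F \<inter> S N = {} \<Longrightarrow>
      L2_set (\<lambda>x. cmod (T \<xi> x)) F \<le> \<epsilon> N * l2_norm \<xi>"
  shows "compact_opr J T"
  unfolding compact_opr_def
proof (intro conjI allI impI)
  fix \<xi> :: "nat \<Rightarrow> 'a \<Rightarrow> complex"
  assume \<xi>: "\<forall>n. \<xi> n \<in> l2 J \<and> l2_norm (\<xi> n) \<le> 1"
  obtain C where C: "0 \<le> C" "\<And>\<xi>. \<xi> \<in> l2 J \<Longrightarrow> l2_norm (T \<xi>) \<le> C * l2_norm \<xi>"
    using bounded_opr_bound[OF bT] by blast
  have T: "T (\<xi> k) \<in> l2 J" for k using \<xi> by (intro bounded_opr_l2[OF bT]) auto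
  have TC: "l2_norm (T (\<xi> k)) \<le> C" for k
    using C(2)[of "\<xi> k"] \<xi> mult_left_mono[of "l2_norm (\<xi> k)" 1 C] C(1) by fastforce
  have \<epsilon>0: "0 \<le> \<epsilon> N \<or> (\<forall>k. l2_norm (\<xi> k) = 0)" for N
    using tail[of _ "{}" N] \<xi> by (simp add: zero_le_mult_iff) (metis l2_norm_ge_0 order_antisym)
  have tail1: "L2_set (\<lambda>x. cmod (T (\<xi> k) x)) F \<le> \<bar>\<epsilon> N\<bar>" if "finite F" "F \<inter> S N = {}" for k F N
  proof -
    have "L2_set (\<lambda>x. cmod (T (\<xi> k) x)) F \<le> \<epsilon> N * l2_norm (\<xi> k)"
      using tail[OF _ that] \<xi> by blast
    also have "\<dots> \<le> \<bar>\<epsilon> N\<bar> * 1"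
      using \<xi> by (intro mult_mono) auto
    finally show ?thesis by simp
  qed
  have "countable (\<Union>N. S N)" using S by (auto intro: countable_finite)
  moreover have "cmod (T (\<xi> k) x) \<le> C" for k x
    using cmod_le_l2_norm[OF T, of k x] TC[of k] by linarith
  ultimately obtain r g where r: "strict_mono r"
    and g: "\<And>x. x \<in> (\<Union>N. S N) \<Longrightarrow> (\<lambda>k. T (\<xi> (r k)) x) \<longlonglongrightarrow> g x"
    by (rule pointwise_convergent_subseq[of "\<Union>N. S N" "\<lambda>k. T (\<xi> k)"]) blast
  define \<eta> where "\<eta> x = (if x \<in> (\<Union>N. S N) then g x else 0)" for x
  have out: "T (\<xi> k) x = 0" if "x \<notin> (\<Union>N. S N)" for k x
  proof -
    have "cmod (T (\<xi> k) x) \<le> \<bar>\<epsilon> N\<bar>" for N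
      using tail1[of "{x}" N k] that by simp
    moreover have "(\<lambda>N. \<bar>\<epsilon> N\<bar>) \<longlonglongrightarrow> 0" using tendsto_rabs_zero[OF \<epsilon>] .
    ultimately have "cmod (T (\<xi> k) x) \<le> 0" by (intro LIMSEQ_le_const) auto
    then show ?thesis by simp
  qed
  have lim: "(\<lambda>k. T (\<xi> (r k)) x) \<longlonglongrightarrow> \<eta> x" for x
    using g[of x] out[of x] by (auto simp: \<eta>_def)
  have lim_L2: "(\<lambda>k. L2_set (\<lambda>x. cmod (T (\<xi> (r k)) x - h x)) F) \<longlonglongrightarrow> L2_set (\<lambda>x. cmod (\<eta> x - h x)) F"
    for F h
    unfolding L2_set_def by (intro tendsto_intros lim)
  have \<eta>: "\<eta> \<in> l2 J"
  proof (rule l2_boundedI(1)[where B = C])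
    show "\<eta> x = 0" if "x \<notin> J" for x
      using lim[of x] l2_vanish[OF T that] by (simp add: LIMSEQ_const_iff)
    show "L2_set (\<lambda>x. cmod (\<eta> x)) F \<le> C" if "finite F" for F
      using lim_L2[of "\<lambda>_. 0" F] order_trans[OF L2_set_le_l2_norm[OF T that] TC]
      by (intro LIMSEQ_le_const2[of _ _ C]) auto
  qed
  have "(\<lambda>n. l2_norm (\<lambda>x. T (\<xi> (r n)) x - \<eta> x)) \<longlonglongrightarrow> 0"
  proof (rule LIMSEQ_I)
    fix \<delta> :: real assume \<delta>: "0 < \<delta>"
    obtain N where N: "\<bar>\<epsilon> N\<bar> < \<delta> / 4"
      using LIMSEQ_D[OF \<epsilon>, of "\<delta> / 4"] \<delta> by auto
    have "L2_set (\<lambda>x. cmod (\<eta> x - \<eta> x)) (S N) = 0" by (simp add: L2_set_def)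
    then obtain k0 where k0: "\<And>k. k \<ge> k0 \<Longrightarrow> L2_set (\<lambda>x. cmod (T (\<xi> (r k)) x - \<eta> x)) (S N) < \<delta> / 4"
      using LIMSEQ_D[OF lim_L2[of \<eta> "S N"], of "\<delta> / 4"] \<delta> by (auto simp: L2_set_nonneg)
    have \<eta>_tail: "L2_set (\<lambda>x. cmod (\<eta> x)) F \<le> \<bar>\<epsilon> N\<bar>" if "finite F" "F \<inter> S N = {}" for F
      using lim_L2[of "\<lambda>_. 0" F] tail1[OF that]
      by (intro LIMSEQ_le_const2[of _ _ "\<bar>\<epsilon> N\<bar>"]) auto
    have "l2_norm (\<lambda>x. T (\<xi> (r k)) x - \<eta> x) \<le> 3 * (\<delta> / 4)" if k: "k \<ge> k0" for k
    proof (rule l2_boundedI(2)[where J = J])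
      show "T (\<xi> (r k)) x - \<eta> x = 0" if "x \<notin> J" for x
        using l2_vanish[OF T that] l2_vanish[OF \<eta> that] by simp
      fix F :: "'a set" assume F: "finite F"
      let ?d = "\<lambda>x. cmod (T (\<xi> (r k)) x - \<eta> x)"
      have "L2_set ?d F \<le> L2_set (\<lambda>x. if x \<in> S N then ?d x else 0) F + L2_set (\<lambda>x. if x \<in> S N then 0 else ?d x) F"
        by (rule order_trans[OF _ L2_set_triangle_ineq]) (auto intro!: L2_set_mono)
      also have "L2_set (\<lambda>x. if x \<in> S N then ?d x else 0) F = L2_set ?d (F \<inter> S N)"
        unfolding L2_set_def using F
        by (intro arg_cong[of _ _ sqrt] sum.mono_neutral_cong_right) auto
      also have "\<dots> \<le> L2_set ?d (S N)"
        unfolding L2_set_def using S by (intro real_sqrt_le_mono sum_mono2) auto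
      also have "L2_set (\<lambda>x. if x \<in> S N then 0 else ?d x) F = L2_set ?d (F - S N)"
        unfolding L2_set_def using F
        by (intro arg_cong[of _ _ sqrt] sum.mono_neutral_cong_right) auto
      also have "L2_set ?d (F - S N) \<le> L2_set (\<lambda>x. cmod (T (\<xi> (r k)) x)) (F - S N) + L2_set (\<lambda>x. cmod (\<eta> x)) (F - S N)"
        by (rule order_trans[OF _ L2_set_triangle_ineq]) (auto intro!: L2_set_mono norm_triangle_ineq4)
      also have "\<dots> \<le> \<bar>\<epsilon> N\<bar> + \<bar>\<epsilon> N\<bar>"
        using F by (intro add_mono tail1 \<eta>_tail) auto
      finally show "L2_set ?d F \<le> 3 * (\<delta> / 4)" using k0[OF k] N by simp
    qed
    then show "\<exists>k0. \<forall>k\<ge>k0. norm (l2_norm (\<lambda>x. T (\<xi> (r k)) x - \<eta> x) - 0) < \<delta>"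
      using \<delta> by (intro exI[of _ k0]) fastforce
  qed
  with r \<eta> show "\<exists>r \<eta>. strict_mono r \<and> \<eta> \<in> l2 J \<and> (\<lambda>n. l2_norm (\<lambda>x. T (\<xi> (r n)) x - \<eta> x)) \<longlonglongrightarrow> 0"
    by blast
qed (rule bT)

text \<open>
  Given \<open>n\<close>, the bound \<open>singular_value_le\<close> applies with the largest \<open>N\<close> such that \<open>2 D M\<^sup>N \<le> n + 1\<close>. Then
  \<open>\<theta>\<^sup>N\<close> is of the order \<open>n\<^sup>-\<^sup>\<kappa>\<close> with \<open>\<kappa> = - ln \<theta> / ln M\<close>, and \<open>M \<theta>\<^sup>p < 1\<close> says that \<open>p \<kappa> > 1\<close>.
\<close>

lemma schatten_if_exponential_tails:
  assumes bT: "bounded_opr J T"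
    and S: "\<And>N. finite (S N)" "\<And>N. S N \<subseteq> J" "\<And>N. real (card (S N)) \<le> D * M ^ N"
    and tail: "\<And>N \<xi> F. \<xi> \<in> l2 J \<Longrightarrow> finite F \<Longrightarrow> F \<inter> S N = {} \<Longrightarrow>
      L2_set (\<lambda>x. cmod (T \<xi> x)) F \<le> B * \<theta> ^ N * l2_norm \<xi>"
    and const: "0 < \<theta>" "\<theta> < 1" "1 < M" "0 < p" "M * \<theta> powr p < 1" "0 \<le> B"
  shows "T \<in> schatten J p"
proof -
  have "(\<lambda>N. B * \<theta> ^ N) \<longlonglongrightarrow> 0"
    using const by (intro tendsto_mult_right_zero LIMSEQ_power_zero) auto
  then have cT: "compact_opr J T"
    using tail by (intro compact_opr_if_small_tails[OF bT S(1)])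
  then obtain s where s: "singular_values J T s" by (rule compact_opr_singular_values)
  have s0: "0 \<le> s n" for n using s by (simp add: singular_values_def)
  define D' where "D' = max D 1"
  have D': "1 \<le> D'" "D * M ^ N \<le> D' * M ^ N" for N
    using const by (auto simp: D'_def intro!: mult_right_mono)
  define \<kappa> where "\<kappa> = - ln \<theta> / ln M"
  have \<kappa>: "0 < \<kappa>" using const by (simp add: \<kappa>_def divide_neg_pos)
  have M\<kappa>: "M powr (- \<kappa> * t) = \<theta> powr t" for t
    using const by (simp add: \<kappa>_def powr_def)
  have p\<kappa>: "1 < p * \<kappa>"
  proof -
    have "ln (M * \<theta> powr p) < ln 1" using const by (subst ln_less_cancel_iff) auto
    then have "ln M + p * ln \<theta> < 0" using const by (simp add: ln_mult ln_powr)
    then show ?thesis using const by (simp add: \<kappa>_def field_simps)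
  qed
  define E where "E = sqrt 2 * (B / \<theta>) * (2 * D') powr \<kappa>"
  have E0: "0 \<le> E" using const by (simp add: E_def)
  have bound: "s n \<le> E * real (Suc n) powr (- \<kappa>)" if n: "2 * D' \<le> real (Suc n)" for n
  proof -
    define y where "y = log M (real (Suc n) / (2 * D'))"
    define N where "N = nat \<lfloor>y\<rfloor>"
    have y0: "0 \<le> y" using n D'(1) const by (simp add: y_def)
    have Ny: "real N \<le> y" "y - 1 \<le> real N" unfolding N_def using y0 by linarith+
    have My: "M powr y = real (Suc n) / (2 * D')"
      unfolding y_def using const D'(1) by (intro powr_log_cancel) auto
    have "M ^ N \<le> real (Suc n) / (2 * D')"
      using powr_mono[OF Ny(1), of M] const My by (simp add: powr_realpow)
    then have "2 * (D' * M ^ N) \<le> real (Suc n)" using D'(1) by (simp add: field_simps)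
    then have "2 * card (S N) \<le> Suc n" using S(3)[of N] D'(2)[of N] by linarith
    then have sn: "s n \<le> sqrt 2 * (B * \<theta> ^ N)"
      using tail const by (intro singular_value_le[OF bT s S(1,2)]) auto
    have "\<theta> ^ N = \<theta> powr (real N)" using const by (simp add: powr_realpow)
    also have "\<dots> \<le> \<theta> powr (y - 1)" using Ny(2) const by (intro powr_mono') auto
    also have "\<theta> powr (y - 1) = \<theta> powr y / \<theta>" using const by (simp add: powr_diff)
    also have "\<theta> powr y = (M powr y) powr (- \<kappa>)" by (simp add: M\<kappa>[symmetric] powr_powr mult.commute)
    also have "\<dots> = real (Suc n) powr (- \<kappa>) / (2 * D') powr (- \<kappa>)"
      unfolding My using D'(1) by (simp add: powr_divide)
    also have "\<dots> = real (Suc n) powr (- \<kappa>) * (2 * D') powr \<kappa>"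
      using D'(1) by (simp add: powr_minus field_simps)
    finally have "sqrt 2 * B * \<theta> ^ N \<le> sqrt 2 * B * (real (Suc n) powr (- \<kappa>) * (2 * D') powr \<kappa> / \<theta>)"
      by (rule mult_left_mono) (use const in auto)
    with sn show ?thesis by (simp add: E_def mult_ac)
  qed
  have "summable (\<lambda>n. s n powr p)"
  proof (rule summable_comparison_test_ev)
    show "\<forall>\<^sub>F n in sequentially. norm (s n powr p) \<le> E powr p * real (Suc n) powr (- (p * \<kappa>))"
    proof (rule eventually_sequentiallyI[of "nat \<lceil>2 * D'\<rceil>"])
      fix n assume "nat \<lceil>2 * D'\<rceil> \<le> n"
      then have "2 * D' \<le> real (Suc n)" by linarith
      then have "s n powr p \<le> (E * real (Suc n) powr (- \<kappa>)) powr p"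
        using bound[of n] s0 const by (intro powr_mono2) auto
      also have "\<dots> = E powr p * real (Suc n) powr (- (p * \<kappa>))"
        using E0 by (simp add: powr_mult powr_powr mult.commute)
      finally show "norm (s n powr p) \<le> E powr p * real (Suc n) powr (- (p * \<kappa>))" by simp
    qed
    have "summable (\<lambda>n. real n powr (- (p * \<kappa>)))"
      using p\<kappa> by (subst summable_real_powr_iff) auto
    then show "summable (\<lambda>n. E powr p * real (Suc n) powr (- (p * \<kappa>)))"
      by (intro summable_mult) (subst summable_Suc_iff)
  qed
  with cT s show ?thesis by (auto simp: schatten_def)
qed

text \<open>
  Schur's test: if all rows and columns have at most \<open>c\<close> non-zero entries, each of absolute value at most
  \<open>\<epsilon>\<close>, then the norm is at most \<open>c \<epsilon>\<close>. It is applied to the rows of level at least \<open>N\<close>, whose entries are at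
  most \<open>C \<theta>\<^sup>N\<close>.
\<close>

theorem matrix_schatten:
  fixes K :: "'b \<Rightarrow> 'b \<Rightarrow> complex" and lev :: "'b \<Rightarrow> nat"
  assumes T: "\<And>\<xi> x. \<xi> \<in> l2 J \<Longrightarrow> T \<xi> x = (\<Sum>y | K x y \<noteq> 0. K x y * \<xi> y)"
    and supp: "\<And>x y. K x y \<noteq> 0 \<Longrightarrow> x \<in> J"
    and row: "\<And>x. finite {y. K x y \<noteq> 0}" "\<And>x. card {y. K x y \<noteq> 0} \<le> c"
    and col: "\<And>y. finite {x. K x y \<noteq> 0}" "\<And>y. card {x. K x y \<noteq> 0} \<le> c"
    and decay: "\<And>x y. cmod (K x y) \<le> C * \<theta> ^ lev x"
    and count: "\<And>N. finite {x. lev x \<le> N \<and> (\<exists>y. K x y \<noteq> 0)}"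
      "\<And>N. real (card {x. lev x \<le> N \<and> (\<exists>y. K x y \<noteq> 0)}) \<le> D * M ^ N"
    and const: "0 < \<theta>" "\<theta> < 1" "1 < M" "0 < p" "M * \<theta> powr p < 1" "0 \<le> C"
  shows "T \<in> schatten J p"
proof -
  define S where "S N = {x. lev x < N \<and> (\<exists>y. K x y \<noteq> 0)}" for N
  have S_sub: "S N \<subseteq> {x. lev x \<le> N \<and> (\<exists>y. K x y \<noteq> 0)}" for N by (auto simp: S_def)
  have S: "finite (S N)" "S N \<subseteq> J" "real (card (S N)) \<le> D * M ^ N" for N
    using finite_subset[OF S_sub count(1)] supp order_trans[OF _ count(2)[of N]]
      card_mono[OF count(1) S_sub, of N] by (auto simp: S_def)
  have tail: "L2_set (\<lambda>x. cmod (T \<xi> x)) F \<le> real c * C * \<theta> ^ N * l2_norm \<xi>"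
    if \<xi>: "\<xi> \<in> l2 J" and F: "finite F" "F \<inter> S N = {}" for \<xi> F N
  proof -
    define R where "R x = {y. K x y \<noteq> 0}" for x
    define Y where "Y = (\<Union>x\<in>F. R x)"
    have Y: "finite Y" unfolding Y_def R_def using F(1) row(1) by auto
    have R: "finite (R x)" "card (R x) \<le> c" for x using row by (auto simp: R_def)
    have "(cmod (T \<xi> x))\<^sup>2 \<le> real c * (C * \<theta> ^ N)\<^sup>2 * (\<Sum>y\<in>R x. (cmod (\<xi> y))\<^sup>2)" if x: "x \<in> F" for x
    proof -
      have K: "cmod (K x y) \<le> C * \<theta> ^ N" if "y \<in> R x" for y
      proof -
        have "\<not> lev x < N" using that x F(2) by (auto simp: S_def R_def)
        then have "\<theta> ^ lev x \<le> \<theta> ^ N" using const by (intro power_decreasing) auto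
        then show ?thesis using decay[of x y] const(6) by (meson mult_left_mono order_trans)
      qed
      have "cmod (T \<xi> x) \<le> (\<Sum>y\<in>R x. cmod (K x y) * cmod (\<xi> y))"
        unfolding T[OF \<xi>] R_def by (rule order_trans[OF norm_sum]) (simp add: norm_mult)
      also have "\<dots> \<le> (\<Sum>y\<in>R x. (C * \<theta> ^ N) * cmod (\<xi> y))"
        by (intro sum_mono mult_right_mono K) auto
      finally have "(cmod (T \<xi> x))\<^sup>2 \<le> (\<Sum>y\<in>R x. (C * \<theta> ^ N) * cmod (\<xi> y))\<^sup>2"
        by (intro power_mono) auto
      also have "\<dots> \<le> (\<Sum>y\<in>R x. ((C * \<theta> ^ N) * cmod (\<xi> y))\<^sup>2) * real (card (R x))"
        by (rule sum_squared_le_sum_of_squares)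
      also have "\<dots> \<le> (\<Sum>y\<in>R x. ((C * \<theta> ^ N) * cmod (\<xi> y))\<^sup>2) * real c"
        using R(2) by (intro mult_left_mono) (auto intro!: sum_nonneg)
      finally show ?thesis
        by (simp add: power_mult_distrib sum_distrib_left[symmetric] mult_ac)
    qed
    then have "(\<Sum>x\<in>F. (cmod (T \<xi> x))\<^sup>2) \<le>
        (\<Sum>x\<in>F. real c * (C * \<theta> ^ N)\<^sup>2 * (\<Sum>y\<in>R x. (cmod (\<xi> y))\<^sup>2))"
      by (rule sum_mono)
    then have 1: "(\<Sum>x\<in>F. (cmod (T \<xi> x))\<^sup>2) \<le>
        real c * (C * \<theta> ^ N)\<^sup>2 * (\<Sum>x\<in>F. \<Sum>y\<in>R x. (cmod (\<xi> y))\<^sup>2)"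
      by (simp add: sum_distrib_left)
    have "(\<Sum>x\<in>F. \<Sum>y\<in>R x. (cmod (\<xi> y))\<^sup>2) =
        (\<Sum>x\<in>F. \<Sum>y\<in>Y. if K x y \<noteq> 0 then (cmod (\<xi> y))\<^sup>2 else 0)"
      using Y by (intro sum.cong refl sum.mono_neutral_cong_left) (auto simp: Y_def R_def)
    also have "\<dots> = (\<Sum>y\<in>Y. \<Sum>x\<in>F. if K x y \<noteq> 0 then (cmod (\<xi> y))\<^sup>2 else 0)"
      by (rule sum.swap)
    also have "\<dots> = (\<Sum>y\<in>Y. real (card {x\<in>F. K x y \<noteq> 0}) * (cmod (\<xi> y))\<^sup>2)"
      using F(1) by (simp add: sum.If_cases Int_def)
    also have "\<dots> \<le> (\<Sum>y\<in>Y. real c * (cmod (\<xi> y))\<^sup>2)"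
    proof (intro sum_mono mult_right_mono)
      show "real (card {x\<in>F. K x y \<noteq> 0}) \<le> real c" for y
        using card_mono[OF col(1)[of y], of "{x\<in>F. K x y \<noteq> 0}"] col(2)[of y] by fastforce
    qed auto
    also have "\<dots> \<le> real c * (l2_norm \<xi>)\<^sup>2"
      unfolding sum_distrib_left[symmetric]
      by (intro mult_left_mono sum_le_l2_norm_sq[OF \<xi> Y]) auto
    finally have "real c * (C * \<theta> ^ N)\<^sup>2 * (\<Sum>x\<in>F. \<Sum>y\<in>R x. (cmod (\<xi> y))\<^sup>2) \<le>
        real c * (C * \<theta> ^ N)\<^sup>2 * (real c * (l2_norm \<xi>)\<^sup>2)"
      by (rule mult_left_mono) simp
    with 1 have "(\<Sum>x\<in>F. (cmod (T \<xi> x))\<^sup>2) \<le> (real c * C * \<theta> ^ N * l2_norm \<xi>)\<^sup>2"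
      by (simp add: power2_eq_square mult_ac)
    then show ?thesis
      unfolding L2_set_def using const by (intro real_le_lsqrt) auto
  qed
  have b0: "L2_set (\<lambda>x. cmod (T \<xi> x)) F \<le> real c * C * l2_norm \<xi>" if "\<xi> \<in> l2 J" "finite F" for \<xi> F
    using tail[OF that, of 0] by (simp add: S_def)
  have out: "T \<xi> x = 0" if "\<xi> \<in> l2 J" "x \<notin> J" for \<xi> x
  proof -
    have "{y. K x y \<noteq> 0} = {}" using supp that(2) by auto
    then show ?thesis unfolding T[OF that(1)] by simp
  qed
  have bT: "bounded_opr J T"
    unfolding bounded_opr_def
  proof (intro conjI ballI allI)
    show "T ` l2 J \<subseteq> l2 J"
      using l2_boundedI(1)[OF out b0] by blast
    show "T (\<lambda>x. \<xi> x + \<eta> x) = (\<lambda>x. T \<xi> x + T \<eta> x)" if "\<xi> \<in> l2 J" "\<eta> \<in> l2 J" for \<xi> \<eta>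
      using that by (simp add: fun_eq_iff T l2_add distrib_left sum.distrib)
    show "T (\<lambda>x. a * \<xi> x) = (\<lambda>x. a * T \<xi> x)" if "\<xi> \<in> l2 J" for a \<xi>
      using that by (simp add: fun_eq_iff T l2_scale sum_distrib_left mult_ac)
    show "\<exists>C. \<forall>\<xi>\<in>l2 J. l2_norm (T \<xi>) \<le> C * l2_norm \<xi>"
      using l2_boundedI(2)[OF out b0] by blast
  qed
  show ?thesis
    by (rule schatten_if_exponential_tails[OF bT S tail]) (use const in auto)
qed

theorem matrix_sum_schatten:
  fixes K :: "'l \<Rightarrow> 'b \<Rightarrow> 'b \<Rightarrow> complex" and lev :: "'b \<Rightarrow> nat"
  assumes \<Lambda>: "finite \<Lambda>"
    and T: "\<And>\<xi> x. \<xi> \<in> l2 J \<Longrightarrow> T \<xi> x = (\<Sum>l\<in>\<Lambda>. \<Sum>y | K l x y \<noteq> 0. K l x y * \<xi> y)"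
    and supp: "\<And>l x y. l \<in> \<Lambda> \<Longrightarrow> K l x y \<noteq> 0 \<Longrightarrow> x \<in> J"
    and row: "\<And>l x. l \<in> \<Lambda> \<Longrightarrow> finite {y. K l x y \<noteq> 0} \<and> card {y. K l x y \<noteq> 0} \<le> c l"
    and col: "\<And>l y. l \<in> \<Lambda> \<Longrightarrow> finite {x. K l x y \<noteq> 0} \<and> card {x. K l x y \<noteq> 0} \<le> c l"
    and decay: "\<And>l x y. l \<in> \<Lambda> \<Longrightarrow> cmod (K l x y) \<le> C l * \<theta> ^ lev x"
    and count: "\<And>l N. l \<in> \<Lambda> \<Longrightarrow> finite {x. lev x \<le> N \<and> (\<exists>y. K l x y \<noteq> 0)} \<and>
      real (card {x. lev x \<le> N \<and> (\<exists>y. K l x y \<noteq> 0)}) \<le> D l * M ^ N"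
    and const: "0 < \<theta>" "\<theta> < 1" "1 < M" "0 < p" "M * \<theta> powr p < 1"
  shows "T \<in> schatten J p"
proof -
  define L where "L x y = (\<Sum>l\<in>\<Lambda>. K l x y)" for x y
  have union: "finite F \<and> card F \<le> (\<Sum>l\<in>\<Lambda>. k l)"
    if "F \<subseteq> (\<Union>l\<in>\<Lambda>. F' l)" "\<And>l. l \<in> \<Lambda> \<Longrightarrow> finite (F' l) \<and> card (F' l) \<le> k l"
    for F :: "'b set" and F' and k :: "'l \<Rightarrow> nat"
  proof -
    have fin: "finite (\<Union>l\<in>\<Lambda>. F' l)" using \<Lambda> that(2) by blast
    have "card F \<le> card (\<Union>l\<in>\<Lambda>. F' l)" by (rule card_mono[OF fin that(1)])
    also have "\<dots> \<le> (\<Sum>l\<in>\<Lambda>. card (F' l))" by (rule card_UN_le[OF \<Lambda>])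
    also have "\<dots> \<le> (\<Sum>l\<in>\<Lambda>. k l)" using that(2) by (intro sum_mono) blast
    finally show ?thesis using finite_subset[OF that(1) fin] by blast
  qed
  have nz: "\<exists>l\<in>\<Lambda>. K l x y \<noteq> 0" if "L x y \<noteq> 0" for x y
    using that unfolding L_def by (meson sum.neutral)
  have rows: "finite {y. L x y \<noteq> 0} \<and> card {y. L x y \<noteq> 0} \<le> (\<Sum>l\<in>\<Lambda>. c l)" for x
    by (rule union[where F' = "\<lambda>l. {y. K l x y \<noteq> 0}"]) (use nz row in blast)+
  have cols: "finite {x. L x y \<noteq> 0} \<and> card {x. L x y \<noteq> 0} \<le> (\<Sum>l\<in>\<Lambda>. c l)" for y
    by (rule union[where F' = "\<lambda>l. {x. K l x y \<noteq> 0}"]) (use nz col in blast)+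
  have counts: "finite {x. lev x \<le> N \<and> (\<exists>y. L x y \<noteq> 0)} \<and>
      card {x. lev x \<le> N \<and> (\<exists>y. L x y \<noteq> 0)} \<le>
        (\<Sum>l\<in>\<Lambda>. card {x. lev x \<le> N \<and> (\<exists>y. K l x y \<noteq> 0)})" for N
  proof (rule union)
    show "{x. lev x \<le> N \<and> (\<exists>y. L x y \<noteq> 0)} \<subseteq> (\<Union>l\<in>\<Lambda>. {x. lev x \<le> N \<and> (\<exists>y. K l x y \<noteq> 0)})"
    proof
      fix x assume "x \<in> {x. lev x \<le> N \<and> (\<exists>y. L x y \<noteq> 0)}"
      then obtain y where "lev x \<le> N" "L x y \<noteq> 0" by blast
      with nz[OF this(2)] show "x \<in> (\<Union>l\<in>\<Lambda>. {x. lev x \<le> N \<and> (\<exists>y. K l x y \<noteq> 0)})" by blast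
    qed
  qed (simp add: count)
  have T': "T \<xi> x = (\<Sum>y | L x y \<noteq> 0. L x y * \<xi> y)" if "\<xi> \<in> l2 J" for \<xi> x
  proof -
    let ?Y = "\<Union>l\<in>\<Lambda>. {y. K l x y \<noteq> 0}"
    have Y: "finite ?Y" using \<Lambda> row by blast
    have "(\<Sum>y | L x y \<noteq> 0. L x y * \<xi> y) = (\<Sum>y\<in>?Y. L x y * \<xi> y)"
      by (rule sum.mono_neutral_left[OF Y]) (use nz in auto)
    also have "\<dots> = (\<Sum>y\<in>?Y. \<Sum>l\<in>\<Lambda>. K l x y * \<xi> y)" by (simp add: L_def sum_distrib_right)
    also have "\<dots> = (\<Sum>l\<in>\<Lambda>. \<Sum>y\<in>?Y. K l x y * \<xi> y)" by (rule sum.swap)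
    also have "\<dots> = (\<Sum>l\<in>\<Lambda>. \<Sum>y | K l x y \<noteq> 0. K l x y * \<xi> y)"
      by (intro sum.cong refl sum.mono_neutral_right[OF Y]) auto
    finally show ?thesis using T[OF that] by simp
  qed
  show ?thesis
  proof (rule matrix_schatten[where K = L and lev = lev and c = "\<Sum>l\<in>\<Lambda>. c l"
        and C = "\<Sum>l\<in>\<Lambda>. \<bar>C l\<bar>" and D = "\<Sum>l\<in>\<Lambda>. D l"])
    show "x \<in> J" if "L x y \<noteq> 0" for x y using nz[OF that] supp by blast
    show "cmod (L x y) \<le> (\<Sum>l\<in>\<Lambda>. \<bar>C l\<bar>) * \<theta> ^ lev x" for x y
    proof -
      have "cmod (L x y) \<le> (\<Sum>l\<in>\<Lambda>. cmod (K l x y))" unfolding L_def by (rule norm_sum)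
      also have "\<dots> \<le> (\<Sum>l\<in>\<Lambda>. \<bar>C l\<bar> * \<theta> ^ lev x)"
      proof (rule sum_mono)
        fix l assume l: "l \<in> \<Lambda>"
        have "C l * \<theta> ^ lev x \<le> \<bar>C l\<bar> * \<theta> ^ lev x" using const by (intro mult_right_mono) auto
        then show "cmod (K l x y) \<le> \<bar>C l\<bar> * \<theta> ^ lev x" using decay[OF l, of x y] by linarith
      qed
      finally show ?thesis by (simp add: sum_distrib_right)
    qed
    show "real (card {x. lev x \<le> N \<and> (\<exists>y. L x y \<noteq> 0)}) \<le> (\<Sum>l\<in>\<Lambda>. D l) * M ^ N" for N
    proof -
      have "real (card {x. lev x \<le> N \<and> (\<exists>y. L x y \<noteq> 0)}) \<le>
          (\<Sum>l\<in>\<Lambda>. real (card {x. lev x \<le> N \<and> (\<exists>y. K l x y \<noteq> 0)}))"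
        using counts[of N] by (simp flip: of_nat_sum)
      also have "\<dots> \<le> (\<Sum>l\<in>\<Lambda>. D l * M ^ N)" using count by (intro sum_mono) blast
      finally show ?thesis by (simp add: sum_distrib_right)
    qed
  qed (use T' rows cols counts const in \<open>auto intro: sum_nonneg\<close>)
qed

text \<open>
  The decay \<open>\<theta>\<close> of the entries and the growth \<open>M\<close> of the number of rows determine the Schatten classes that
  contain the direct sum of the blocks. Sparsity allows estimating norms by entries.
\<close>

definition block_bounds ::
  "real \<Rightarrow> real \<Rightarrow> (int \<Rightarrow> 'a \<Rightarrow> 'a \<Rightarrow> complex) \<Rightarrow> nat \<Rightarrow> real \<Rightarrow> real \<Rightarrow> nat \<Rightarrow> bool" where
  "block_bounds \<theta> M K c C E m \<longleftrightarrow>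
    (\<forall>n v. finite {w. K n v w \<noteq> 0} \<and> card {w. K n v w \<noteq> 0} \<le> c) \<and>
    (\<forall>n w. finite {v. K n v w \<noteq> 0} \<and> card {v. K n v w \<noteq> 0} \<le> c) \<and>
    (\<forall>n v w. n \<le> - int m \<longrightarrow> K n v w = 0) \<and>
    (\<forall>n v w. cmod (K n v w) \<le> C * \<theta> powr (real_of_int n)) \<and>
    (\<forall>n. finite {v. \<exists>w. K n v w \<noteq> 0} \<and> real (card {v. \<exists>w. K n v w \<noteq> 0}) \<le> E * M powr (real_of_int n))"

text \<open>
  A sum of block-diagonal matrices \<open>\<Oplus>\<^sub>n K\<^sub>n\<close>, each followed by a permutation
  \<open>(w, n) \<mapsto> (\<psi> w, n + \<kappa>)\<close> of the basis, is itself a sparse matrix whose rows are graded by \<open>n\<close>. The numbers of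
  rows up to a given level form a geometric sum, so they grow like \<open>M\<^sup>n\<close> again.
\<close>

theorem block_sum_schatten:
  fixes K :: "'l \<Rightarrow> int \<Rightarrow> 'a \<Rightarrow> 'a \<Rightarrow> complex" and \<psi> :: "'l \<Rightarrow> 'a \<Rightarrow> 'a" and \<kappa> :: "'l \<Rightarrow> int"
  assumes \<Lambda>: "finite \<Lambda>"
    and T: "\<And>\<xi> v n. \<xi> \<in> l2 (I \<times> UNIV) \<Longrightarrow>
      T \<xi> (v, n) = (\<Sum>l\<in>\<Lambda>. \<Sum>w | K l n v w \<noteq> 0. K l n v w * \<xi> (\<psi> l w, n + \<kappa> l))"
    and \<psi>: "\<And>l. l \<in> \<Lambda> \<Longrightarrow> bij (\<psi> l)"
    and supp: "\<And>l n v w. l \<in> \<Lambda> \<Longrightarrow> K l n v w \<noteq> 0 \<Longrightarrow> v \<in> I"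
    and bounds: "\<And>l. l \<in> \<Lambda> \<Longrightarrow> block_bounds \<theta> M (K l) (c l) (C l) (D l) (m' l)"
    and const: "0 < \<theta>" "\<theta> < 1" "1 < M" "0 < p" "M * \<theta> powr p < 1"
  shows "T \<in> schatten (I \<times> UNIV) p"
proof -
  define m where "m = (\<Sum>l\<in>\<Lambda>. m' l)"
  have row: "finite {w. K l n v w \<noteq> 0} \<and> card {w. K l n v w \<noteq> 0} \<le> c l"
    and col: "finite {v. K l n v w \<noteq> 0} \<and> card {v. K l n v w \<noteq> 0} \<le> c l"
    and decay: "cmod (K l n v w) \<le> C l * \<theta> powr (real_of_int n)"
    and count: "finite {v. \<exists>w. K l n v w \<noteq> 0} \<and>
      real (card {v. \<exists>w. K l n v w \<noteq> 0}) \<le> D l * M powr (real_of_int n)" if "l \<in> \<Lambda>" for l n v w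
    using bounds[OF that] by (simp_all add: block_bounds_def)
  have vanish: "K l n v w = 0" if "l \<in> \<Lambda>" "n \<le> - int m" for l n v w
  proof -
    have "m' l \<le> m" unfolding m_def using that(1) \<Lambda> by (intro member_le_sum) auto
    then show ?thesis using bounds[OF that(1)] that(2) by (simp add: block_bounds_def)
  qed
  define lev where "lev x = nat (snd x + int m)" for x :: "'a \<times> int"
  define L where "L l x y = (if snd y = snd x + \<kappa> l then K l (snd x) (fst x) (inv (\<psi> l) (fst y)) else 0)"
    for l and x y :: "'a \<times> int"
  have inv: "inv (\<psi> l) (\<psi> l w) = w" "\<psi> l (inv (\<psi> l) w) = w" if "l \<in> \<Lambda>" for l w
    using \<psi>[OF that] by (simp_all add: bij_is_inj bij_is_surj surj_f_inv_f)
  have rows: "{y. L l x y \<noteq> 0} = (\<lambda>w. (\<psi> l w, snd x + \<kappa> l)) ` {w. K l (snd x) (fst x) w \<noteq> 0}"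
    if "l \<in> \<Lambda>" for l x
  proof (intro set_eqI iffI)
    fix y assume "y \<in> {y. L l x y \<noteq> 0}"
    then show "y \<in> (\<lambda>w. (\<psi> l w, snd x + \<kappa> l)) ` {w. K l (snd x) (fst x) w \<noteq> 0}"
      by (intro image_eqI[of _ _ "inv (\<psi> l) (fst y)"])
        (auto simp: L_def inv[OF that] prod_eq_iff split: if_splits)
  qed (auto simp: L_def inv[OF that])
  have cols: "{x. L l x y \<noteq> 0} = (\<lambda>v. (v, snd y - \<kappa> l)) ` {v. K l (snd y - \<kappa> l) v (inv (\<psi> l) (fst y)) \<noteq> 0}"
    if "l \<in> \<Lambda>" for l y
  proof (intro set_eqI iffI)
    fix x assume "x \<in> {x. L l x y \<noteq> 0}"
    then show "x \<in> (\<lambda>v. (v, snd y - \<kappa> l)) ` {v. K l (snd y - \<kappa> l) v (inv (\<psi> l) (fst y)) \<noteq> 0}"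
      by (intro image_eqI[of _ _ "fst x"]) (auto simp: L_def prod_eq_iff split: if_splits)
  qed (auto simp: L_def)
  have card_le: "finite (F ` A) \<and> card (F ` A) \<le> k" if "finite A \<and> card A \<le> k" for A :: "'a set" and F :: "'a \<Rightarrow> 'a \<times> int" and k
    using that card_image_le[of A F] by auto
  show ?thesis
  proof (rule matrix_sum_schatten[where K = L and lev = lev and c = c and C = "\<lambda>l. \<bar>C l\<bar> * \<theta> powr (- real m)"
        and D = "\<lambda>l. \<bar>D l\<bar> * (M powr (- real m)) * (M / (M - 1))", OF \<Lambda>])
    fix \<xi> :: "'a \<times> int \<Rightarrow> complex" and x assume \<xi>: "\<xi> \<in> l2 (I \<times> UNIV)"
    have "(\<Sum>y | L l x y \<noteq> 0. L l x y * \<xi> y) =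
        (\<Sum>w | K l (snd x) (fst x) w \<noteq> 0. K l (snd x) (fst x) w * \<xi> (\<psi> l w, snd x + \<kappa> l))" if "l \<in> \<Lambda>" for l
    proof -
      have "inj_on (\<lambda>w. (\<psi> l w, snd x + \<kappa> l)) {w. K l (snd x) (fst x) w \<noteq> 0}"
        using bij_is_inj[OF \<psi>[OF that]] by (auto simp: inj_on_def inj_def)
      then show ?thesis
        unfolding rows[OF that] by (subst sum.reindex) (auto simp: L_def inv[OF that])
    qed
    then show "T \<xi> x = (\<Sum>l\<in>\<Lambda>. \<Sum>y | L l x y \<noteq> 0. L l x y * \<xi> y)"
      using T[OF \<xi>, of "fst x" "snd x"] by simp
  next
    fix l x y assume l: "l \<in> \<Lambda>"
    show "x \<in> I \<times> UNIV" if "L l x y \<noteq> 0"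
      using that supp[OF l] by (cases x) (auto simp: L_def split: if_splits)
    show "finite {y. L l x y \<noteq> 0} \<and> card {y. L l x y \<noteq> 0} \<le> c l"
      unfolding rows[OF l] by (rule card_le[OF row[OF l]])
    show "finite {x. L l x y \<noteq> 0} \<and> card {x. L l x y \<noteq> 0} \<le> c l"
      unfolding cols[OF l] by (rule card_le[OF col[OF l]])
    show "cmod (L l x y) \<le> \<bar>C l\<bar> * \<theta> powr (- real m) * \<theta> ^ lev x"
    proof (cases "snd x \<le> - int m")
      case True
      then have "L l x y = 0" using vanish[OF l] by (simp add: L_def)
      then show ?thesis using const(1) by simp
    next
      case False
      then have "real (lev x) = real_of_int (snd x) + real m" by (simp add: lev_def)
      then have "\<theta> powr (- real m) * \<theta> ^ lev x = \<theta> powr (real_of_int (snd x))"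
        using const by (simp add: powr_realpow[symmetric] powr_add[symmetric])
      moreover have "cmod (K l (snd x) v w) \<le> \<bar>C l\<bar> * \<theta> powr (real_of_int (snd x))" for v w
        by (rule order_trans[OF decay[OF l] mult_right_mono]) auto
      then have "cmod (L l x y) \<le> \<bar>C l\<bar> * \<theta> powr (real_of_int (snd x))"
        unfolding L_def by simp
      ultimately show ?thesis by (simp add: mult.assoc)
    qed
  next
    fix l N assume l: "l \<in> \<Lambda>"
    define A where "A i = {v. \<exists>w. K l (int i - int m) v w \<noteq> 0}" for i
    have sub: "{x. lev x \<le> N \<and> (\<exists>y. L l x y \<noteq> 0)} \<subseteq> (\<Union>i\<in>{..N}. (\<lambda>v. (v, int i - int m)) ` A i)"
    proof
      fix x assume x: "x \<in> {x. lev x \<le> N \<and> (\<exists>y. L l x y \<noteq> 0)}"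
      then obtain w where w: "K l (snd x) (fst x) w \<noteq> 0" by (auto simp: L_def split: if_splits)
      then have "\<not> snd x \<le> - int m" using vanish[OF l] by blast
      then have "int (lev x) - int m = snd x" by (simp add: lev_def)
      then show "x \<in> (\<Union>i\<in>{..N}. (\<lambda>v. (v, int i - int m)) ` A i)"
        using x w by (intro UN_I[of "lev x"] image_eqI[of _ _ "fst x"]) (auto simp: A_def)
    qed
    have A: "finite (A i)" "real (card (A i)) \<le> \<bar>D l\<bar> * M powr (- real m) * M ^ i" for i
    proof -
      show "finite (A i)" unfolding A_def using count[OF l] by blast
      have "real (card (A i)) \<le> D l * M powr (real_of_int (int i - int m))"
        unfolding A_def using count[OF l] by blast
      also have "\<dots> \<le> \<bar>D l\<bar> * M powr (real_of_int (int i - int m))" by (intro mult_right_mono) auto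
      also have "M powr (real_of_int (int i - int m)) = M powr (- real m) * M ^ i"
        using const by (simp add: powr_realpow[symmetric] powr_add[symmetric])
      finally show "real (card (A i)) \<le> \<bar>D l\<bar> * M powr (- real m) * M ^ i" by (simp add: mult.assoc)
    qed
    have fin: "finite (\<Union>i\<in>{..N}. (\<lambda>v. (v, int i - int m)) ` A i)" using A(1) by blast
    have "card {x. lev x \<le> N \<and> (\<exists>y. L l x y \<noteq> 0)} \<le> (\<Sum>i\<le>N. card ((\<lambda>v. (v, int i - int m)) ` A i))"
      using card_mono[OF fin sub] card_UN_le[of "{..N}" "\<lambda>i. (\<lambda>v. (v, int i - int m)) ` A i"] by simp
    also have "\<dots> \<le> (\<Sum>i\<le>N. card (A i))" using A(1) by (intro sum_mono card_image_le)
    finally have "real (card {x. lev x \<le> N \<and> (\<exists>y. L l x y \<noteq> 0)}) \<le> (\<Sum>i\<le>N. real (card (A i)))"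
      by (simp flip: of_nat_sum)
    also have "\<dots> \<le> (\<Sum>i\<le>N. \<bar>D l\<bar> * M powr (- real m) * M ^ i)" by (intro sum_mono A(2))
    also have "\<dots> = \<bar>D l\<bar> * M powr (- real m) * (\<Sum>i\<le>N. M ^ i)" by (simp add: sum_distrib_left)
    also have "\<dots> \<le> \<bar>D l\<bar> * M powr (- real m) * ((M / (M - 1)) * M ^ N)"
    proof (rule mult_left_mono)
      have "(\<Sum>i\<le>N. M ^ i) = (M ^ Suc N - 1) / (M - 1)"
        using const geometric_sum[of M "Suc N"] by (simp add: lessThan_Suc_atMost)
      also have "\<dots> \<le> M ^ Suc N / (M - 1)" using const by (intro divide_right_mono) auto
      finally show "(\<Sum>i\<le>N. M ^ i) \<le> (M / (M - 1)) * M ^ N" by simp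
    qed simp
    finally show "finite {x. lev x \<le> N \<and> (\<exists>y. L l x y \<noteq> 0)} \<and>
        real (card {x. lev x \<le> N \<and> (\<exists>y. L l x y \<noteq> 0)}) \<le>
        \<bar>D l\<bar> * M powr (- real m) * (M / (M - 1)) * M ^ N"
      using finite_subset[OF sub fin] by (simp add: mult.assoc)
  qed (use const in auto)
qed

section \<open>Integer iterates\<close>

lemma ipow_of_nat: "ipow f (int n) = f ^^ n"
  by (simp add: ipow_def)

lemma ipow_minus_of_nat: "ipow f (- int n) = inv f ^^ n"
  by (cases "n = 0") (auto simp: ipow_def)

lemma ipow_0 [simp]: "ipow f 0 x = x"
  by (simp add: ipow_def)

lemma ipow_Suc:
  assumes "bij f"
  shows "ipow f (j + 1) x = f (ipow f j x)"
proof (cases "0 \<le> j")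
  case True
  then show ?thesis by (simp add: ipow_def nat_add_distrib)
next
  case False
  define m where "m = nat (- j - 1)"
  have j: "j = - int (Suc m)" "j + 1 = - int m" using False by (auto simp: m_def)
  show ?thesis
    unfolding j(2) ipow_minus_of_nat unfolding j(1) ipow_minus_of_nat
    using assms by (simp add: bij_is_surj surj_f_inv_f)
qed

lemma ipow_1 [simp]: "bij f \<Longrightarrow> ipow f 1 x = f x"
  using ipow_Suc[of f 0] by simp

lemma ipow_add:
  assumes "bij f"
  shows "ipow f (i + j) x = ipow f i (ipow f j x)"
proof (induction i rule: int_induct[where k = 0])
  case (step1 i)
  then show ?case using ipow_Suc[OF assms, of "i + j" x] ipow_Suc[OF assms, of i "ipow f j x"]
    by (simp add: algebra_simps)
next
  case (step2 i)
  have "f (ipow f (i - 1 + j) x) = f (ipow f (i - 1) (ipow f j x))"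
    using step2 ipow_Suc[OF assms, of "i - 1 + j" x] ipow_Suc[OF assms, of "i - 1" "ipow f j x"]
    by (simp add: algebra_simps)
  then show ?case using assms by (simp add: bij_is_inj inj_eq)
qed simp

lemma ipow_uminus_cancel [simp]:
  "bij f \<Longrightarrow> ipow f (- i) (ipow f i x) = x" "bij f \<Longrightarrow> ipow f i (ipow f (- i) x) = x"
  using ipow_add[of f "- i" i x] ipow_add[of f i "- i" x] by simp_all

lemma bij_ipow: "bij f \<Longrightarrow> bij (ipow f i)"
  by (rule o_bij[of "ipow f (- i)"]) (auto simp: fun_eq_iff)

lemma ipow_inv:
  assumes "bij f"
  shows "ipow (inv f) j = ipow f (- j)"
proof (cases "0 \<le> j")
  case True
  define n where "n = nat j"
  have "j = int n" using True by (simp add: n_def)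
  then show ?thesis by (simp add: ipow_of_nat ipow_minus_of_nat)
next
  case False
  define n where "n = nat (- j)"
  have "j = - int n" using False by (simp add: n_def)
  then show ?thesis using assms by (simp add: ipow_of_nat ipow_minus_of_nat inv_inv_eq)
qed

section \<open>Dynamics of the bracket\<close>

text \<open>
  At the scale \<open>\<epsilon>'\<^sub>X\<close> these relations characterise stable and unstable equivalence. With integer times,
  shifting both orbits only shifts \<open>t\<close>.
\<close>

definition fclose :: "'a smale_data \<Rightarrow> real \<Rightarrow> int \<Rightarrow> 'a \<Rightarrow> 'a \<Rightarrow> bool" where
  "fclose X \<delta> t x y \<longleftrightarrow> (\<forall>i\<ge>t. sdist X (ipow (smap X) i x) (ipow (smap X) i y) \<le> \<delta>)"

definition bclose :: "'a smale_data \<Rightarrow> real \<Rightarrow> int \<Rightarrow> 'a \<Rightarrow> 'a \<Rightarrow> bool" where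
  "bclose X \<delta> t x y \<longleftrightarrow> (\<forall>i\<le>t. sdist X (ipow (smap X) i x) (ipow (smap X) i y) \<le> \<delta>)"

lemma flip_close:
  assumes "bij (smap X)"
  shows "fclose (flip X) \<delta> t = bclose X \<delta> (- t)" "bclose (flip X) \<delta> t = fclose X \<delta> (- t)"
proof -
  have *: "(\<forall>i\<ge>t. P (- i)) = (\<forall>i\<le>-t. P i)" "(\<forall>i\<le>t. P (- i)) = (\<forall>i\<ge>-t. P i)"
    for t :: int and P
    by (metis minus_le_iff minus_minus le_minus_iff)+
  show "fclose (flip X) \<delta> t = bclose X \<delta> (- t)" "bclose (flip X) \<delta> t = fclose X \<delta> (- t)"
    unfolding fclose_def bclose_def flip_sel ipow_inv[OF assms] fun_eq_iff
    using *[of t "\<lambda>i. sdist X (ipow (smap X) i x) (ipow (smap X) i y) \<le> \<delta>" for x y] by simp_all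
qed

text \<open>
  The metric properties of a self-similar Smale space. They are invariant under interchanging stable
  and unstable, so that every statement below holds for \<open>flip X\<close> as well.
\<close>

locale hyperbolic =
  fixes X :: "'a smale_data"
  assumes metric: "Metric_space UNIV (sdist X)"
    and bij: "bij (smap X)"
    and eps_pos: "0 < seps X" and lam_gt_1: "1 < slam X"
    and eps'_pos: "0 < seps' X" and eps'_le: "seps' X \<le> seps X / 2"
    and br_refl: "\<And>x. sbr X x x = x"
    and br_right: "\<And>x y z. sdist X y z \<le> seps X \<Longrightarrow> sdist X x (sbr X y z) \<le> seps X \<Longrightarrow>
      sdist X x z \<le> seps X \<Longrightarrow> sbr X x (sbr X y z) = sbr X x z"
    and br_left: "\<And>x y z. sdist X x y \<le> seps X \<Longrightarrow> sdist X (sbr X x y) z \<le> seps X \<Longrightarrow>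
      sdist X x z \<le> seps X \<Longrightarrow> sbr X (sbr X x y) z = sbr X x z"
    and br_equivariant: "\<And>x y. sdist X x y \<le> seps X \<Longrightarrow> sdist X (smap X x) (smap X y) \<le> seps X \<Longrightarrow>
      smap X (sbr X x y) = sbr X (smap X x) (smap X y)"
    and contract_s: "\<And>x y. sdist X x y < seps X \<Longrightarrow> sbr X x y = y \<Longrightarrow>
      sdist X (smap X x) (smap X y) \<le> inverse (slam X) * sdist X x y"
    and contract_u: "\<And>x y. sdist X x y < seps X \<Longrightarrow> sbr X y x = y \<Longrightarrow>
      sdist X (inv (smap X) x) (inv (smap X) y) \<le> inverse (slam X) * sdist X x y"
    and br_near: "\<And>x y. sdist X x y \<le> seps' X \<Longrightarrow>
      sdist X x (sbr X x y) < seps X / 2 \<and> sdist X y (sbr X x y) < seps X / 2"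
    and lipschitz: "\<And>x y. sdist X (smap X x) (smap X y) \<le> slam X * sdist X x y"
    and lipschitz_inv: "\<And>x y. sdist X (inv (smap X) x) (inv (smap X) y) \<le> slam X * sdist X x y"

lemma self_similar_hyperbolic:
  assumes "self_similar X"
  shows "hyperbolic X"
proof -
  have X: "smale_space X" using assms by (simp add: self_similar_def)
  note * = X[unfolded smale_space_def Let_def]
  have M: "Metric_space UNIV (sdist X)" using * by blast
  have refl: "sbr X x x = x" for x using * by blast
  have e: "0 < seps X" using * by blast
  have d0: "sdist X x x = 0" for x using Metric_space.zero[OF M] by simp
  have contract_s: "sdist X (smap X x) (smap X y) \<le> inverse (slam X) * sdist X x y"
    if "sdist X x y < seps X" "sbr X x y = y" for x y
  proof -
    have "x \<in> loc_s X x (seps X)" "y \<in> loc_s X x (seps X)"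
      using that e by (auto simp: loc_s_def d0 refl)
    then show ?thesis using * e by blast
  qed
  have contract_u: "sdist X (inv (smap X) x) (inv (smap X) y) \<le> inverse (slam X) * sdist X x y"
    if "sdist X x y < seps X" "sbr X y x = y" for x y
  proof -
    have "x \<in> loc_u X x (seps X)" "y \<in> loc_u X x (seps X)"
      using that e by (auto simp: loc_u_def d0 refl)
    then show ?thesis using * e by blast
  qed
  have br_right: "sbr X x (sbr X y z) = sbr X x z"
    if "sdist X y z \<le> seps X" "sdist X x (sbr X y z) \<le> seps X" "sdist X x z \<le> seps X" for x y z
    using * that by blast
  have br_left: "sbr X (sbr X x y) z = sbr X x z"
    if "sdist X x y \<le> seps X" "sdist X (sbr X x y) z \<le> seps X" "sdist X x z \<le> seps X" for x y z
    using * that by blast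
  have br_equivariant: "smap X (sbr X x y) = sbr X (smap X x) (smap X y)"
    if "sdist X x y \<le> seps X" "sdist X (smap X x) (smap X y) \<le> seps X" for x y
    using * that by blast
  have br_near: "sdist X x (sbr X x y) < seps X / 2 \<and> sdist X y (sbr X x y) < seps X / 2"
    if "sdist X x y \<le> seps' X" for x y
    using * that by blast
  have const: "1 < slam X" "0 < seps' X" "seps' X \<le> seps X / 2" using * by blast+
  show ?thesis
    by (rule hyperbolic.intro; (fact M e refl contract_s contract_u br_right br_left br_equivariant
        br_near const smale_space_bij[OF X])?)
      (use assms in \<open>simp_all add: self_similar_def\<close>)
qed

lemma hyperbolic_flip:
  assumes "hyperbolic X"
  shows "hyperbolic (flip X)"
proof -
  interpret hyperbolic X by fact
  interpret Metric_space UNIV "sdist X" by (rule metric)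
  have inv1: "smap X (inv (smap X) x) = x" "inv (smap X) (smap X x) = x" for x
    using bij by (simp_all add: bij_is_surj surj_f_inv_f bij_is_inj)
  show ?thesis
  proof (rule hyperbolic.intro)
    fix x y
    show "smap (flip X) (sbr (flip X) x y) = sbr (flip X) (smap (flip X) x) (smap (flip X) y)"
      if "sdist (flip X) x y \<le> seps (flip X)" "sdist (flip X) (smap (flip X) x) (smap (flip X) y) \<le> seps (flip X)"
      using that br_equivariant[of "inv (smap X) y" "inv (smap X) x"]
      by (simp add: flip_sel inv1 commute) (metis inv1(2))
    show "sbr (flip X) x (sbr (flip X) y z) = sbr (flip X) x z"
      if "sdist (flip X) y z \<le> seps (flip X)" "sdist (flip X) x (sbr (flip X) y z) \<le> seps (flip X)"
        "sdist (flip X) x z \<le> seps (flip X)" for z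
      using that br_left[of z y x] by (simp add: flip_sel commute)
    show "sbr (flip X) (sbr (flip X) x y) z = sbr (flip X) x z"
      if "sdist (flip X) x y \<le> seps (flip X)" "sdist (flip X) (sbr (flip X) x y) z \<le> seps (flip X)"
        "sdist (flip X) x z \<le> seps (flip X)" for z
      using that br_right[of y x z] by (simp add: flip_sel commute)
    show "sdist (flip X) x (sbr (flip X) x y) < seps (flip X) / 2 \<and> sdist (flip X) y (sbr (flip X) x y) < seps (flip X) / 2"
      if "sdist (flip X) x y \<le> seps' (flip X)"
      using that br_near[of y x] by (simp add: flip_sel commute)
  qed (use metric bij eps_pos lam_gt_1 eps'_pos eps'_le br_refl contract_s contract_u lipschitz lipschitz_inv
      in \<open>auto simp: flip_sel bij_imp_bij_inv inv_inv_eq\<close>)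
qed

context hyperbolic
begin

abbreviation "d \<equiv> sdist X"
abbreviation "\<phi> \<equiv> ipow (smap X)"

sublocale Metric_space UNIV d by (rule metric)

lemma tri: "d x z \<le> d x y + d y z"
  by (rule triangle) auto

lemma phi_add: "\<phi> (i + j) x = \<phi> i (\<phi> j x)"
  by (rule ipow_add[OF bij])

lemma phi_Suc: "\<phi> (i + 1) x = smap X (\<phi> i x)"
  by (rule ipow_Suc[OF bij])

lemma fclose_shift: "fclose X \<delta> t (\<phi> s x) (\<phi> s y) \<longleftrightarrow> fclose X \<delta> (t + s) x y"
proof -
  have "(\<forall>i\<ge>t. P (i + s)) \<longleftrightarrow> (\<forall>i\<ge>t + s. P i)" for P
    by (metis add_le_cancel_right diff_add_cancel)
  from this[of "\<lambda>i. d (\<phi> i x) (\<phi> i y) \<le> \<delta>"] show ?thesis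
    by (simp add: fclose_def phi_add)
qed

lemma bclose_shift: "bclose X \<delta> t (\<phi> s x) (\<phi> s y) \<longleftrightarrow> bclose X \<delta> (t + s) x y"
proof -
  have "(\<forall>i\<le>t. P (i + s)) \<longleftrightarrow> (\<forall>i\<le>t + s. P i)" for P
    by (metis add_le_cancel_right diff_add_cancel)
  from this[of "\<lambda>i. d (\<phi> i x) (\<phi> i y) \<le> \<delta>"] show ?thesis
    by (simp add: bclose_def phi_add)
qed

lemma fclose_sym: "fclose X \<delta> t x y \<Longrightarrow> fclose X \<delta> t y x"
  and bclose_sym: "bclose X \<delta> t x y \<Longrightarrow> bclose X \<delta> t y x"
  by (simp_all add: fclose_def bclose_def commute)

lemma fclose_trans: "fclose X \<delta> t x y \<Longrightarrow> fclose X \<delta>' t y z \<Longrightarrow> fclose X (\<delta> + \<delta>') t x z"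
  and bclose_trans: "bclose X \<delta> t x y \<Longrightarrow> bclose X \<delta>' t y z \<Longrightarrow> bclose X (\<delta> + \<delta>') t x z"
  unfolding fclose_def bclose_def by (meson tri add_mono order_trans)+

lemma fclose_mono: "fclose X \<delta> t x y \<Longrightarrow> \<delta> \<le> \<delta>' \<Longrightarrow> t \<le> t' \<Longrightarrow> fclose X \<delta>' t' x y"
  and bclose_mono: "bclose X \<delta> t x y \<Longrightarrow> \<delta> \<le> \<delta>' \<Longrightarrow> t' \<le> t \<Longrightarrow> bclose X \<delta>' t' x y"
  unfolding fclose_def bclose_def by (meson order_trans)+

lemma eps'_less_eps: "seps' X < seps X"
  using eps'_le eps_pos by linarith

lemma inverse_lam: "0 < inverse (slam X)" "inverse (slam X) < 1"
  using lam_gt_1 by (auto simp: inverse_less_1_iff)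

lemma lam_power_small:
  assumes "0 < \<delta>"
  obtains n where "inverse (slam X) ^ n * c \<le> \<delta>"
proof -
  have "(\<lambda>n. inverse (slam X) ^ n * c) \<longlonglongrightarrow> 0"
    using inverse_lam by (intro tendsto_mult_left_zero LIMSEQ_power_zero) auto
  from LIMSEQ_D[OF this assms] obtain n where "\<bar>inverse (slam X) ^ n * c\<bar> < \<delta>" by force
  then show thesis by (intro that[of n]) linarith
qed

lemma zero_if_lam_power:
  assumes "\<And>n. r \<le> inverse (slam X) ^ n * c"
  shows "r \<le> 0"
proof (rule ccontr)
  assume "\<not> r \<le> 0"
  then obtain n where "inverse (slam X) ^ n * c \<le> r / 2" by (meson half_gt_zero lam_power_small not_le)
  with assms[of n] \<open>\<not> r \<le> 0\<close> show False by linarith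
qed

lemma stable_iterate:
  assumes "sbr X x y = y" "d x y < seps X"
  shows "sbr X (\<phi> (int n) x) (\<phi> (int n) y) = \<phi> (int n) y \<and>
    d (\<phi> (int n) x) (\<phi> (int n) y) \<le> inverse (slam X) ^ n * d x y"
proof (induction n)
  case (Suc n)
  let ?x = "\<phi> (int n) x" and ?y = "\<phi> (int n) y"
  have "inverse (slam X) ^ n * d x y \<le> 1 * d x y"
    using inverse_lam by (intro mult_right_mono power_le_one) auto
  then have lt: "d ?x ?y < seps X" using Suc assms(2) by linarith
  have c: "d (smap X ?x) (smap X ?y) \<le> inverse (slam X) * d ?x ?y"
    using Suc lt by (intro contract_s) auto
  also have "\<dots> \<le> inverse (slam X) * (inverse (slam X) ^ n * d x y)"
    using Suc inverse_lam by (intro mult_left_mono) auto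
  finally have 1: "d (smap X ?x) (smap X ?y) \<le> inverse (slam X) ^ Suc n * d x y" by (simp add: mult.assoc)
  have "inverse (slam X) * d ?x ?y \<le> 1 * d ?x ?y"
    using inverse_lam by (intro mult_right_mono) auto
  with c lt have br: "smap X (sbr X ?x ?y) = sbr X (smap X ?x) (smap X ?y)"
    by (intro br_equivariant) auto
  have "sbr X ?x ?y = ?y" using Suc by blast
  then have 2: "sbr X (smap X ?x) (smap X ?y) = smap X ?y"
    by (intro trans[OF sym[OF br]] arg_cong[of _ _ "smap X"])
  have 3: "\<phi> (int (Suc n)) u = smap X (\<phi> (int n) u)" for u
    using phi_Suc[of "int n" u] by (simp add: add.commute)
  show ?case unfolding 3 using 1 2 by blast
qed (use assms in simp)

lemma stable_fclose:
  assumes "sbr X x y = y" "d x y < seps X" "inverse (slam X) ^ n * seps X \<le> \<delta>"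
  shows "fclose X \<delta> (int n) x y"
  unfolding fclose_def
proof (intro allI impI)
  fix i assume "int n \<le> i"
  define m where "m = nat i"
  have i: "i = int m" and m: "n \<le> m" using \<open>int n \<le> i\<close> by (simp_all add: m_def)
  have "d (\<phi> i x) (\<phi> i y) \<le> inverse (slam X) ^ m * d x y"
    using stable_iterate[OF assms(1,2), of m] by (simp add: i)
  also have "\<dots> \<le> inverse (slam X) ^ n * seps X"
    using inverse_lam m assms(2) by (intro mult_mono power_decreasing) auto
  finally show "d (\<phi> i x) (\<phi> i y) \<le> \<delta>" using assms(3) by linarith
qed

lemma flip_hyperbolic: "hyperbolic (flip X)"
  by (rule hyperbolic_flip) (rule hyperbolic_axioms)

lemma unstable_iterate:
  assumes "sbr X y x = y" "d x y < seps X"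
  shows "sbr X (\<phi> (- int n) y) (\<phi> (- int n) x) = \<phi> (- int n) y \<and>
    d (\<phi> (- int n) x) (\<phi> (- int n) y) \<le> inverse (slam X) ^ n * d x y"
  using hyperbolic.stable_iterate[OF flip_hyperbolic, of x y n] assms
  by (simp add: flip_sel ipow_inv[OF bij])

lemma unstable_bclose:
  assumes "sbr X y x = y" "d x y < seps X" "inverse (slam X) ^ n * seps X \<le> \<delta>"
  shows "bclose X \<delta> (- int n) x y"
  using hyperbolic.stable_fclose[OF flip_hyperbolic, of x y n \<delta>] assms
  by (simp add: flip_sel flip_close[OF bij])

lemma bracket_stable:
  assumes "d x y \<le> seps' X"
  shows "sbr X x (sbr X x y) = sbr X x y" "d x (sbr X x y) < seps X / 2"
proof -
  have "d x y \<le> seps X" "d x (sbr X x y) \<le> seps X"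
    using assms br_near[OF assms] eps'_le eps_pos by linarith+
  then show "sbr X x (sbr X x y) = sbr X x y" by (intro br_right)
  show "d x (sbr X x y) < seps X / 2" using br_near[OF assms] by blast
qed

lemma bracket_unstable:
  assumes "d x y \<le> seps' X"
  shows "sbr X (sbr X x y) y = sbr X x y" "d y (sbr X x y) < seps X / 2"
proof -
  have "d x y \<le> seps X" "d y (sbr X x y) \<le> seps X"
    using assms br_near[OF assms] eps'_le eps_pos by linarith+
  then show "sbr X (sbr X x y) y = sbr X x y" by (intro br_left) (simp_all add: commute)
  show "d y (sbr X x y) < seps X / 2" using br_near[OF assms] by blast
qed

lemma bracket_iterate:
  assumes "\<And>i. t1 \<le> i \<Longrightarrow> i \<le> t2 \<Longrightarrow> d (\<phi> i x) (\<phi> i y) \<le> seps' X" "t1 \<le> i" "i \<le> t2"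
  shows "\<phi> (i - t1) (sbr X (\<phi> t1 x) (\<phi> t1 y)) = sbr X (\<phi> i x) (\<phi> i y)"
  using assms(2,3)
proof (induction i rule: int_ge_induct)
  case (step i)
  have "d (\<phi> i x) (\<phi> i y) \<le> seps X" "d (\<phi> (i + 1) x) (\<phi> (i + 1) y) \<le> seps X"
    using assms(1)[of i] assms(1)[of "i + 1"] step eps'_less_eps by auto
  then have "smap X (sbr X (\<phi> i x) (\<phi> i y)) = sbr X (\<phi> (i + 1) x) (\<phi> (i + 1) y)"
    unfolding phi_Suc by (rule br_equivariant)
  then show ?case using step phi_Suc[of "i - t1"] by (simp add: algebra_simps)
qed simp

text \<open>
  The orbit of \<open>z = [x, y]\<close> stays near that of \<open>y\<close> in forward time, being the bracket of two close orbits. As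
  \<open>z\<close> lies on the local unstable set of \<open>y\<close>, going back from time \<open>n\<close> shows that its distance from \<open>y\<close> is of order
  \<open>\<lambda>\<^sup>-\<^sup>n\<close>. So \<open>z = y\<close>.
\<close>

lemma fclose_imp_stable:
  assumes "fclose X (seps' X) 0 x y"
  shows "sbr X x y = y"
proof -
  define z where "z = sbr X x y"
  have near: "d (\<phi> (int n) x) (\<phi> (int n) y) \<le> seps' X" for n
    using assms by (simp add: fclose_def)
  have "d y z \<le> inverse (slam X) ^ n * seps X" for n
  proof -
    let ?z = "sbr X (\<phi> (int n) x) (\<phi> (int n) y)"
    have z: "\<phi> (int n) z = ?z"
      using bracket_iterate[of 0 "int n" x y "int n"] assms by (simp add: z_def fclose_def)
    have lt: "d (\<phi> (int n) y) ?z < seps X" using bracket_unstable(2)[OF near] eps_pos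
      by (smt (verit) field_sum_of_halves)
    have "d y z = d (\<phi> (- int n) (\<phi> (int n) y)) (\<phi> (- int n) ?z)"
      unfolding z[symmetric] by (simp add: bij)
    also have "\<dots> \<le> inverse (slam X) ^ n * d (\<phi> (int n) y) ?z"
      using unstable_iterate[OF bracket_unstable(1)[OF near] lt] by blast
    also have "\<dots> \<le> inverse (slam X) ^ n * seps X"
      using lt inverse_lam by (intro mult_left_mono) auto
    finally show ?thesis .
  qed
  then have "d y z \<le> 0" by (rule zero_if_lam_power)
  then show ?thesis unfolding z_def by (metis nonneg order_antisym zero UNIV_I)
qed

lemma bclose_imp_unstable: "bclose X (seps' X) 0 x y \<Longrightarrow> sbr X y x = y"
  using hyperbolic.fclose_imp_stable[OF flip_hyperbolic, of x y]
  by (simp add: flip_sel flip_close[OF bij])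

lemma fclose_contract:
  assumes "fclose X (seps' X) t x y"
  shows "d (\<phi> (t + int n) x) (\<phi> (t + int n) y) \<le> inverse (slam X) ^ n * seps' X"
proof -
  have 0: "fclose X (seps' X) 0 (\<phi> t x) (\<phi> t y)" using assms by (simp add: fclose_shift)
  have le: "d (\<phi> t x) (\<phi> t y) \<le> seps' X" using assms by (simp add: fclose_def)
  have "d (\<phi> (int n) (\<phi> t x)) (\<phi> (int n) (\<phi> t y)) \<le> inverse (slam X) ^ n * d (\<phi> t x) (\<phi> t y)"
    using stable_iterate[OF fclose_imp_stable[OF 0], of n] le eps'_less_eps by auto
  also have "\<dots> \<le> inverse (slam X) ^ n * seps' X"
    using le inverse_lam by (intro mult_left_mono) auto
  finally show ?thesis by (simp add: phi_add add.commute[of t])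
qed

text \<open>
  From every time \<open>-n\<close> on the two orbits are close, so at time \<open>0\<close> they have already been contracted by
  \<open>\<lambda>\<^sup>n\<close>.
\<close>

lemma expansive:
  assumes "\<And>i. d (\<phi> i x) (\<phi> i y) \<le> seps' X"
  shows "x = y"
proof -
  have "d x y \<le> inverse (slam X) ^ n * seps' X" for n
    using fclose_contract[of "- int n" x y n] assms by (simp add: fclose_def)
  then have "d x y \<le> 0" by (rule zero_if_lam_power)
  then show ?thesis by (metis nonneg order_antisym zero UNIV_I)
qed

text \<open>
  The bracket of two orbit segments that stay close does not depend on the time at which it is taken.
  Taken at the beginning it shows that its orbit is asymptotic to that of \<open>w\<close> from then on, taken at
  the end that it is asymptotic to that of \<open>v\<close> up to then.
\<close>

lemma orbit_bracket:
  assumes close: "\<And>i. t1 \<le> i \<Longrightarrow> i \<le> t2 \<Longrightarrow> d (\<phi> i v) (\<phi> i w) \<le> seps' X" and "t1 \<le> t2"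
    and j: "inverse (slam X) ^ j * seps X \<le> \<delta>"
  obtains z where "fclose X \<delta> (t1 + int j) w z" "bclose X \<delta> (t2 - int j) v z"
proof -
  define c where "c i = sbr X (\<phi> i w) (\<phi> i v)" for i
  have near: "d (\<phi> i w) (\<phi> i v) \<le> seps' X" if "t1 \<le> i" "i \<le> t2" for i
    using close[OF that] by (simp add: commute)
  define z where "z = \<phi> (- t1) (c t1)"
  have z: "\<phi> i z = c i" if "t1 \<le> i" "i \<le> t2" for i
    using bracket_iterate[of t1 t2 w v i] near that phi_add[of i "- t1"] by (simp add: z_def c_def)
  have "fclose X \<delta> (int j) (\<phi> t1 w) (\<phi> t1 z)"
    unfolding z[OF order_refl assms(2)] c_def using near[OF order_refl assms(2)] j
    by (intro stable_fclose bracket_stable) (use bracket_stable(2) eps_pos in fastforce)+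
  moreover have "bclose X \<delta> (- int j) (\<phi> t2 v) (\<phi> t2 z)"
    unfolding z[OF assms(2) order_refl] c_def using near[OF assms(2) order_refl] j
    by (intro unstable_bclose bracket_unstable) (use bracket_unstable(2) eps_pos in fastforce)+
  ultimately show thesis
    by (intro that[of z]) (simp_all add: fclose_shift bclose_shift add.commute)
qed

lemma fclose_imp_glob_s:
  assumes "fclose X (seps' X) t x y"
  shows "y \<in> glob_s X x"
proof -
  have "(\<lambda>n. d (\<phi> (t + int n) x) (\<phi> (t + int n) y)) \<longlonglongrightarrow> 0"
  proof (rule tendsto_sandwich[of "\<lambda>_. 0" _ _ "\<lambda>n. inverse (slam X) ^ n * seps' X"])
    show "(\<lambda>n. inverse (slam X) ^ n * seps' X) \<longlonglongrightarrow> 0"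
      using inverse_lam by (intro tendsto_mult_left_zero LIMSEQ_power_zero) auto
  qed (use fclose_contract[OF assms] in auto)
  then have *: "(\<lambda>n. d (\<phi> (t + int n) x) (\<phi> (t + int n) y)) \<longlonglongrightarrow> 0" .
  have "(\<lambda>n. d (\<phi> (int n) x) (\<phi> (int n) y)) \<longlonglongrightarrow> 0"
  proof (rule LIMSEQ_I)
    fix r :: real assume "0 < r"
    then obtain m where m: "\<And>n. n \<ge> m \<Longrightarrow> norm (d (\<phi> (t + int n) x) (\<phi> (t + int n) y) - 0) < r"
      using LIMSEQ_D[OF *] by blast
    have "norm (d (\<phi> (int n) x) (\<phi> (int n) y) - 0) < r" if "n \<ge> nat (t + int m)" for n
    proof (cases "0 \<le> int n - t")
      case True
      have "t + int (nat (int n - t)) = int n" "nat (int n - t) \<ge> m" using that True by auto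
      then show ?thesis using m[of "nat (int n - t)"] by simp
    qed (use that in linarith)
    then show "\<exists>n0. \<forall>n\<ge>n0. norm (d (\<phi> (int n) x) (\<phi> (int n) y) - 0) < r" by blast
  qed
  then show ?thesis by (simp add: glob_s_def ipow_of_nat)
qed

lemma glob_s_imp_fclose:
  assumes "y \<in> glob_s X x" "0 < \<delta>"
  obtains n where "fclose X \<delta> (int n) x y"
proof -
  from assms(1) have "(\<lambda>n. d (\<phi> (int n) x) (\<phi> (int n) y)) \<longlonglongrightarrow> 0"
    by (simp add: glob_s_def ipow_of_nat)
  from LIMSEQ_D[OF this assms(2)] obtain n0 where
    n0: "\<And>n. n \<ge> n0 \<Longrightarrow> d (\<phi> (int n) x) (\<phi> (int n) y) < \<delta>" by auto
  have "fclose X \<delta> (int n0) x y"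
    unfolding fclose_def
  proof (intro allI impI)
    fix i assume i: "int n0 \<le> i"
    then have "int (nat i) = i" "n0 \<le> nat i" by auto
    then show "d (\<phi> i x) (\<phi> i y) \<le> \<delta>" using n0[of "nat i"] by simp
  qed
  then show thesis by (rule that)
qed

lemma bclose_imp_glob_u: "bclose X (seps' X) t x y \<Longrightarrow> y \<in> glob_u X x"
  using hyperbolic.fclose_imp_glob_s[OF flip_hyperbolic, of "- t" x y]
  by (simp add: flip_sel flip_close[OF bij] glob_flip[OF bij])

lemma glob_u_imp_bclose:
  assumes "y \<in> glob_u X x" "0 < \<delta>"
  obtains n where "bclose X \<delta> (- int n) x y"
  using hyperbolic.glob_s_imp_fclose[OF flip_hyperbolic, of y x \<delta>] assms
  by (auto simp: flip_close[OF bij] glob_flip[OF bij])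

lemma glob_s_trans:
  assumes "y \<in> glob_s X x" "z \<in> glob_s X y"
  shows "z \<in> glob_s X x"
proof -
  have e: "0 < seps' X / 2" using eps'_pos by simp
  obtain n where n: "fclose X (seps' X / 2) (int n) x y" by (rule glob_s_imp_fclose[OF assms(1) e])
  obtain m where m: "fclose X (seps' X / 2) (int m) y z" by (rule glob_s_imp_fclose[OF assms(2) e])
  have "fclose X (seps' X / 2 + seps' X / 2) (int (max n m)) x z"
    by (rule fclose_trans[OF fclose_mono[OF n] fclose_mono[OF m]]) auto
  then show ?thesis by (intro fclose_imp_glob_s) simp
qed

lemma glob_s_phi: "\<phi> j y \<in> glob_s X (\<phi> j x) \<longleftrightarrow> y \<in> glob_s X x"
proof
  assume "y \<in> glob_s X x"
  then obtain n where "fclose X (seps' X) (int n) x y" by (rule glob_s_imp_fclose[OF _ eps'_pos])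
  then have "fclose X (seps' X) (int n - j) (\<phi> j x) (\<phi> j y)" by (simp add: fclose_shift)
  then show "\<phi> j y \<in> glob_s X (\<phi> j x)" by (rule fclose_imp_glob_s)
next
  assume "\<phi> j y \<in> glob_s X (\<phi> j x)"
  then obtain n where "fclose X (seps' X) (int n) (\<phi> j x) (\<phi> j y)" by (rule glob_s_imp_fclose[OF _ eps'_pos])
  then show "y \<in> glob_s X x" unfolding fclose_shift by (rule fclose_imp_glob_s)
qed

lemma glob_u_trans: "y \<in> glob_u X x \<Longrightarrow> z \<in> glob_u X y \<Longrightarrow> z \<in> glob_u X x"
  and glob_u_phi: "\<phi> j y \<in> glob_u X (\<phi> j x) \<longleftrightarrow> y \<in> glob_u X x"
  using hyperbolic.glob_s_trans[OF flip_hyperbolic, of y x z] hyperbolic.glob_s_phi[OF flip_hyperbolic, of "- j" y x]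
  by (simp_all add: glob_flip[OF bij] flip_sel ipow_inv[OF bij])

end

section \<open>Compactly supported Lipschitz functions on the stable groupoid\<close>

lemma Lip_c_outside: "f \<in> Lip_c G \<T> D \<Longrightarrow> a \<notin> G \<Longrightarrow> f a = 0"
  unfolding Lip_c_def by blast

lemma Lip_c_lipschitz:
  assumes "f \<in> Lip_c G \<T> D"
  obtains C where "\<And>a b. a \<in> G \<Longrightarrow> b \<in> G \<Longrightarrow> cmod (f a - f b) \<le> C * D a b"
  using assms unfolding Lip_c_def by blast

definition unst_pts :: "'a smale_data \<Rightarrow> 'a set \<Rightarrow> 'a set" where
  "unst_pts X Q = (\<Union>q\<in>Q. glob_u X q)"

lemma G_s_iff: "(v, w) \<in> G_s X Q \<longleftrightarrow> v \<in> unst_pts X Q \<and> w \<in> unst_pts X Q \<and> w \<in> glob_s X v"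
  by (simp add: G_s_def unst_pts_def)

definition basic_sets :: "'a smale_data \<Rightarrow> 'a set \<Rightarrow> ('a \<times> 'a) set set" where
  "basic_sets X Q = {holonomy_s X v w \<eta> N |v w \<eta> N. (v, w) \<in> G_s X Q \<and>
        (smap X ^^ N) w \<in> loc_s X ((smap X ^^ N) v) (seps' X / 2) \<and>
        0 < \<eta> \<and> \<eta> \<le> seps X / 2 \<and>
        (smap X ^^ N) ` loc_u X w \<eta> \<subseteq> loc_u X ((smap X ^^ N) w) (seps' X / 2)}"

lemma top_s_eq: "top_s X Q = topology_generated_by (basic_sets X Q)"
  by (simp add: top_s_def basic_sets_def)

text \<open>
  What compactness of the support is used for: the two coordinates of its points are asymptotic to one
  another in forward time and to finitely many points in backward time, both from a uniform time on.
\<close>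

definition close_support ::
  "'a smale_data \<Rightarrow> real \<Rightarrow> ('a \<times> 'a \<Rightarrow> complex) \<Rightarrow> nat \<Rightarrow> 'a set \<Rightarrow> bool" where
  "close_support X \<delta> f T R \<longleftrightarrow> (\<forall>v w. f (v, w) \<noteq> 0 \<longrightarrow> fclose X \<delta> (int T) v w \<and>
    (\<exists>r\<in>R. bclose X \<delta> (- int T) r v) \<and> (\<exists>r\<in>R. bclose X \<delta> (- int T) r w))"

text \<open>
  The index \<open>k(a, n)\<close> grows by this amount from one cover to the next.
\<close>

definition scale_step :: "'a smale_data \<Rightarrow> nat" where
  "scale_step X = nat \<lceil>log (slam X) 3\<rceil>"

text \<open>
  A Lipschitz function for the groupoid metric changes by at most a multiple of \<open>2\<^sup>-\<^sup>l\<^sup>/\<^sup>L\<close>, with \<open>L\<close> the step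
  above, between points whose coordinates stay close up to time \<open>l\<close>. The time \<open>T\<close>, from which on the coordinates of
  the points are close to each other, costs a factor that depends on \<open>T\<close> only.
\<close>

definition lip_estimate ::
  "'a smale_data \<Rightarrow> ('a \<times> 'a) set \<Rightarrow> ('a \<times> 'a \<Rightarrow> complex) \<Rightarrow> real \<Rightarrow> bool" where
  "lip_estimate X G f C \<longleftrightarrow> (\<forall>a1 a2 b1 b2 T l. (a1, a2) \<in> G \<longrightarrow> (b1, b2) \<in> G \<longrightarrow>
      fclose X (seps' X / 4) (int T) a1 a2 \<longrightarrow> fclose X (seps' X) (int T) b1 b2 \<longrightarrow>
      bclose X (seps' X / 8) (int l) a1 b1 \<longrightarrow> bclose X (seps' X / 8) (int l) a2 b2 \<longrightarrow>
      T + 1 + scale_step X \<le> l \<longrightarrow>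
      cmod (f (a1, a2) - f (b1, b2)) \<le> C * 2 powr (- ((real l - real T - 1) / real (scale_step X))))"

lemma lip_estimate_mono: "lip_estimate X G f C \<Longrightarrow> C \<le> C' \<Longrightarrow> lip_estimate X G f C'"
  unfolding lip_estimate_def by (meson mult_right_mono order_trans powr_ge_zero)

context hyperbolic
begin

lemma close_support_mono:
  assumes "close_support X \<delta> f T R" "T \<le> T'"
  shows "close_support X \<delta> f T' R"
proof -
  have "int T \<le> int T'" "- int T' \<le> - int T" using assms(2) by simp_all
  then show ?thesis
    using assms(1) unfolding close_support_def by (meson bclose_mono fclose_mono order_refl)
qed

lemma funpow_phi: "(smap X ^^ n) x = \<phi> (int n) x" "(inv (smap X) ^^ n) x = \<phi> (- int n) x"
  by (simp_all add: ipow_of_nat ipow_minus_of_nat)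

lemma lipschitz_iterate: "d (\<phi> (int n) x) (\<phi> (int n) y) \<le> slam X ^ n * d x y"
proof (induction n)
  case (Suc n)
  have 3: "\<phi> (int (Suc n)) u = smap X (\<phi> (int n) u)" for u
    using phi_Suc[of "int n" u] by (simp add: add.commute)
  have "d (\<phi> (int (Suc n)) x) (\<phi> (int (Suc n)) y) \<le> slam X * d (\<phi> (int n) x) (\<phi> (int n) y)"
    unfolding 3 by (rule lipschitz)
  also have "\<dots> \<le> slam X * (slam X ^ n * d x y)"
    using Suc lam_gt_1 by (intro mult_left_mono) auto
  finally show ?case by (simp add: mult.assoc)
qed simp

text \<open>On a basic set both coordinates are asymptotic to the centre, uniformly.\<close>

lemma basic_set_close:
  assumes U: "U \<in> basic_sets X Q" and \<delta>: "0 < \<delta>"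
  shows "\<exists>v w T. v \<in> unst_pts X Q \<and> w \<in> unst_pts X Q \<and>
    (\<forall>p\<in>U. fclose X \<delta> (int T) (fst p) (snd p) \<and> bclose X \<delta> (- int T) v (fst p) \<and>
      bclose X \<delta> (- int T) w (snd p))"
proof -
  obtain v w \<eta> N where U_eq: "U = holonomy_s X v w \<eta> N" and vw: "(v, w) \<in> G_s X Q"
    and w: "\<phi> (int N) w \<in> loc_s X (\<phi> (int N) v) (seps' X / 2)"
    and \<eta>: "\<eta> \<le> seps X / 2" and sub: "\<phi> (int N) ` loc_u X w \<eta> \<subseteq> loc_u X (\<phi> (int N) w) (seps' X / 2)"
    using U unfolding basic_sets_def by (auto simp: ipow_of_nat)
  obtain n where n: "inverse (slam X) ^ n * seps X \<le> \<delta>" by (rule lam_power_small[OF \<delta>])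
  have "fclose X \<delta> (int (n + N)) (fst p) (snd p) \<and> bclose X \<delta> (- int (n + N)) v (fst p) \<and>
      bclose X \<delta> (- int (n + N)) w (snd p)" if p: "p \<in> U" for p
  proof -
    obtain z where z: "z \<in> loc_u X w \<eta>"
      and p_eq: "p = (\<phi> (- int N) (sbr X (\<phi> (int N) z) (\<phi> (int N) v)), z)"
      using p unfolding U_eq holonomy_s_def by (auto simp: funpow_phi)
    define y where "y = sbr X (\<phi> (int N) z) (\<phi> (int N) v)"
    have y: "\<phi> (int N) (fst p) = y" by (simp add: p_eq y_def bij)
    have "d (\<phi> (int N) w) (\<phi> (int N) z) < seps' X / 2" using z sub by (auto simp: loc_u_def)
    moreover have "d (\<phi> (int N) v) (\<phi> (int N) w) < seps' X / 2" using w by (auto simp: loc_s_def)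
    ultimately have near: "d (\<phi> (int N) z) (\<phi> (int N) v) \<le> seps' X"
      using tri[of "\<phi> (int N) z" "\<phi> (int N) v" "\<phi> (int N) w"] by (simp add: commute)
    have half: "seps X / 2 < seps X" using eps_pos by simp
    have "fclose X \<delta> (int n) (\<phi> (int N) z) y"
      unfolding y_def using bracket_stable[OF near] half n by (intro stable_fclose) auto
    then have "fclose X \<delta> (int n + int N) z (fst p)" unfolding y[symmetric] fclose_shift .
    then have "fclose X \<delta> (int (n + N)) (snd p) (fst p)" by (simp add: p_eq)
    then have 1: "fclose X \<delta> (int (n + N)) (fst p) (snd p)" by (rule fclose_sym)
    have "bclose X \<delta> (- int n) (\<phi> (int N) v) y"
      unfolding y_def using bracket_unstable[OF near] half n by (intro unstable_bclose) auto
    then have "bclose X \<delta> (- int n + int N) v (fst p)" unfolding y[symmetric] bclose_shift .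
    then have 2: "bclose X \<delta> (- int (n + N)) v (fst p)" by (rule bclose_mono) auto
    have "bclose X \<delta> (- int n) w (snd p)"
      unfolding p_eq snd_conv using z \<eta> half n by (intro unstable_bclose) (auto simp: loc_u_def)
    then have "bclose X \<delta> (- int (n + N)) w (snd p)" by (rule bclose_mono) auto
    with 1 2 show ?thesis by blast
  qed
  then show ?thesis using vw unfolding G_s_iff by blast
qed

text \<open>
  The point is the value of its own holonomy map at the centre. That \<open>\<phi>\<^sup>N\<close> maps a sufficiently small local
  unstable set into a given one follows from the Lipschitz property.
\<close>

lemma in_basic_set:
  assumes "(v, w) \<in> G_s X Q"
  shows "(v, w) \<in> \<Union> (basic_sets X Q)"
proof -
  have "0 < seps' X / 4" using eps'_pos by simp
  then obtain N where N: "fclose X (seps' X / 4) (int N) v w"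
    using assms unfolding G_s_iff by (meson glob_s_imp_fclose)
  have "fclose X (seps' X / 4) 0 (\<phi> (int N) v) (\<phi> (int N) w)" using N by (simp add: fclose_shift)
  then have fc: "fclose X (seps' X) 0 (\<phi> (int N) v) (\<phi> (int N) w)"
    by (rule fclose_mono) (use eps'_pos in auto)
  have dvw: "d (\<phi> (int N) v) (\<phi> (int N) w) \<le> seps' X / 4" using N by (simp add: fclose_def)
  define \<eta> where "\<eta> = seps' X / (4 * slam X ^ N)"
  have lam: "1 \<le> slam X ^ N" using lam_gt_1 by simp
  have \<eta>: "0 < \<eta>" using eps'_pos lam by (simp add: \<eta>_def)
  have "\<eta> \<le> seps' X / 4"
    unfolding \<eta>_def using eps'_pos lam by (intro divide_left_mono) auto
  then have \<eta>_le: "\<eta> \<le> seps X / 2" using eps'_less_eps eps'_pos by linarith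
  have "\<phi> (int N) z \<in> loc_u X (\<phi> (int N) w) (seps' X / 2)" if "z \<in> loc_u X w \<eta>" for z
  proof -
    have z: "d w z < \<eta>" "sbr X z w = z" using that by (auto simp: loc_u_def)
    have near: "d (\<phi> (int i) w) (\<phi> (int i) z) \<le> seps' X / 4" if "i \<le> N" for i
    proof -
      have "d (\<phi> (int i) w) (\<phi> (int i) z) \<le> slam X ^ i * d w z" by (rule lipschitz_iterate)
      also have "\<dots> \<le> slam X ^ N * \<eta>"
        using z that lam_gt_1 by (intro mult_mono power_increasing) auto
      also have "\<dots> = seps' X / 4" using lam_gt_1 by (simp add: \<eta>_def)
      finally show ?thesis .
    qed
    have "\<phi> (int N - 0) (sbr X (\<phi> 0 z) (\<phi> 0 w)) = sbr X (\<phi> (int N) z) (\<phi> (int N) w)"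
    proof (rule bracket_iterate[of 0 "int N"])
      fix i assume "0 \<le> i" "i \<le> int N"
      then show "d (\<phi> i z) (\<phi> i w) \<le> seps' X"
        using near[of "nat i"] eps'_pos by (simp add: commute nat_le_iff)
    qed auto
    then show ?thesis using near[of N] z eps'_pos by (simp add: loc_u_def)
  qed
  then have "\<phi> (int N) ` loc_u X w \<eta> \<subseteq> loc_u X (\<phi> (int N) w) (seps' X / 2)" by blast
  moreover have "\<phi> (int N) w \<in> loc_s X (\<phi> (int N) v) (seps' X / 2)"
    using fclose_imp_stable[OF fc] dvw eps'_pos by (simp add: loc_s_def)
  ultimately have "holonomy_s X v w \<eta> N \<in> basic_sets X Q"
    unfolding basic_sets_def mem_Collect_eq ipow_of_nat[symmetric] using assms \<eta> \<eta>_le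
    by (intro exI[of _ v] exI[of _ w] exI[of _ \<eta>] exI[of _ N] conjI refl)
  moreover have "(v, w) \<in> holonomy_s X v w \<eta> N"
  proof -
    have "sbr X (\<phi> (int N) w) (\<phi> (int N) v) = \<phi> (int N) v"
      by (rule fclose_imp_stable[OF fclose_sym[OF fc]])
    then show ?thesis
      unfolding holonomy_s_def funpow_phi using \<eta>
      by (intro image_eqI[of _ _ w]) (auto simp: loc_u_def br_refl bij)
  qed
  ultimately show ?thesis by blast
qed

text \<open>
  The basic sets cover the groupoid, so finitely many cover the closure of the support.
\<close>

lemma supp_close:
  assumes f: "f \<in> Lip_c (G_s X Q) (top_s X Q) D" and \<delta>: "0 < \<delta>"
  obtains R T where "finite R" "R \<subseteq> unst_pts X Q" "close_support X \<delta> f T R"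
proof -
  let ?S = "{a \<in> G_s X Q. f a \<noteq> 0}"
  have G: "f a \<noteq> 0 \<Longrightarrow> a \<in> G_s X Q" for a using Lip_c_outside[OF f] by blast
  have comp: "compactin (top_s X Q) (top_s X Q closure_of ?S)" using f by (simp add: Lip_c_def)
  have top: "topspace (top_s X Q) = \<Union> (basic_sets X Q)" by (simp add: top_s_eq)
  have "?S \<subseteq> \<Union> (basic_sets X Q)" using in_basic_set by auto
  then have sub: "?S \<subseteq> top_s X Q closure_of ?S" unfolding top[symmetric] by (rule closure_of_subset)
  have op: "openin (top_s X Q) U" if "U \<in> basic_sets X Q" for U
    unfolding top_s_eq by (rule topology_generated_by_Basis[OF that])
  have "top_s X Q closure_of ?S \<subseteq> \<Union> (basic_sets X Q)"
    unfolding top[symmetric] by (rule closure_of_subset_topspace)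
  then obtain \<F> where \<F>: "finite \<F>" "\<F> \<subseteq> basic_sets X Q" "top_s X Q closure_of ?S \<subseteq> \<Union>\<F>"
    using compactinD[OF comp, of "basic_sets X Q"] op by blast
  have "\<forall>U\<in>\<F>. \<exists>v w T. v \<in> unst_pts X Q \<and> w \<in> unst_pts X Q \<and>
    (\<forall>p\<in>U. fclose X \<delta> (int T) (fst p) (snd p) \<and> bclose X \<delta> (- int T) v (fst p) \<and>
      bclose X \<delta> (- int T) w (snd p))"
    using \<F>(2) basic_set_close[OF _ \<delta>] by blast
  then obtain v w T where vwT: "\<And>U. U \<in> \<F> \<Longrightarrow> v U \<in> unst_pts X Q \<and> w U \<in> unst_pts X Q \<and>
    (\<forall>p\<in>U. fclose X \<delta> (int (T U)) (fst p) (snd p) \<and> bclose X \<delta> (- int (T U)) (v U) (fst p) \<and>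
      bclose X \<delta> (- int (T U)) (w U) (snd p))"
    by metis
  define T' where "T' = (\<Sum>U\<in>\<F>. T U)"
  have T': "T U \<le> T'" if "U \<in> \<F>" for U
    unfolding T'_def using that \<F>(1) by (intro member_le_sum) auto
  have main: "fclose X \<delta> (int T') x y \<and> (\<exists>r\<in>v ` \<F> \<union> w ` \<F>. bclose X \<delta> (- int T') r x) \<and>
      (\<exists>r\<in>v ` \<F> \<union> w ` \<F>. bclose X \<delta> (- int T') r y)" if "f (x, y) \<noteq> 0" for x y
  proof -
    have "(x, y) \<in> ?S" using that G[OF that] by simp
    then obtain U where U: "U \<in> \<F>" "(x, y) \<in> U" using sub \<F>(3) by (meson UnionE subsetD)
    have le: "int (T U) \<le> int T'" "- int T' \<le> - int (T U)" using T'[OF U(1)] by simp_all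
    have *: "fclose X \<delta> (int (T U)) x y" "bclose X \<delta> (- int (T U)) (v U) x" "bclose X \<delta> (- int (T U)) (w U) y"
      using vwT[OF U(1)] U(2) by fastforce+
    have "fclose X \<delta> (int T') x y" "bclose X \<delta> (- int T') (v U) x" "bclose X \<delta> (- int T') (w U) y"
      by (rule fclose_mono[OF *(1) order_refl le(1)] bclose_mono[OF *(2) order_refl le(2)]
          bclose_mono[OF *(3) order_refl le(2)])+
    then show ?thesis using U(1) by blast
  qed
  show thesis
  proof (rule that)
    show "close_support X \<delta> f T' (v ` \<F> \<union> w ` \<F>)" unfolding close_support_def using main by blast
  qed (use \<F>(1) vwT in auto)
qed

subsection \<open>The groupoid metric\<close>

lemma scale_step_pos: "0 < scale_step X"
  unfolding scale_step_def using lam_gt_1 by (simp add: less_ceiling_iff)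

lemma quasi_set:
  assumes "a \<in> G_s X Q" "b \<in> G_s X Q"
  shows "{inverse (2 ^ n) :: real |n. \<exists>U\<in>cover_s X Q n. a \<in> U \<and> b \<in> U} \<noteq> {}"
    "bdd_below {inverse (2 ^ n) :: real |n. \<exists>U\<in>cover_s X Q n. a \<in> U \<and> b \<in> U}"
proof -
  have "\<exists>U\<in>cover_s X Q 0. a \<in> U \<and> b \<in> U" using assms by (simp add: cover_s_def)
  then show "{inverse (2 ^ n) :: real |n. \<exists>U\<in>cover_s X Q n. a \<in> U \<and> b \<in> U} \<noteq> {}" by blast
  show "bdd_below {inverse (2 ^ n) :: real |n. \<exists>U\<in>cover_s X Q n. a \<in> U \<and> b \<in> U}"
    by (rule bdd_belowI[of _ 0]) auto
qed

lemma quasi_s_nonneg: "a \<in> G_s X Q \<Longrightarrow> b \<in> G_s X Q \<Longrightarrow> 0 \<le> quasi_s X Q a b"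
  unfolding quasi_s_def by (rule cInf_greatest[OF quasi_set(1)]) auto

lemma quasi_s_le:
  "a \<in> G_s X Q \<Longrightarrow> b \<in> G_s X Q \<Longrightarrow> U \<in> cover_s X Q n \<Longrightarrow> a \<in> U \<Longrightarrow> b \<in> U \<Longrightarrow>
    quasi_s X Q a b \<le> inverse (2 ^ n)"
  unfolding quasi_s_def by (rule cInf_lower[OF _ quasi_set(2)]) auto

text \<open>
  Take the chain consisting of the two points only.
\<close>

lemma D_s_le_quasi_s:
  assumes "a \<in> G_s X Q" "b \<in> G_s X Q"
  shows "D_s X Q a b \<le> quasi_s X Q a b"
  unfolding D_s_def
proof (rule cInf_lower)
  show "quasi_s X Q a b \<in> {\<Sum>i<length c - 1. quasi_s X Q (c ! i) (c ! Suc i) |c.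
      c \<noteq> [] \<and> set c \<subseteq> G_s X Q \<and> hd c = a \<and> last c = b}"
    using assms by (auto intro!: exI[of _ "[a, b]"])
  show "bdd_below {\<Sum>i<length c - 1. quasi_s X Q (c ! i) (c ! Suc i) |c.
      c \<noteq> [] \<and> set c \<subseteq> G_s X Q \<and> hd c = a \<and> last c = b}"
    by (rule bdd_belowI[of _ 0]) (auto intro!: sum_nonneg quasi_s_nonneg)
qed

lemma Lip_c_bounded:
  assumes f: "f \<in> Lip_c (G_s X Q) (top_s X Q) (D_s X Q)"
  obtains B where "0 \<le> B" "\<And>a. cmod (f a) \<le> B"
proof -
  obtain C where C: "\<And>a b. a \<in> G_s X Q \<Longrightarrow> b \<in> G_s X Q \<Longrightarrow> cmod (f a - f b) \<le> C * D_s X Q a b"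
    using Lip_c_lipschitz[OF f] by blast
  have out: "f a = 0" if "a \<notin> G_s X Q" for a by (rule Lip_c_outside[OF f that])
  show thesis
  proof (cases "G_s X Q = {}")
    case True
    then show thesis using out by (intro that[of 0]) auto
  next
    case False
    then obtain a0 where a0: "a0 \<in> G_s X Q" by blast
    have "cmod (f a) \<le> cmod (f a0) + \<bar>C\<bar>" for a
    proof (cases "a \<in> G_s X Q")
      case True
      have U: "G_s X Q \<in> cover_s X Q 0" by (simp add: cover_s_def)
      have D: "D_s X Q a a0 \<le> 1"
        using D_s_le_quasi_s[OF True a0] quasi_s_le[OF True a0 U True a0] by simp
      have "0 \<le> D_s X Q a a0"
        unfolding D_s_def using True a0
        by (intro cInf_greatest) (auto intro!: sum_nonneg quasi_s_nonneg exI[of _ "[a, a0]"])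
      then have "C * D_s X Q a a0 \<le> \<bar>C\<bar> * 1"
        using D by (intro mult_mono) auto
      then show ?thesis using C[OF True a0] norm_triangle_sub[of "f a" "f a0"] by linarith
    qed (simp add: out)
    then show thesis by (intro that[of "cmod (f a0) + \<bar>C\<bar>"]) auto
  qed
qed

text \<open>
  Two points of the groupoid whose coordinates stay close up to time \<open>l\<close> lie in a common set of the
  \<open>n\<close>-th cover as long as the time \<open>k(a, n)\<close> at which that cover lives is at most \<open>l\<close>.
\<close>

lemma close_in_V_s:
  assumes a: "fclose X (seps' X / 4) (int T) a1 a2" and b: "fclose X (seps' X) (int T) b1 b2"
    and ab: "bclose X (seps' X / 8) (int l) a1 b1" "bclose X (seps' X / 8) (int l) a2 b2"
    and m: "N_s X (a1, a2) \<le> m" "T \<le> m" "m \<le> l"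
  shows "(a1, a2) \<in> V_s X m (a1, a2)" "(b1, b2) \<in> V_s X m (a1, a2)"
proof -
  define r where "r = inverse (slam X ^ m) * seps' X / 4"
  have r: "0 < r" using lam_gt_1 eps'_pos by (simp add: r_def)
  have V: "V_s X m (a1, a2) = (\<lambda>z. (\<phi> (- int m) (sbr X (\<phi> (int m) z) (\<phi> (int m) a1)), z)) ` loc_u X a2 r"
    using m by (simp add: V_s_def holonomy_s_def r_def max_def funpow_phi)
  have mem: "(x, z) \<in> V_s X m (a1, a2)"
    if "sbr X (\<phi> (int m) z) (\<phi> (int m) a1) = \<phi> (int m) x" "z \<in> loc_u X a2 r" for x z
    unfolding V using that by (intro image_eqI[of _ _ z]) (auto simp: bij)
  have mT: "int T \<le> int m" and ml: "int m \<le> int l" using m by auto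
  have am: "fclose X (seps' X / 4) 0 (\<phi> (int m) a1) (\<phi> (int m) a2)"
    unfolding fclose_shift using fclose_mono[OF a order_refl mT] by simp
  have "sbr X (\<phi> (int m) a2) (\<phi> (int m) a1) = \<phi> (int m) a1"
    using fclose_mono[OF fclose_sym[OF am], of "seps' X" 0] eps'_pos by (intro fclose_imp_stable) auto
  then show "(a1, a2) \<in> V_s X m (a1, a2)"
    using r by (intro mem) (auto simp: loc_u_def br_refl)
  have bm: "fclose X (seps' X) 0 (\<phi> (int m) b2) (\<phi> (int m) b1)"
    unfolding fclose_shift using fclose_mono[OF fclose_sym[OF b] order_refl mT] by simp
  have bs: "sbr X (\<phi> (int m) b2) (\<phi> (int m) b1) = \<phi> (int m) b1"
    by (rule fclose_imp_stable[OF bm])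
  have abm: "bclose X (seps' X / 8) 0 (\<phi> (int m) a1) (\<phi> (int m) b1)"
    "bclose X (seps' X / 8) 0 (\<phi> (int m) a2) (\<phi> (int m) b2)"
    unfolding bclose_shift using bclose_mono[OF ab(1) order_refl ml] bclose_mono[OF ab(2) order_refl ml] by simp_all
  have unst: "sbr X y x = y" if "bclose X (seps' X / 8) 0 x y" for x y
    using bclose_mono[OF that, of "seps' X" 0] eps'_pos by (intro bclose_imp_unstable) auto
  have near: "d (\<phi> (int m) a1) (\<phi> (int m) b1) \<le> seps' X / 8" "d (\<phi> (int m) a2) (\<phi> (int m) b2) \<le> seps' X / 8"
    "d (\<phi> (int m) a1) (\<phi> (int m) a2) \<le> seps' X / 4" "d (\<phi> (int m) b2) (\<phi> (int m) b1) \<le> seps' X"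
    using abm am bm by (auto simp: bclose_def fclose_def)
  have "sbr X (\<phi> (int m) b2) (sbr X (\<phi> (int m) b1) (\<phi> (int m) a1)) = sbr X (\<phi> (int m) b2) (\<phi> (int m) a1)"
  proof (rule br_right)
    show "d (\<phi> (int m) b1) (\<phi> (int m) a1) \<le> seps X"
      using near(1) eps'_less_eps eps'_pos by (simp add: commute)
    show "d (\<phi> (int m) b2) (sbr X (\<phi> (int m) b1) (\<phi> (int m) a1)) \<le> seps X"
      unfolding unst[OF abm(1)] using near(4) eps'_less_eps by linarith
    show "d (\<phi> (int m) b2) (\<phi> (int m) a1) \<le> seps X"
      using tri[of "\<phi> (int m) b2" "\<phi> (int m) a1" "\<phi> (int m) a2"] near eps'_less_eps eps'_pos
      by (simp add: commute)
  qed
  then have "sbr X (\<phi> (int m) b2) (\<phi> (int m) a1) = \<phi> (int m) b1"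
    unfolding unst[OF abm(1)] bs by simp
  moreover have "b2 \<in> loc_u X a2 r"
  proof -
    have "bclose X (seps' X / 8) (int m - int m) a2 b2" using bclose_mono[OF ab(2) order_refl, of 0] by simp
    then have "sbr X b2 a2 = b2" by (intro unst) simp
    moreover have "d a2 b2 < r"
    proof -
      have lt: "d (\<phi> (int m) a2) (\<phi> (int m) b2) < seps X"
        using near(2) eps'_less_eps eps'_pos by linarith
      have "d a2 b2 = d (\<phi> (- int m) (\<phi> (int m) a2)) (\<phi> (- int m) (\<phi> (int m) b2))" by (simp add: bij)
      also have "\<dots> \<le> inverse (slam X) ^ m * d (\<phi> (int m) a2) (\<phi> (int m) b2)"
        using unstable_iterate[OF unst[OF abm(2)] lt] by blast
      also have "\<dots> \<le> inverse (slam X) ^ m * (seps' X / 8)"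
        using near(2) inverse_lam by (intro mult_left_mono) auto
      also have "\<dots> < inverse (slam X) ^ m * (seps' X / 4)"
        using eps'_pos inverse_lam by (intro mult_strict_left_mono) auto
      also have "\<dots> = r" by (simp add: r_def power_inverse)
      finally show ?thesis .
    qed
    ultimately show ?thesis by (simp add: loc_u_def)
  qed
  ultimately show "(b1, b2) \<in> V_s X m (a1, a2)" by (rule mem)
qed

lemma N_s_le:
  assumes "fclose X (seps' X / 4) (int T) a1 a2"
  shows "N_s X (a1, a2) \<le> T"
proof -
  have 0: "fclose X (seps' X / 4) 0 (\<phi> (int T) a1) (\<phi> (int T) a2)" using assms by (simp add: fclose_shift)
  have "fclose X (seps' X) 0 (\<phi> (int T) a1) (\<phi> (int T) a2)" by (rule fclose_mono[OF 0]) (use eps'_pos in auto)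
  then have "sbr X (\<phi> (int T) a1) (\<phi> (int T) a2) = \<phi> (int T) a2" by (rule fclose_imp_stable)
  moreover have "d (\<phi> (int T) a1) (\<phi> (int T) a2) \<le> seps' X / 4" using assms by (simp add: fclose_def)
  ultimately show ?thesis
    unfolding N_s_def using eps'_pos by (intro Least_le) (simp add: loc_s_def funpow_phi)
qed

text \<open>
  Choose the largest \<open>q\<close> for which the cover number \<open>q + 1\<close> lives at a time \<open>m \<le> l\<close>. These times advance in steps
  of \<open>scale_step X\<close>, so \<open>q + 1 \<ge> (l - T - 1) / scale_step X\<close>, and both points lie in a common set of that cover.
\<close>

lemma Lip_c_estimate:
  assumes f: "f \<in> Lip_c (G_s X Q) (top_s X Q) (D_s X Q)"
  obtains C where "0 \<le> C" "lip_estimate X (G_s X Q) f C"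
proof -
  obtain C where C: "\<And>a b. a \<in> G_s X Q \<Longrightarrow> b \<in> G_s X Q \<Longrightarrow> cmod (f a - f b) \<le> C * D_s X Q a b"
    using Lip_c_lipschitz[OF f] by blast
  have "cmod (f (a1, a2) - f (b1, b2)) \<le> \<bar>C\<bar> * 2 powr (- ((real l - real T - 1) / real (scale_step X)))"
    if G: "(a1, a2) \<in> G_s X Q" "(b1, b2) \<in> G_s X Q"
      and cl: "fclose X (seps' X / 4) (int T) a1 a2" "fclose X (seps' X) (int T) b1 b2"
        "bclose X (seps' X / 8) (int l) a1 b1" "bclose X (seps' X / 8) (int l) a2 b2"
      and l: "T + 1 + scale_step X \<le> l" for a1 a2 b1 b2 T l
  proof -
    define N where "N = max (N_s X (a1, a2)) 1"
    have N: "N \<le> T + 1" "N_s X (a1, a2) \<le> N" using N_s_le[OF cl(1)] by (auto simp: N_def)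
    define q where "q = (l - N) div scale_step X"
    have q1: "1 \<le> q" unfolding q_def using N(1) l scale_step_pos
      by (simp add: div_greater_zero_iff Suc_le_eq)
    define m where "m = N + q * scale_step X"
    have "q * scale_step X \<le> l - N" unfolding q_def by (rule div_times_less_eq_dividend)
    then have m_le: "m \<le> l" unfolding m_def using N(1) l by linarith
    have "l - N < q * scale_step X + scale_step X"
      unfolding q_def using dividend_less_div_times[OF scale_step_pos, of "l - N"] by (simp add: add.commute)
    then have m_gt: "l < m + scale_step X" unfolding m_def by linarith
    have k: "k_s X (a1, a2) (Suc q) = m"
      using q1 by (simp add: k_s_def m_def N_def scale_step_def)
    have mem: "(a1, a2) \<in> V_s X m (a1, a2)" "(b1, b2) \<in> V_s X m (a1, a2)"
      by (rule close_in_V_s[OF cl]; use N m_gt l m_le in \<open>simp add: m_def\<close>)+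
    have U: "V_s X m (a1, a2) \<in> cover_s X Q (Suc q)"
      unfolding cover_s_def using G(1) k by auto
    have "C * D_s X Q (a1, a2) (b1, b2) \<le> \<bar>C\<bar> * quasi_s X Q (a1, a2) (b1, b2)"
    proof -
      have "0 \<le> D_s X Q (a1, a2) (b1, b2)"
        unfolding D_s_def using G
        by (intro cInf_greatest) (auto intro!: sum_nonneg quasi_s_nonneg exI[of _ "[(a1, a2), (b1, b2)]"])
      then show ?thesis using D_s_le_quasi_s[OF G] by (intro mult_mono) auto
    qed
    also have "\<dots> \<le> \<bar>C\<bar> * inverse (2 ^ Suc q)"
      using quasi_s_le[OF G U mem] by (intro mult_left_mono) auto
    also have "inverse (2 ^ Suc q) = (2 :: real) powr (- real (Suc q))"
      by (simp add: powr_minus powr_realpow del: of_nat_Suc power_Suc)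
    also have "\<dots> \<le> 2 powr (- ((real l - real T - 1) / real (scale_step X)))"
    proof -
      have "real l - real N < real (Suc q) * real (scale_step X)"
        using m_gt unfolding m_def by (simp add: algebra_simps flip: of_nat_add of_nat_mult)
      then have "real l - real T - 1 \<le> real (Suc q) * real (scale_step X)"
        using N(1) by linarith
      then have "(real l - real T - 1) / real (scale_step X) \<le> real (Suc q)"
        using scale_step_pos by (simp add: divide_le_eq)
      then show ?thesis by (intro powr_mono) auto
    qed
    finally show ?thesis using C[OF G] by (simp add: mult_left_mono)
  qed
  then show thesis by (intro that[of "\<bar>C\<bar>"]) (simp_all add: lip_estimate_def)
qed

end

section \<open>The commutator kernel\<close>

definition supp_pts :: "('a \<times> 'a \<Rightarrow> complex) \<Rightarrow> 'a set" where
  "supp_pts f = {v. \<exists>w. f (v, w) \<noteq> 0 \<or> f (w, v) \<noteq> 0}"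

context hyperbolic
begin

text \<open>
  Each of the finitely many points to which the support is backward asymptotic is backward asymptotic to a point
  of \<open>Q\<close>.
\<close>

lemma supp_near_orbit:
  assumes f: "f \<in> Lip_c (G_s X Q) (top_s X Q) D" and \<gamma>: "0 < \<gamma>"
  obtains T where "\<And>v. v \<in> supp_pts f \<Longrightarrow> \<exists>q\<in>Q. bclose X \<gamma> (- int T) q v"
proof -
  have \<gamma>2: "0 < \<gamma> / 2" using \<gamma> by simp
  obtain R T where R: "finite R" "R \<subseteq> unst_pts X Q" and cs: "close_support X (\<gamma> / 2) f T R"
    by (rule supp_close[OF f \<gamma>2])
  have "\<exists>q n. q \<in> Q \<and> bclose X (\<gamma> / 2) (- int n) q r" if "r \<in> R" for r
  proof -
    from that R obtain q where "q \<in> Q" "r \<in> glob_u X q" by (auto simp: unst_pts_def)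
    then show ?thesis using glob_u_imp_bclose[OF _ \<gamma>2] by metis
  qed
  then obtain q n where q: "\<And>r. r \<in> R \<Longrightarrow> q r \<in> Q" "\<And>r. r \<in> R \<Longrightarrow> bclose X (\<gamma> / 2) (- int (n r)) (q r) r"
    by metis
  define T' where "T' = T + (\<Sum>r\<in>R. n r)"
  have "\<exists>q\<in>Q. bclose X \<gamma> (- int T') q v" if "v \<in> supp_pts f" for v
  proof -
    have "\<exists>r\<in>R. bclose X (\<gamma> / 2) (- int T) r v"
      using that cs unfolding supp_pts_def close_support_def by blast
    then obtain r where r: "r \<in> R" "bclose X (\<gamma> / 2) (- int T) r v" by blast
    have "n r \<le> (\<Sum>r\<in>R. n r)" using r(1) R(1) by (intro member_le_sum) auto
    then have le: "- int T' \<le> - int (n r)" "- int T' \<le> - int T" by (simp_all add: T'_def del: of_nat_sum)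
    have "bclose X (\<gamma> / 2 + \<gamma> / 2) (- int T') (q r) v"
      by (rule bclose_trans[OF bclose_mono[OF q(2)[OF r(1)] order_refl le(1)] bclose_mono[OF r(2) order_refl le(2)]])
    then show ?thesis using q(1)[OF r(1)] by auto
  qed
  then show thesis by (rule that)
qed

lemma phi_mem:
  assumes "smap X ` Q = Q"
  shows "\<phi> j q \<in> Q \<longleftrightarrow> q \<in> Q"
proof -
  have Q: "smap X q \<in> Q \<longleftrightarrow> q \<in> Q" for q
    using assms bij by (metis image_eqI imageE bij_is_inj injD)
  show ?thesis
  proof (induction j rule: int_induct[where k = 0])
    case (step1 i) then show ?case using Q phi_Suc[of i q] by simp
  next
    case (step2 i) then show ?case using Q[of "\<phi> (i - 1) q"] phi_Suc[of "i - 1" q] by simp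
  qed simp
qed

lemma unst_pts_phi:
  assumes "smap X ` Q = Q"
  shows "\<phi> j x \<in> unst_pts X Q \<longleftrightarrow> x \<in> unst_pts X Q"
proof -
  have "\<exists>q\<in>Q. \<phi> j x \<in> glob_u X q" if "q \<in> Q" "x \<in> glob_u X q" for q x j
    using that phi_mem[OF assms] glob_u_phi[of j x q] by blast
  then have imp: "\<phi> j x \<in> unst_pts X Q" if "x \<in> unst_pts X Q" for x j
    using that by (auto simp: unst_pts_def)
  show ?thesis using imp[of x j] imp[of "\<phi> j x" "- j"] by (auto simp: bij)
qed

lemma unst_pts_bclose:
  assumes "bclose X (seps' X) t x y" "x \<in> unst_pts X Q"
  shows "y \<in> unst_pts X Q"
  using assms(2) glob_u_trans bclose_imp_glob_u[OF assms(1)] by (auto simp: unst_pts_def)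

end

lemma count_union:
  assumes "finite R" and E: "E \<subseteq> (\<Union>r\<in>R. E' r)" and "\<And>r. r \<in> R \<Longrightarrow> finite (E' r) \<and> card (E' r) \<le> k"
  shows "finite E \<and> card E \<le> card R * k"
proof -
  have fin: "finite (\<Union>r\<in>R. E' r)" using assms by auto
  have "card E \<le> card (\<Union>r\<in>R. E' r)" by (rule card_mono[OF fin E])
  also have "\<dots> \<le> (\<Sum>r\<in>R. card (E' r))" by (rule card_UN_le[OF assms(1)])
  also have "\<dots> \<le> card R * k" using sum_bounded_above[of R "\<lambda>r. card (E' r)" k] assms(3) by simp
  finally show ?thesis using finite_subset[OF E fin] by blast
qed

text \<open>
  By expansiveness, bounds for the sizes of separated sets have this property. It refers to orbits in both
  directions of time, which makes it invariant under passing to \<open>flip X\<close>.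
\<close>

definition count_bound :: "'a smale_data \<Rightarrow> (nat \<Rightarrow> nat) \<Rightarrow> bool" where
  "count_bound X S \<longleftrightarrow> (\<forall>E t m. (\<forall>x\<in>E. \<forall>y\<in>E. bclose X (seps' X) t x y \<and>
    fclose X (seps' X) (t + int m) x y) \<longrightarrow> finite E \<and> card E \<le> S m)"

lemma count_bound_flip:
  assumes S: "count_bound X S" and bij: "bij (smap X)"
  shows "count_bound (flip X) S"
  unfolding count_bound_def flip_close[OF bij] flip_sel
proof (intro allI impI)
  fix E t m
  assume "\<forall>x\<in>E. \<forall>y\<in>E. fclose X (seps' X) (- t) x y \<and> bclose X (seps' X) (- (t + int m)) x y"
  then have "\<forall>x\<in>E. \<forall>y\<in>E. bclose X (seps' X) (- t - int m) x y \<and>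
      fclose X (seps' X) (- t - int m + int m) x y" by simp
  then show "finite E \<and> card E \<le> S m" using S unfolding count_bound_def by blast
qed

context hyperbolic
begin

text \<open>
  Points paired with the same \<open>v\<close> are close to each other in forward time, via \<open>v\<close>; those backward asymptotic to
  the same \<open>r\<close> are also close in backward time. Hence there is a uniform bound on the size of the fibres.
\<close>

lemma close_support_fibres:
  fixes S :: "nat \<Rightarrow> nat"
  assumes cs: "close_support X (seps' X / 8) f T R" and R: "finite R"
    and count: "count_bound X S"
  shows "finite {w. f (v, w) \<noteq> 0} \<and> card {w. f (v, w) \<noteq> 0} \<le> card R * S (2 * T)"
    "finite {w. f (w, v) \<noteq> 0} \<and> card {w. f (w, v) \<noteq> 0} \<le> card R * S (2 * T)"
proof -
  let ?\<delta> = "seps' X / 8"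
  have \<delta>: "?\<delta> + ?\<delta> \<le> seps' X" using eps'_pos by simp
  have *: "finite E \<and> card E \<le> card R * S (2 * T)"
    if E: "\<And>w. w \<in> E \<Longrightarrow> fclose X ?\<delta> (int T) v w \<and> (\<exists>r\<in>R. bclose X ?\<delta> (- int T) r w)" for E
  proof (rule count_union[OF R])
    show "E \<subseteq> (\<Union>r\<in>R. {w\<in>E. bclose X ?\<delta> (- int T) r w})" using E by blast
    show "finite {w\<in>E. bclose X ?\<delta> (- int T) r w} \<and> card {w\<in>E. bclose X ?\<delta> (- int T) r w} \<le> S (2 * T)" for r
    proof (rule count[unfolded count_bound_def, rule_format, of _ "- int T"])
      fix x y assume x: "x \<in> {w\<in>E. bclose X ?\<delta> (- int T) r w}" and y: "y \<in> {w\<in>E. bclose X ?\<delta> (- int T) r w}"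
      have "bclose X (?\<delta> + ?\<delta>) (- int T) x y" using x y by (blast intro: bclose_trans bclose_sym)
      moreover have "fclose X (?\<delta> + ?\<delta>) (int T) x y" using E x y by (blast intro: fclose_trans fclose_sym)
      ultimately show "bclose X (seps' X) (- int T) x y \<and> fclose X (seps' X) (- int T + int (2 * T)) x y"
        using bclose_mono[OF _ \<delta> order_refl] fclose_mono[OF _ \<delta> order_refl] by simp
    qed
  qed
  show "finite {w. f (v, w) \<noteq> 0} \<and> card {w. f (v, w) \<noteq> 0} \<le> card R * S (2 * T)"
    by (rule *) (use cs in \<open>simp add: close_support_def\<close>)
  show "finite {w. f (w, v) \<noteq> 0} \<and> card {w. f (w, v) \<noteq> 0} \<le> card R * S (2 * T)"
    by (rule *) (use cs fclose_sym in \<open>auto simp: close_support_def\<close>)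
qed

end

text \<open>The matrix of the commutator \<open>[\<alpha>\<^sub>s\<^sup>n(\<rho>\<^sub>s(f)), \<rho>\<^sub>u(g)]\<close>.\<close>

definition block_kernel ::
  "('a \<Rightarrow> 'a) \<Rightarrow> 'a set \<Rightarrow> ('a \<times> 'a \<Rightarrow> complex) \<Rightarrow> ('a \<times> 'a \<Rightarrow> complex) \<Rightarrow> int \<Rightarrow> 'a \<Rightarrow> 'a \<Rightarrow> complex" where
  "block_kernel h I f g n v w = (if v \<in> I \<and> w \<in> I then
     (\<Sum>z | f (ipow h (- n) v, ipow h (- n) z) \<noteq> 0. f (ipow h (- n) v, ipow h (- n) z) * g (z, w)) -
     (\<Sum>z | g (v, z) \<noteq> 0. g (v, z) * f (ipow h (- n) z, ipow h (- n) w)) else 0)"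

text \<open>
  The pair \<open>f\<close>, \<open>g\<close> together with the constants that its compact supports and Lipschitz properties provide. The
  function \<open>g\<close> on the unstable groupoid is treated as one on the stable groupoid of \<open>flip X\<close>.
\<close>

locale commuting_pair = hyperbolic X for X :: "'a smale_data" +
  fixes P Q :: "'a set" and f g :: "'a \<times> 'a \<Rightarrow> complex"
    and T m0 :: nat and Rf Rg :: "'a set" and B C D M :: real and S :: "nat \<Rightarrow> nat"
  assumes inv_P: "smap X ` P = P" and inv_Q: "smap X ` Q = Q"
    and close_f: "close_support X (seps' X / 8) f T Rf" and close_g: "close_support (flip X) (seps' X / 8) g T Rg"
    and fin_R: "finite Rf" "finite Rg"
    and bounded: "\<And>a. cmod (f a) \<le> B" "\<And>a. cmod (g a) \<le> B" and const: "0 \<le> C" "1 < M" "0 \<le> D"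
    and disj: "\<And>z m. \<phi> m z \<in> supp_pts f \<Longrightarrow> z \<in> supp_pts g \<Longrightarrow> m < int m0"
    and est_f: "lip_estimate X (G_s X Q) f C" and est_g: "lip_estimate (flip X) (G_u X P) g C"
    and sep: "\<And>n E. finite E \<Longrightarrow> separated_set X n (seps' X) E \<Longrightarrow> card E \<le> S n"
    and growth: "\<And>n. real (S n) \<le> D * M ^ n"
begin

abbreviation "\<delta> \<equiv> seps' X / 8"

abbreviation "K \<equiv> block_kernel (smap X) (hpts X P Q) f g"

lemma supp_f:
  assumes "f (v, w) \<noteq> 0"
  shows "fclose X \<delta> (int T) v w" "\<exists>r\<in>Rf. bclose X \<delta> (- int T) r v" "\<exists>r\<in>Rf. bclose X \<delta> (- int T) r w"
  using close_f assms by (simp_all add: close_support_def)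

lemma supp_g:
  assumes "g (v, w) \<noteq> 0"
  shows "bclose X \<delta> (- int T) v w" "\<exists>r\<in>Rg. fclose X \<delta> (int T) r v" "\<exists>r\<in>Rg. fclose X \<delta> (int T) r w"
  using close_g assms by (simp_all add: close_support_def flip_close[OF bij])

lemma delta: "0 < \<delta>" "\<delta> + \<delta> \<le> seps' X" "\<delta> \<le> seps' X" "\<delta> \<le> seps' X / 4"
  using eps'_pos by simp_all

lemma B0: "0 \<le> B"
  using bounded(1)[of undefined] norm_ge_zero order_trans by blast

text \<open>
  By expansiveness two different orbits are more than \<open>\<epsilon>'\<^sub>X\<close> apart at some time, which must lie in the given
  interval.
\<close>

lemma count_orbits: "count_bound X S"
  unfolding count_bound_def
proof (intro allI impI, rule finite_if_finite_subsets_card_bdd)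
  fix E t m F
  assume close: "\<forall>x\<in>E. \<forall>y\<in>E. bclose X (seps' X) t x y \<and> fclose X (seps' X) (t + int m) x y"
  assume F: "F \<subseteq> E" "finite F"
  have inj: "inj (\<phi> t)" using bij_ipow[OF bij] by (rule bij_is_inj)
  have "separated_set X m (seps' X) (\<phi> t ` F)"
    unfolding separated_set_def
  proof (intro ballI impI)
    fix x' y' assume "x' \<in> \<phi> t ` F" "y' \<in> \<phi> t ` F" "x' \<noteq> y'"
    then obtain x y where xy: "x \<in> F" "y \<in> F" "x' = \<phi> t x" "y' = \<phi> t y" "x \<noteq> y" by blast
    then obtain i where i: "\<not> d (\<phi> i x) (\<phi> i y) \<le> seps' X" using expansive by blast
    have cl: "bclose X (seps' X) t x y" "fclose X (seps' X) (t + int m) x y"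
      using close xy F(1) by blast+
    have "t < i" "i < t + int m"
      using i cl unfolding bclose_def fclose_def by (meson not_le)+
    then have "int (nat (i - t)) + t = i" "nat (i - t) < m" by auto
    then show "\<exists>j<m. seps' X < d ((smap X ^^ j) x') ((smap X ^^ j) y')"
      using i unfolding xy(3,4) funpow_phi
      by (intro exI[of _ "nat (i - t)"]) (simp flip: phi_add)
  qed
  from sep[OF _ this] F(2) show "card F \<le> S m"
    by (simp add: card_image inj_on_subset[OF inj])
qed

definition c :: nat where "c = (card Rf + card Rg) * S (2 * T)"

lemma fibres_f:
  "finite {w. f (v, w) \<noteq> 0} \<and> card {w. f (v, w) \<noteq> 0} \<le> c"
  "finite {w. f (w, v) \<noteq> 0} \<and> card {w. f (w, v) \<noteq> 0} \<le> c"
  using close_support_fibres[OF close_f fin_R(1) count_orbits, where v = v]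
  by (simp_all add: c_def algebra_simps)

lemma fibres_g:
  "finite {w. g (v, w) \<noteq> 0} \<and> card {w. g (v, w) \<noteq> 0} \<le> c"
  "finite {w. g (w, v) \<noteq> 0} \<and> card {w. g (w, v) \<noteq> 0} \<le> c"
  using hyperbolic.close_support_fibres[OF flip_hyperbolic, unfolded flip_sel,
      OF close_g fin_R(2) count_bound_flip[OF count_orbits bij], where v = v]
  by (simp_all add: c_def algebra_simps)

lemma image_fibre: "{z. f (x, \<phi> (- n) z) \<noteq> 0} = \<phi> n ` {w. f (x, w) \<noteq> 0}"
  "{z. f (\<phi> (- n) z, x) \<noteq> 0} = \<phi> n ` {w. f (w, x) \<noteq> 0}"
  by (auto simp: bij image_iff) (metis bij ipow_uminus_cancel(2))+

lemma fibres_f_shift: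
  "finite {z. f (x, \<phi> (- n) z) \<noteq> 0} \<and> card {z. f (x, \<phi> (- n) z) \<noteq> 0} \<le> c"
  "finite {z. f (\<phi> (- n) z, x) \<noteq> 0} \<and> card {z. f (\<phi> (- n) z, x) \<noteq> 0} \<le> c"
  unfolding image_fibre using fibres_f[of x] card_image_le order_trans by (metis finite_imageI)+

lemma K_nonzero:
  assumes "K n v w \<noteq> 0"
  shows "v \<in> hpts X P Q" "w \<in> hpts X P Q"
    "(\<exists>z. f (\<phi> (- n) v, \<phi> (- n) z) \<noteq> 0 \<and> g (z, w) \<noteq> 0) \<or>
     (\<exists>z. g (v, z) \<noteq> 0 \<and> f (\<phi> (- n) z, \<phi> (- n) w) \<noteq> 0)"
proof -
  show "v \<in> hpts X P Q" "w \<in> hpts X P Q" using assms by (auto simp: block_kernel_def split: if_splits)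
  show "(\<exists>z. f (\<phi> (- n) v, \<phi> (- n) z) \<noteq> 0 \<and> g (z, w) \<noteq> 0) \<or>
     (\<exists>z. g (v, z) \<noteq> 0 \<and> f (\<phi> (- n) z, \<phi> (- n) w) \<noteq> 0)"
  proof (rule ccontr)
    assume "\<not> ?thesis"
    then have "(\<Sum>z | f (\<phi> (- n) v, \<phi> (- n) z) \<noteq> 0. f (\<phi> (- n) v, \<phi> (- n) z) * g (z, w)) = 0"
      "(\<Sum>z | g (v, z) \<noteq> 0. g (v, z) * f (\<phi> (- n) z, \<phi> (- n) w)) = 0"
      by (auto intro!: sum.neutral)
    then have "K n v w = 0" unfolding block_kernel_def by (simp only:) simp
    with assms show False by contradiction
  qed
qed

lemma count_two:
  assumes "finite A \<and> card A \<le> k" "finite A' \<and> card A' \<le> k"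
    "\<And>z. finite (F z) \<and> card (F z) \<le> c" "\<And>z. finite (F' z) \<and> card (F' z) \<le> c"
    "E \<subseteq> (\<Union>z\<in>A. F z) \<union> (\<Union>z\<in>A'. F' z)"
  shows "finite E \<and> card E \<le> 2 * k * c"
proof -
  have 1: "finite (\<Union>z\<in>A. F z) \<and> card (\<Union>z\<in>A. F z) \<le> card A * c"
    by (rule count_union[of A _ F]) (use assms in auto)
  have 2: "finite (\<Union>z\<in>A'. F' z) \<and> card (\<Union>z\<in>A'. F' z) \<le> card A' * c"
    by (rule count_union[of A' _ F']) (use assms in auto)
  have "card E \<le> card ((\<Union>z\<in>A. F z) \<union> (\<Union>z\<in>A'. F' z))"
    using 1 2 by (intro card_mono assms(5)) auto
  also have "\<dots> \<le> card (\<Union>z\<in>A. F z) + card (\<Union>z\<in>A'. F' z)" by (rule card_Un_le)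
  also have "\<dots> \<le> card A * c + card A' * c" using 1 2 by linarith
  also have "\<dots> \<le> k * c + k * c" using assms(1,2) by (intro add_mono mult_right_mono) auto
  finally show ?thesis using finite_subset[OF assms(5)] 1 2 by (simp add: mult.assoc)
qed

lemma K_rows: "finite {w. K n v w \<noteq> 0} \<and> card {w. K n v w \<noteq> 0} \<le> 2 * c * c"
proof (rule count_two)
  show "{w. K n v w \<noteq> 0} \<subseteq> (\<Union>z\<in>{z. f (\<phi> (- n) v, \<phi> (- n) z) \<noteq> 0}. {w. g (z, w) \<noteq> 0}) \<union>
      (\<Union>z\<in>{z. g (v, z) \<noteq> 0}. {w. f (\<phi> (- n) z, \<phi> (- n) w) \<noteq> 0})"
    using K_nonzero(3)[of n v] by blast
qed (rule fibres_f_shift fibres_g)+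

lemma K_cols: "finite {v. K n v w \<noteq> 0} \<and> card {v. K n v w \<noteq> 0} \<le> 2 * c * c"
proof (rule count_two)
  show "{v. K n v w \<noteq> 0} \<subseteq> (\<Union>z\<in>{z. g (z, w) \<noteq> 0}. {v. f (\<phi> (- n) v, \<phi> (- n) z) \<noteq> 0}) \<union>
      (\<Union>z\<in>{z. f (\<phi> (- n) z, \<phi> (- n) w) \<noteq> 0}. {v. g (v, z) \<noteq> 0})"
    using K_nonzero(3)[of n _ w] by blast
qed (rule fibres_f_shift fibres_g)+

text \<open>
  The corner \<open>z\<close> of a rectangle is forward asymptotic to one of finitely many points from time \<open>T\<close> on, and backward
  asymptotic to one of finitely many points up to time \<open>- T - n\<close>.
\<close>

lemma count_middle:
  defines "Z n \<equiv> {z. \<phi> (- n) z \<in> supp_pts f \<and> z \<in> supp_pts g}"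
  shows "finite (Z n) \<and> card (Z n) \<le> card Rf * (card Rg * S (nat (2 * int T + n)))"
proof (rule count_union[OF fin_R(1)])
  define Z1 where "Z1 r = {z\<in>Z n. bclose X \<delta> (- int T) r (\<phi> (- n) z)}" for r
  have "\<exists>r\<in>Rf. bclose X \<delta> (- int T) r v" if "v \<in> supp_pts f" for v
    using that supp_f unfolding supp_pts_def by blast
  then show "Z n \<subseteq> (\<Union>r\<in>Rf. Z1 r)" by (auto simp: Z1_def Z_def)
  fix r
  show "finite (Z1 r) \<and> card (Z1 r) \<le> card Rg * S (nat (2 * int T + n))"
  proof (rule count_union[OF fin_R(2)])
    have "\<exists>r\<in>Rg. fclose X \<delta> (int T) r v" if "v \<in> supp_pts g" for v
      using that supp_g unfolding supp_pts_def by blast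
    then show "Z1 r \<subseteq> (\<Union>r'\<in>Rg. {z\<in>Z1 r. fclose X \<delta> (int T) r' z})" by (auto simp: Z1_def Z_def)
    fix r'
    show "finite {z\<in>Z1 r. fclose X \<delta> (int T) r' z} \<and>
        card {z\<in>Z1 r. fclose X \<delta> (int T) r' z} \<le> S (nat (2 * int T + n))"
    proof (rule count_orbits[unfolded count_bound_def, rule_format, of _ "- int T - n"])
      fix x y assume x: "x \<in> {z\<in>Z1 r. fclose X \<delta> (int T) r' z}" and y: "y \<in> {z\<in>Z1 r. fclose X \<delta> (int T) r' z}"
      have "bclose X (\<delta> + \<delta>) (- int T) (\<phi> (- n) x) (\<phi> (- n) y)"
        using x y unfolding Z1_def by (blast intro: bclose_trans bclose_sym)
      then have "bclose X (seps' X) (- int T - n) x y"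
        unfolding bclose_shift by (rule bclose_mono[OF _ delta(2)]) simp
      moreover have "fclose X (\<delta> + \<delta>) (int T) x y"
        using x y by (blast intro: fclose_trans fclose_sym)
      then have "fclose X (seps' X) (- int T - n + int (nat (2 * int T + n))) x y"
        by (rule fclose_mono[OF _ delta(2)]) simp
      ultimately show "bclose X (seps' X) (- int T - n) x y \<and>
          fclose X (seps' X) (- int T - n + int (nat (2 * int T + n))) x y" by blast
    qed
  qed
qed

lemma K_support:
  "finite {v. \<exists>w. K n v w \<noteq> 0} \<and>
   card {v. \<exists>w. K n v w \<noteq> 0} \<le> 2 * (card Rf * (card Rg * S (nat (2 * int T + n)))) * c"
proof (rule count_two[OF count_middle count_middle])
  have mem: "\<phi> (- n) z \<in> supp_pts f \<and> z \<in> supp_pts g"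
    if "f (\<phi> (- n) x, \<phi> (- n) z) \<noteq> 0 \<and> g (z, y) \<noteq> 0 \<or> g (x, z) \<noteq> 0 \<and> f (\<phi> (- n) z, \<phi> (- n) y) \<noteq> 0" for x y z
    using that unfolding supp_pts_def by blast
  show "{v. \<exists>w. K n v w \<noteq> 0} \<subseteq>
      (\<Union>z\<in>{z. \<phi> (- n) z \<in> supp_pts f \<and> z \<in> supp_pts g}. {v. f (\<phi> (- n) v, \<phi> (- n) z) \<noteq> 0}) \<union>
      (\<Union>z\<in>{z. \<phi> (- n) z \<in> supp_pts f \<and> z \<in> supp_pts g}. {v. g (v, z) \<noteq> 0})"
  proof
    fix v assume "v \<in> {v. \<exists>w. K n v w \<noteq> 0}"
    then obtain w where "K n v w \<noteq> 0" by blast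
    from K_nonzero(3)[OF this] obtain z where
      z: "f (\<phi> (- n) v, \<phi> (- n) z) \<noteq> 0 \<and> g (z, w) \<noteq> 0 \<or> g (v, z) \<noteq> 0 \<and> f (\<phi> (- n) z, \<phi> (- n) w) \<noteq> 0"
      by blast
    then show "v \<in> (\<Union>z\<in>{z. \<phi> (- n) z \<in> supp_pts f \<and> z \<in> supp_pts g}. {v. f (\<phi> (- n) v, \<phi> (- n) z) \<noteq> 0}) \<union>
      (\<Union>z\<in>{z. \<phi> (- n) z \<in> supp_pts f \<and> z \<in> supp_pts g}. {v. g (v, z) \<noteq> 0})"
      using mem[OF z] by blast
  qed
qed (rule fibres_f_shift fibres_g)+

lemma K_vanish:
  assumes "n \<le> - int m0"
  shows "K n v w = 0"
proof (rule ccontr)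
  assume "K n v w \<noteq> 0"
  from K_nonzero(3)[OF this] obtain z where "\<phi> (- n) z \<in> supp_pts f" "z \<in> supp_pts g"
    unfolding supp_pts_def by blast
  then show False using disj[of "- n" z] assms by simp
qed

lemma K_bounded: "cmod (K n v w) \<le> 2 * real c * B\<^sup>2"
proof -
  have *: "cmod (\<Sum>z\<in>A. F z) \<le> real c * B\<^sup>2" if "finite A \<and> card A \<le> c" "\<And>z. cmod (F z) \<le> B\<^sup>2" for A and F :: "'a \<Rightarrow> complex"
  proof -
    have "cmod (\<Sum>z\<in>A. F z) \<le> real (card A) * B\<^sup>2" by (rule sum_norm_bound) (rule that(2))
    also have "\<dots> \<le> real c * B\<^sup>2" using that(1) by (intro mult_right_mono) auto
    finally show ?thesis .
  qed
  have prod: "cmod (f a * g b) \<le> B\<^sup>2" "cmod (g b * f a) \<le> B\<^sup>2" for a b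
    unfolding norm_mult power2_eq_square by (intro mult_mono bounded B0 norm_ge_zero)+
  have "cmod (\<Sum>z | f (\<phi> (- n) v, \<phi> (- n) z) \<noteq> 0. f (\<phi> (- n) v, \<phi> (- n) z) * g (z, w)) \<le> real c * B\<^sup>2"
    by (rule *[OF fibres_f_shift(1) prod(1)])
  moreover have "cmod (\<Sum>z | g (v, z) \<noteq> 0. g (v, z) * f (\<phi> (- n) z, \<phi> (- n) w)) \<le> real c * B\<^sup>2"
    by (rule *[OF fibres_g(1) prod(2)])
  ultimately show ?thesis
    unfolding block_kernel_def using B0 by (auto intro!: order_trans[OF norm_triangle_ineq4])
qed

lemma hpts_iff: "v \<in> hpts X P Q \<longleftrightarrow> v \<in> unst_pts X Q \<and> v \<in> unst_pts (flip X) P"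
  by (auto simp: hpts_def unst_pts_def glob_flip[OF bij])

text \<open>
  The four points \<open>v\<close>, \<open>z\<close>, \<open>w\<close>, \<open>z'\<close> form a rectangle with long stable sides \<open>(v, z)\<close>, \<open>(z', w)\<close> and
  unstable sides \<open>(z, w)\<close>, \<open>(v, z')\<close>. Corners joined by an unstable side are close in backward time, so the two
  stable sides are close in the stable groupoid after applying \<open>\<phi>\<^sup>-\<^sup>n\<close>; symmetrically for the unstable sides.
\<close>

lemma rectangle_estimate:
  assumes I: "v \<in> hpts X P Q" "w \<in> hpts X P Q"
    and vz: "fclose X \<delta> (int T' - n) v z" and zw: "bclose X \<delta> (- int T') z w"
    and vz': "bclose X \<delta> (- int T') v z'" and z'w: "fclose X \<delta> (int T' - n) z' w"
    and n: "2 * int T' + 1 + int (scale_step X) \<le> n"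
  shows "cmod (f (\<phi> (- n) v, \<phi> (- n) z) * g (z, w) - g (v, z') * f (\<phi> (- n) z', \<phi> (- n) w))
    \<le> 2 * B * C * 2 powr (- ((real_of_int n - 2 * real T' - 1) / real (scale_step X)))"
proof -
  have flip_step: "scale_step (flip X) = scale_step X" by (simp add: scale_step_def flip_sel)
  define l where "l = nat (n - int T')"
  have l: "int l = n - int T'" "T' + 1 + scale_step X \<le> l" using n by (simp_all add: l_def nat_le_eq_zle)
  have fz: "fclose X (seps' X) (int T' - n) x y" if "fclose X \<delta> (int T' - n) x y" for x y
    by (rule fclose_mono[OF that delta(3) order_refl])
  have bz: "bclose X (seps' X) (- int T') x y" if "bclose X \<delta> (- int T') x y" for x y
    by (rule bclose_mono[OF that delta(3) order_refl])
  have st: "y \<in> unst_pts (flip X) P" if "fclose X (seps' X) t x y" "x \<in> unst_pts (flip X) P" for x y t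
    using hyperbolic.unst_pts_bclose[OF flip_hyperbolic, of "- t" x y P] that
    by (simp add: flip_sel flip_close[OF bij])
  have U: "v \<in> unst_pts X Q" "w \<in> unst_pts X Q" "z \<in> unst_pts X Q" "z' \<in> unst_pts X Q"
    using I hpts_iff unst_pts_bclose[OF bclose_sym[OF bz[OF zw]]] unst_pts_bclose[OF bz[OF vz']] by blast+
  have W: "v \<in> unst_pts (flip X) P" "w \<in> unst_pts (flip X) P" "z \<in> unst_pts (flip X) P" "z' \<in> unst_pts (flip X) P"
    using I hpts_iff st[OF fz[OF vz]] st[OF fclose_sym[OF fz[OF z'w]]] by blast+
  have Gs: "(\<phi> (- n) v, \<phi> (- n) z) \<in> G_s X Q" "(\<phi> (- n) z', \<phi> (- n) w) \<in> G_s X Q"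
    unfolding G_s_iff unst_pts_phi[OF inv_Q] glob_s_phi
    using U fclose_imp_glob_s[OF fz[OF vz]] fclose_imp_glob_s[OF fz[OF z'w]] by blast+
  have Gu: "(z, w) \<in> G_u X P" "(v, z') \<in> G_u X P"
    unfolding G_u_def G_s_iff glob_flip[OF bij]
    using W bclose_imp_glob_u[OF bz[OF zw]] bclose_imp_glob_u[OF bz[OF vz']] by blast+
  have ex: "(real l - real T' - 1) = real_of_int n - 2 * real T' - 1"
    using arg_cong[OF l(1), of real_of_int] by simp
  define \<eta> where "\<eta> = 2 powr (- ((real_of_int n - 2 * real T' - 1) / real (scale_step X)))"
  have "cmod (f (\<phi> (- n) v, \<phi> (- n) z) - f (\<phi> (- n) z', \<phi> (- n) w)) \<le> C * \<eta>"
    unfolding \<eta>_def ex[symmetric]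
  proof (rule est_f[unfolded lip_estimate_def, rule_format, OF Gs _ _ _ _ l(2)])
    show "fclose X (seps' X / 4) (int T') (\<phi> (- n) v) (\<phi> (- n) z)"
      unfolding fclose_shift using fclose_mono[OF vz delta(4) order_refl] by simp
    show "fclose X (seps' X) (int T') (\<phi> (- n) z') (\<phi> (- n) w)"
      unfolding fclose_shift using fz[OF z'w] by simp
    show "bclose X \<delta> (int l) (\<phi> (- n) v) (\<phi> (- n) z')" "bclose X \<delta> (int l) (\<phi> (- n) z) (\<phi> (- n) w)"
      unfolding bclose_shift using vz' zw l(1) by simp_all
  qed
  moreover have "cmod (g (z, w) - g (v, z')) \<le> C * \<eta>"
    unfolding \<eta>_def ex[symmetric]
  proof (rule est_g[unfolded lip_estimate_def flip_sel flip_close[OF bij] minus_minus flip_step,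
        rule_format, OF Gu _ _ _ _ l(2)])
    show "bclose X (seps' X / 4) (- int T') z w" by (rule bclose_mono[OF zw delta(4) order_refl])
    show "bclose X (seps' X) (- int T') v z'" by (rule bz[OF vz'])
    show "fclose X \<delta> (- int l) z v" "fclose X \<delta> (- int l) w z'"
      using fclose_sym[OF vz] fclose_sym[OF z'w] l(1) by simp_all
  qed
  moreover have "f (\<phi> (- n) v, \<phi> (- n) z) * g (z, w) - g (v, z') * f (\<phi> (- n) z', \<phi> (- n) w) =
      (f (\<phi> (- n) v, \<phi> (- n) z) - f (\<phi> (- n) z', \<phi> (- n) w)) * g (z, w) +
      f (\<phi> (- n) z', \<phi> (- n) w) * (g (z, w) - g (v, z'))"
    by (simp add: algebra_simps)
  moreover have "cmod (x * g b + f a * y) \<le> (C * \<eta>) * B + B * (C * \<eta>)"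
    if "cmod x \<le> C * \<eta>" "cmod y \<le> C * \<eta>" for x y a b
  proof -
    have "0 \<le> C * \<eta>" using const(1) by (simp add: \<eta>_def)
    then have "cmod (x * g b) \<le> (C * \<eta>) * B" "cmod (f a * y) \<le> B * (C * \<eta>)"
      unfolding norm_mult using that by (intro mult_mono bounded B0 norm_ge_zero; simp)+
    then show ?thesis using norm_triangle_ineq[of "x * g b" "f a * y"] by linarith
  qed
  ultimately have "cmod (f (\<phi> (- n) v, \<phi> (- n) z) * g (z, w) - g (v, z') * f (\<phi> (- n) z', \<phi> (- n) w)) \<le>
      (C * \<eta>) * B + B * (C * \<eta>)"
    by metis
  then show ?thesis by (simp add: \<eta>_def algebra_simps)
qed

lemma sum_single:
  assumes "finite A" "\<And>y. y \<in> A \<Longrightarrow> y \<noteq> z \<Longrightarrow> F y = 0" "z \<notin> A \<Longrightarrow> F z = 0"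
  shows "(\<Sum>y\<in>A. F y) = (F z :: complex)"
proof -
  have "(\<Sum>y\<in>A. F y) = (\<Sum>y\<in>{z}. F y)"
    by (rule sum.mono_neutral_cong) (use assms in auto)
  then show ?thesis by simp
qed

text \<open>
  Three corners of a rectangle are controlled up to the time \<open>T\<close> of the supports; the fourth one, given by
  \<open>orbit_bracket\<close>, up to \<open>T' = T + j\<close>, where \<open>j\<close> is the time it takes to contract \<open>\<epsilon>\<^sub>X\<close> to the scale \<open>\<delta>\<close>. So if the
  entry is non-zero, both \<open>z\<close> and \<open>z'\<close> exist at the scale \<open>T'\<close>. There they are unique by expansiveness, so each of
  the two sums has at most one non-zero term.
\<close>

lemma K_decay:
  obtains T' where "\<And>n v w. 2 * int T' + 1 + int (scale_step X) \<le> n \<Longrightarrow>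
    cmod (K n v w) \<le> 2 * B * C * 2 powr (- ((real_of_int n - 2 * real T' - 1) / real (scale_step X)))"
proof -
  obtain j where j: "inverse (slam X) ^ j * seps X \<le> \<delta>" by (rule lam_power_small[OF delta(1)])
  define T' where "T' = T + j"
  have "cmod (K n v w) \<le> 2 * B * C * 2 powr (- ((real_of_int n - 2 * real T' - 1) / real (scale_step X)))"
    if n: "2 * int T' + 1 + int (scale_step X) \<le> n" for n v w
  proof (cases "K n v w = 0")
    case True
    then show ?thesis using B0 const(1) by simp
  next
    case False
    note I = K_nonzero(1,2)[OF False]
    have t12: "int T - n \<le> - int T" using n by (simp add: T'_def)
    have long: "int T - n \<le> int T' - n" and late: "- int T' \<le> - int T" by (simp_all add: T'_def)
    have side_f: "fclose X \<delta> (int T - n) x y" if "f (\<phi> (- n) x, \<phi> (- n) y) \<noteq> 0" for x y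
      using supp_f(1)[OF that] by (simp add: fclose_shift)
    have side_g: "bclose X \<delta> (- int T) x y" if "g (x, y) \<noteq> 0" for x y
      by (rule supp_g(1)[OF that])
    have corner: "\<exists>z'. fclose X \<delta> (int T' - n) y z' \<and> bclose X \<delta> (- int T') x z'"
      if xz: "fclose X \<delta> (int T - n) x z" and zy: "bclose X \<delta> (- int T) z y" for x y z
    proof -
      have "d (\<phi> i x) (\<phi> i y) \<le> seps' X" if "int T - n \<le> i" "i \<le> - int T" for i
        using tri[of "\<phi> i x" "\<phi> i y" "\<phi> i z"] xz zy that delta(2) unfolding fclose_def bclose_def
        by fastforce
      then obtain z' where "fclose X \<delta> (int T - n + int j) y z'" "bclose X \<delta> (- int T - int j) x z'"
        by (rule orbit_bracket[OF _ t12 j]) auto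
      then show ?thesis by (intro exI[of _ z']) (simp add: T'_def algebra_simps)
    qed
    have uniq: "y = z" if "fclose X \<delta> (int T' - n) x y" "bclose X \<delta> (- int T') y x'"
      "fclose X \<delta> (int T' - n) x z" "bclose X \<delta> (- int T') z x'" for x x' y z
    proof -
      have F: "fclose X (\<delta> + \<delta>) (int T' - n) y z" by (rule fclose_trans[OF fclose_sym[OF that(1)] that(3)])
      have Bc: "bclose X (\<delta> + \<delta>) (- int T') y z" by (rule bclose_trans[OF that(2) bclose_sym[OF that(4)]])
      have "d (\<phi> i y) (\<phi> i z) \<le> seps' X" for i
      proof (cases "i \<le> - int T'")
        case True
        then show ?thesis using Bc delta(2) unfolding bclose_def by fastforce
      next
        case False
        then have "int T' - n \<le> i" using n by linarith
        then show ?thesis using F delta(2) unfolding fclose_def by fastforce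
      qed
      then show ?thesis by (rule expansive)
    qed
    obtain z z' where vz: "fclose X \<delta> (int T' - n) v z" and zw: "bclose X \<delta> (- int T') z w"
      and vz': "bclose X \<delta> (- int T') v z'" and z'w: "fclose X \<delta> (int T' - n) z' w"
      using K_nonzero(3)[OF False]
    proof (elim disjE exE conjE)
      fix z assume "f (\<phi> (- n) v, \<phi> (- n) z) \<noteq> 0" "g (z, w) \<noteq> 0"
      then have s: "fclose X \<delta> (int T - n) v z" "bclose X \<delta> (- int T) z w" using side_f side_g by blast+
      from corner[OF s] obtain z' where "fclose X \<delta> (int T' - n) w z'" "bclose X \<delta> (- int T') v z'" by blast
      then show thesis
        using that[of z z'] fclose_mono[OF s(1) order_refl long] bclose_mono[OF s(2) order_refl late] fclose_sym
        by blast
    next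
      fix z' assume "g (v, z') \<noteq> 0" "f (\<phi> (- n) z', \<phi> (- n) w) \<noteq> 0"
      then have s: "fclose X \<delta> (int T - n) w z'" "bclose X \<delta> (- int T) z' v"
        using fclose_sym[OF side_f] bclose_sym[OF side_g] by blast+
      from corner[OF s] obtain z where "fclose X \<delta> (int T' - n) v z" "bclose X \<delta> (- int T') w z" by blast
      then show thesis
        using that[of z z'] fclose_mono[OF fclose_sym[OF s(1)] order_refl long]
          bclose_mono[OF bclose_sym[OF s(2)] order_refl late] bclose_sym
        by blast
    qed
    have f_T': "fclose X \<delta> (int T' - n) x y" if "f (\<phi> (- n) x, \<phi> (- n) y) \<noteq> 0" for x y
      by (rule fclose_mono[OF side_f[OF that] order_refl long])
    have g_T': "bclose X \<delta> (- int T') x y" if "g (x, y) \<noteq> 0" for x y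
      by (rule bclose_mono[OF side_g[OF that] order_refl late])
    have "(\<Sum>y | f (\<phi> (- n) v, \<phi> (- n) y) \<noteq> 0. f (\<phi> (- n) v, \<phi> (- n) y) * g (y, w)) =
        f (\<phi> (- n) v, \<phi> (- n) z) * g (z, w)"
    proof (rule sum_single)
      show "finite {y. f (\<phi> (- n) v, \<phi> (- n) y) \<noteq> 0}" using fibres_f_shift(1) by blast
      show "f (\<phi> (- n) v, \<phi> (- n) y) * g (y, w) = 0" if "y \<noteq> z" for y
        using uniq[OF f_T' g_T' vz zw, of y] that by auto
    qed auto
    moreover have "(\<Sum>y | g (v, y) \<noteq> 0. g (v, y) * f (\<phi> (- n) y, \<phi> (- n) w)) =
        g (v, z') * f (\<phi> (- n) z', \<phi> (- n) w)"
    proof (rule sum_single)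
      show "finite {y. g (v, y) \<noteq> 0}" using fibres_g(1) by blast
      show "g (v, y) * f (\<phi> (- n) y, \<phi> (- n) w) = 0" if "y \<noteq> z'" for y
        using uniq[OF fclose_sym[OF f_T'] bclose_sym[OF g_T'] fclose_sym[OF z'w] bclose_sym[OF vz'], of y] that
        by auto
    qed auto
    ultimately show ?thesis
      unfolding block_kernel_def using I rectangle_estimate[OF I vz zw vz' z'w n] by simp
  qed
  then show thesis by (rule that)
qed

end

lemma periodic_orbit_finite_invariant:
  assumes "periodic_orbit h P"
  shows "finite P" "h ` P = P"
proof -
  obtain x k where k: "0 < k" "(h ^^ k) x = x" and P: "P = {(h ^^ n) x |n. True}"
    using assms unfolding periodic_orbit_def by blast
  have "P \<subseteq> (\<lambda>n. (h ^^ n) x) ` {..<k}"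
  proof
    fix y assume "y \<in> P"
    then obtain n where "y = (h ^^ n) x" using P by blast
    then have "y = (h ^^ (n mod k)) x" by (simp add: funpow_mod_eq[OF k(2)])
    then show "y \<in> (\<lambda>n. (h ^^ n) x) ` {..<k}" using k(1) by auto
  qed
  then show "finite P" by (rule finite_subset) simp
  have "h ((h ^^ n) x) \<in> P" for n unfolding P by (auto intro!: exI[of _ "Suc n"])
  moreover have "(h ^^ n) x \<in> h ` P" for n
  proof -
    have "(h ^^ (n + k)) x = (h ^^ n) x" by (simp add: funpow_add k(2))
    moreover have "n + k = Suc (n + k - 1)" using k(1) by simp
    ultimately have "(h ^^ n) x = h ((h ^^ (n + k - 1)) x)" by (metis comp_apply funpow.simps(2))
    then show ?thesis unfolding P by blast
  qed
  ultimately show "h ` P = P" unfolding P by blast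
qed

context hyperbolic
begin

text \<open>
  Let \<open>3 \<gamma>\<close> be at most the distance of \<open>P\<close> and \<open>Q\<close>. The orbit of \<open>z\<close> is \<open>\<gamma>\<close>-close to \<open>Q\<close> up to time
  \<open>m - T\<^sub>f\<close> and to \<open>P\<close> from time \<open>T\<^sub>g\<close> on, so these two ranges of times cannot meet.
\<close>

lemma supports_disjoint:
  assumes P: "finite P" "smap X ` P = P" and Q: "finite Q" "smap X ` Q = Q" and PQ: "P \<inter> Q = {}"
    and f: "f \<in> Lip_c (G_s X Q) (top_s X Q) D" and g: "g \<in> Lip_c (G_u X P) (top_u X P) D'"
  obtains m0 :: nat where "\<And>z m. \<phi> m z \<in> supp_pts f \<Longrightarrow> z \<in> supp_pts g \<Longrightarrow> m < int m0"
proof -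
  define \<gamma> where "\<gamma> = Min (insert 1 ((\<lambda>(p, q). d p q) ` (P \<times> Q))) / 3"
  have fin: "finite (insert 1 ((\<lambda>(p, q). d p q) ` (P \<times> Q)))" using P Q by simp
  have "0 < d p q" if "p \<in> P" "q \<in> Q" for p q
    using that PQ by (metis disjoint_iff mdist_pos_less UNIV_I)
  then have \<gamma>: "0 < \<gamma>" unfolding \<gamma>_def using fin by (auto simp: Min_gr_iff)
  have sep: "3 * \<gamma> \<le> d p q" if "p \<in> P" "q \<in> Q" for p q
    unfolding \<gamma>_def using fin that by (auto simp: Min_le_iff)
  obtain Tf where Tf: "\<And>v. v \<in> supp_pts f \<Longrightarrow> \<exists>q\<in>Q. bclose X \<gamma> (- int Tf) q v"
    using supp_near_orbit[OF f \<gamma>] by blast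
  obtain Tg where Tg: "\<And>v. v \<in> supp_pts g \<Longrightarrow> \<exists>p\<in>P. bclose (flip X) \<gamma> (- int Tg) p v"
    using hyperbolic.supp_near_orbit[OF flip_hyperbolic g[unfolded G_u_def top_u_def] \<gamma>] by blast
  have "m < int (Tf + Tg)" if z: "\<phi> m z \<in> supp_pts f" "z \<in> supp_pts g" for z m
  proof (rule ccontr)
    assume m: "\<not> m < int (Tf + Tg)"
    obtain q where q: "q \<in> Q" "bclose X \<gamma> (- int Tf) q (\<phi> m z)" using Tf[OF z(1)] by blast
    obtain p where p: "p \<in> P" "fclose X \<gamma> (int Tg) p z"
      using Tg[OF z(2)] by (auto simp: flip_close[OF bij])
    have "int Tg - m \<le> - int Tf" using m by simp
    then have "d (\<phi> (int Tg - m) q) (\<phi> (int Tg - m) (\<phi> m z)) \<le> \<gamma>"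
      using q(2) unfolding bclose_def by blast
    then have 1: "d (\<phi> (int Tg) z) (\<phi> (int Tg - m) q) \<le> \<gamma>"
      by (simp add: phi_add[symmetric] commute)
    have 2: "d (\<phi> (int Tg) p) (\<phi> (int Tg) z) \<le> \<gamma>" using p(2) unfolding fclose_def by blast
    have "3 * \<gamma> \<le> d (\<phi> (int Tg) p) (\<phi> (int Tg - m) q)"
      using p(1) q(1) by (intro sep) (simp_all add: phi_mem[OF P(2)] phi_mem[OF Q(2)])
    then show False
      using 1 2 \<gamma> tri[of "\<phi> (int Tg) p" "\<phi> (int Tg - m) q" "\<phi> (int Tg) z"] by linarith
  qed
  then show thesis by (rule that)
qed

text \<open>
  Vanishing, decay and counting for a single pair of functions, as needed for \<open>block_sum_schatten\<close>. The finite
  fibres ensure that the sums in the products of the two matrices are finite.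
\<close>

theorem block_kernel_bounds:
  fixes M D :: real and S :: "nat \<Rightarrow> nat"
  assumes P: "periodic_orbit (smap X) P" and Q: "periodic_orbit (smap X) Q" and PQ: "P \<inter> Q = {}"
    and f: "f \<in> Lip_c (G_s X Q) (top_s X Q) (D_s X Q)" and g: "g \<in> Lip_c (G_u X P) (top_u X P) (D_u X P)"
    and sep: "\<And>n E. finite E \<Longrightarrow> separated_set X n (seps' X) E \<Longrightarrow> card E \<le> S n"
    and growth: "\<And>n. real (S n) \<le> D * M ^ n" and M: "1 < M" and D: "0 \<le> D"
  defines "K \<equiv> block_kernel (smap X) (hpts X P Q) f g"
    and "\<theta> \<equiv> 2 powr (- 1 / real (scale_step X))"
  shows "\<And>v. finite {w. f (v, w) \<noteq> 0}" "\<And>v. finite {w. g (v, w) \<noteq> 0}"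
    "\<exists>c C E m. block_bounds \<theta> M K c C E m"
proof -
  note P' = periodic_orbit_finite_invariant[OF P] and Q' = periodic_orbit_finite_invariant[OF Q]
  have \<delta>: "0 < seps' X / 8" using eps'_pos by simp
  obtain m0 :: nat where disj: "\<And>z m. \<phi> m z \<in> supp_pts f \<Longrightarrow> z \<in> supp_pts g \<Longrightarrow> m < int m0"
    using supports_disjoint[OF P' Q' PQ f g] by blast
  obtain Rf Tf where f_supp: "finite Rf" "Rf \<subseteq> unst_pts X Q" "close_support X (seps' X / 8) f Tf Rf"
    by (rule supp_close[OF f \<delta>])
  obtain Rg Tg where g_supp: "finite Rg" "Rg \<subseteq> unst_pts (flip X) P"
    "close_support (flip X) (seps' X / 8) g Tg Rg"
    by (rule hyperbolic.supp_close[OF flip_hyperbolic g[unfolded G_u_def top_u_def] \<delta>])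
  obtain Bf where Bf: "0 \<le> Bf" "\<And>a. cmod (f a) \<le> Bf" using Lip_c_bounded[OF f] by blast
  obtain Bg where Bg: "0 \<le> Bg" "\<And>a. cmod (g a) \<le> Bg"
    using hyperbolic.Lip_c_bounded[OF flip_hyperbolic g[unfolded G_u_def top_u_def D_u_def]] by blast
  obtain Cf where Cf: "0 \<le> Cf" "lip_estimate X (G_s X Q) f Cf" by (rule Lip_c_estimate[OF f])
  obtain Cg where Cg: "0 \<le> Cg" "lip_estimate (flip X) (G_u X P) g Cg"
    unfolding G_u_def
    by (rule hyperbolic.Lip_c_estimate[OF flip_hyperbolic g[unfolded G_u_def top_u_def D_u_def]])
  define T where "T = max Tf Tg"
  interpret commuting_pair X P Q f g T m0 Rf Rg "max Bf Bg" "max Cf Cg" D M S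
  proof (rule commuting_pair.intro[OF hyperbolic_axioms], rule commuting_pair_axioms.intro)
    show "close_support X (seps' X / 8) f T Rf"
      by (rule close_support_mono[OF f_supp(3)]) (simp add: T_def)
    show "close_support (flip X) (seps' X / 8) g T Rg"
      by (rule hyperbolic.close_support_mono[OF flip_hyperbolic g_supp(3)]) (simp add: T_def)
    show "cmod (f a) \<le> max Bf Bg" "cmod (g a) \<le> max Bf Bg" for a
      using Bf(2)[of a] Bg(2)[of a] by linarith+
    show "lip_estimate X (G_s X Q) f (max Cf Cg)" "lip_estimate (flip X) (G_u X P) g (max Cf Cg)"
      by (rule lip_estimate_mono[OF Cf(2)], simp) (rule lip_estimate_mono[OF Cg(2)], simp)
  qed (use P'(2) Q'(2) f_supp(1) g_supp(1) Cf(1) M D disj sep growth in auto)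
  show "finite {w. f (v, w) \<noteq> 0}" "finite {w. g (v, w) \<noteq> 0}" for v
    using fibres_f(1) fibres_g(1) by blast+
  obtain T' where T': "\<And>n v w. 2 * int T' + 1 + int (scale_step X) \<le> n \<Longrightarrow>
    cmod (K n v w) \<le> 2 * max Bf Bg * max Cf Cg * 2 powr (- ((real_of_int n - 2 * real T' - 1) / real (scale_step X)))"
    unfolding K_def using K_decay by blast
  define n1 where "n1 = 2 * int T' + 1 + int (scale_step X)"
  define C1 where "C1 = 2 * max Bf Bg * max Cf Cg * 2 powr ((2 * real T' + 1) / real (scale_step X))"
  define C2 where "C2 = 2 * real c * (max Bf Bg)\<^sup>2 * \<theta> powr (- real_of_int n1)"
  have C12: "0 \<le> C1" "0 \<le> C2" using Bf(1) Cf(1) by (simp_all add: C1_def C2_def)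
  have L: "0 < real (scale_step X)" using scale_step_pos by simp
  have \<theta>: "0 < \<theta>" "\<theta> < 1" using L by (simp_all add: \<theta>_def powr_less_one)
  \<comment> \<open>the decay holds from \<open>n\<^sub>1\<close> on; below \<open>n\<^sub>1\<close> the factor \<open>\<theta>\<^sup>n\<close> is bounded from below\<close>
  have dec: "cmod (K n v w) \<le> (C1 + C2) * \<theta> powr (real_of_int n)" for n v w
  proof (cases "n1 \<le> n")
    case True
    have "- ((real_of_int n - 2 * real T' - 1) / real (scale_step X)) =
        (2 * real T' + 1) / real (scale_step X) + (- real_of_int n / real (scale_step X))"
      using L by (simp add: field_simps)
    then have "2 powr (- ((real_of_int n - 2 * real T' - 1) / real (scale_step X))) =
        2 powr ((2 * real T' + 1) / real (scale_step X)) * 2 powr (- real_of_int n / real (scale_step X))"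
      by (simp only: powr_add)
    also have "2 powr (- real_of_int n / real (scale_step X)) = \<theta> powr (real_of_int n)"
      by (simp add: \<theta>_def powr_powr)
    finally have "cmod (K n v w) \<le> C1 * \<theta> powr (real_of_int n)"
      using T'[of n v w] True by (simp add: C1_def n1_def mult.assoc)
    also have "\<dots> \<le> (C1 + C2) * \<theta> powr (real_of_int n)" using C12 by (intro mult_right_mono) auto
    finally show ?thesis .
  next
    case False
    then have "\<theta> powr 0 \<le> \<theta> powr (real_of_int n - real_of_int n1)"
      using \<theta> by (intro powr_mono') auto
    then have "1 \<le> \<theta> powr (- real_of_int n1) * \<theta> powr (real_of_int n)"
      using \<theta> by (simp add: powr_add[symmetric])
    then have "2 * real c * (max Bf Bg)\<^sup>2 * 1 \<le> 2 * real c * (max Bf Bg)\<^sup>2 * (\<theta> powr (- real_of_int n1) * \<theta> powr (real_of_int n))"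
      by (rule mult_left_mono) simp
    also have "\<dots> = C2 * \<theta> powr (real_of_int n)" by (simp add: C2_def mult.assoc)
    also have "\<dots> \<le> (C1 + C2) * \<theta> powr (real_of_int n)" using C12 by (intro mult_right_mono) auto
    finally show ?thesis using K_bounded[of n v w] unfolding K_def by linarith
  qed
  define E where "E = 2 * real (card Rf) * real (card Rg) * real c * D * M powr (2 * real T + real m0)"
  have E0: "0 \<le> E" using D by (simp add: E_def)
  have count: "finite {v. \<exists>w. K n v w \<noteq> 0} \<and> real (card {v. \<exists>w. K n v w \<noteq> 0}) \<le> E * M powr (real_of_int n)" for n
  proof (cases "n \<le> - int m0")
    case True
    then show ?thesis using E0 K_vanish unfolding K_def by simp
  next
    case False
    have "M ^ nat (2 * int T + n) = M powr (real (nat (2 * int T + n)))" using M by (simp add: powr_realpow)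
    also have "\<dots> \<le> M powr ((2 * real T + real m0) + real_of_int n)"
      using M False by (intro powr_mono) linarith+
    finally have "D * M ^ nat (2 * int T + n) \<le> D * (M powr (2 * real T + real m0) * M powr (real_of_int n))"
      using D by (simp add: powr_add mult_left_mono)
    then have S: "real (S (nat (2 * int T + n))) \<le> D * (M powr (2 * real T + real m0) * M powr (real_of_int n))"
      using growth order_trans by blast
    have "card {v. \<exists>w. K n v w \<noteq> 0} \<le> 2 * (card Rf * (card Rg * S (nat (2 * int T + n)))) * c"
      using K_support[of n] unfolding K_def by blast
    then have "real (card {v. \<exists>w. K n v w \<noteq> 0}) \<le> real (2 * (card Rf * (card Rg * S (nat (2 * int T + n)))) * c)"
      by (rule of_nat_mono)
    also have "\<dots> = (2 * real (card Rf) * real (card Rg) * real c) * real (S (nat (2 * int T + n)))" by simp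
    also have "\<dots> \<le> (2 * real (card Rf) * real (card Rg) * real c) * (D * (M powr (2 * real T + real m0) * M powr (real_of_int n)))"
      by (rule mult_left_mono[OF S]) simp
    also have "\<dots> = E * M powr (real_of_int n)" by (simp add: E_def mult.assoc)
    finally show ?thesis using K_support[of n] unfolding K_def by blast
  qed
  have "block_bounds \<theta> M K (2 * c * c) (C1 + C2) E m0"
    unfolding block_bounds_def using dec count K_rows K_cols K_vanish by (auto simp: K_def)
  then show "\<exists>c C E m. block_bounds \<theta> M K c C E m" by blast
qed

end

section \<open>Counting separated orbits by entropy\<close>

lemma finer_metric_uniform:
  assumes M: "Metric_space UNIV d" "Metric_space UNIV d'" and top: "mtop d' = mtop d"
    and comp: "compact_space (mtop d)" and e: "0 < e"
  obtains e' where "0 < e'" "\<And>x y. d x y \<le> e' \<Longrightarrow> d' x y \<le> e"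
proof -
  have d: "mspace (metric (UNIV, d)) = UNIV" "mdist (metric (UNIV, d)) = d"
    "mtopology_of (metric (UNIV, d)) = mtop d"
    using M(1) by (simp_all add: Metric_space.mspace_metric Metric_space.mdist_metric
        Metric_space.mtopology_of mtop_def)
  have d': "mspace (metric (UNIV, d')) = UNIV" "mdist (metric (UNIV, d')) = d'"
    "mtopology_of (metric (UNIV, d')) = mtop d'"
    using M(2) by (simp_all add: Metric_space.mspace_metric Metric_space.mdist_metric
        Metric_space.mtopology_of mtop_def)
  have "uniformly_continuous_map (metric (UNIV, d)) (metric (UNIV, d')) (\<lambda>x. x)"
    by (rule continuous_imp_uniformly_continuous_map)
      (simp add: d(3) d'(3) top comp)
  then obtain \<delta> where \<delta>: "0 < \<delta>" "\<And>x y. d y x < \<delta> \<Longrightarrow> d' y x < e"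
    using e unfolding uniformly_continuous_map_def d d' by auto
  show thesis
  proof (rule that[of "\<delta> / 2"])
    show "d' x y \<le> e" if "d x y \<le> \<delta> / 2" for x y
      using \<delta>(2)[of x y] that \<delta>(1) by linarith
  qed (use \<delta>(1) in simp)
qed

text \<open>
  The supremum defining \<open>separated_number\<close> is taken in the natural numbers, where it is an upper bound only if the
  cardinalities are bounded. They are: recording near which of finitely many \<open>\<epsilon>/2\<close>-dense points an orbit
  passes at each of the \<open>n\<close> times distinguishes the members of a separated set.
\<close>

lemma card_le_separated_number:
  assumes M: "Metric_space UNIV (sdist X)" and comp: "compact_space (mtop (sdist X))" and e: "0 < e"
    and E: "finite E" "separated_set X n e E"
  shows "card E \<le> separated_number X n e"
proof -
  interpret Metric_space UNIV "sdist X" by fact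
  have "mtotally_bounded UNIV"
    using comp unfolding mtop_def compact_space_def
    by (simp add: compactin_imp_mtotally_bounded)
  then obtain C where C: "finite C" "UNIV \<subseteq> (\<Union>x\<in>C. mball x (e / 2))"
    using e unfolding mtotally_bounded_def by (meson half_gt_zero)
  have "\<exists>x. x \<in> C \<and> sdist X x y < e / 2" for y
    using C(2) by (auto simp: mball_def)
  then obtain near where near: "\<And>y. near y \<in> C" "\<And>y. sdist X (near y) y < e / 2" by metis
  have bound: "card E \<le> card (PiE {..<n} (\<lambda>_. C))" if E: "finite E" "separated_set X n e E" for E
  proof (rule card_inj_on_le)
    define code where "code x = restrict (\<lambda>i. near ((smap X ^^ i) x)) {..<n}" for x
    show "code ` E \<subseteq> PiE {..<n} (\<lambda>_. C)"
      unfolding code_def using near(1) by (intro image_subsetI) (simp add: restrict_PiE_iff)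
    show "finite (PiE {..<n} (\<lambda>_. C))" using C(1) by (intro finite_PiE) auto
    show "inj_on code E"
    proof (rule inj_onI, rule ccontr)
      fix x y assume xy: "x \<in> E" "y \<in> E" "code x = code y" "x \<noteq> y"
      then obtain i where i: "i < n" "sdist X ((smap X ^^ i) x) ((smap X ^^ i) y) > e"
        using E(2) unfolding separated_set_def by blast
      have "near ((smap X ^^ i) x) = near ((smap X ^^ i) y)"
        using fun_cong[OF xy(3), of i] i(1) by (simp add: code_def)
      then have "sdist X ((smap X ^^ i) x) ((smap X ^^ i) y) < e / 2 + e / 2"
        using near(2)[of "(smap X ^^ i) x"] near(2)[of "(smap X ^^ i) y"]
          triangle[of "(smap X ^^ i) x" "near ((smap X ^^ i) x)" "(smap X ^^ i) y"]
        by (simp add: commute)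
      then show False using i(2) by simp
    qed
  qed
  show ?thesis
    unfolding separated_number_def using E
    by (intro cSup_upper bdd_aboveI[of _ "card (PiE {..<n} (\<lambda>_. C))"]) (auto intro: bound)
qed

lemma entropy_nonneg: "0 \<le> entropy X"
proof -
  have "0 \<le> limsup (\<lambda>n. ereal (ln (real (separated_number X n 1)) / real n))"
  proof (rule le_Limsup)
    have "0 \<le> ln (real k)" for k :: nat by (cases "k = 0") auto
    then show "\<forall>\<^sub>F n in sequentially. 0 \<le> ereal (ln (real (separated_number X n 1)) / real n)"
      by (intro always_eventually allI) simp
  qed simp
  also have "\<dots> \<le> entropy X" unfolding entropy_def by (rule SUP_upper) simp
  finally show ?thesis .
qed

lemma separated_number_growth:
  assumes h: "entropy X < ereal h" "0 < h" and e: "0 < e"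
  obtains D where "0 \<le> D" "\<And>n. real (separated_number X n e) \<le> D * exp h ^ n"
proof -
  have "limsup (\<lambda>n. ereal (ln (real (separated_number X n e)) / real n)) \<le> entropy X"
    unfolding entropy_def using e by (intro SUP_upper) simp
  then have "limsup (\<lambda>n. ereal (ln (real (separated_number X n e)) / real n)) < ereal h"
    using h(1) by (rule le_less_trans)
  then have "\<forall>\<^sub>F n in sequentially. ereal (ln (real (separated_number X n e)) / real n) < ereal h"
    by (rule Limsup_lessD)
  then obtain n0 where n0: "\<And>n. n \<ge> n0 \<Longrightarrow> ln (real (separated_number X n e)) / real n < h"
    by (auto simp: eventually_sequentially)
  define D where "D = 1 + (\<Sum>n\<le>n0. real (separated_number X n e))"
  have D1: "1 \<le> D" unfolding D_def by (simp add: sum_nonneg)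
  have exp1: "1 \<le> exp h ^ n" for n using h(2) by (intro one_le_power) simp
  have "real (separated_number X n e) \<le> D * exp h ^ n" for n
  proof (cases "n \<le> n0 \<or> separated_number X n e = 0")
    case True
    have "real (separated_number X n e) \<le> D"
    proof (cases "n \<le> n0")
      case True
      then have "real (separated_number X n e) \<le> (\<Sum>n\<le>n0. real (separated_number X n e))"
        by (intro member_le_sum) auto
      then show ?thesis by (simp add: D_def)
    qed (use True D1 in simp)
    then show ?thesis using mult_mono[OF _ exp1[of n], of "real (separated_number X n e)" D] D1 by simp
  next
    case False
    then have n: "n0 < n" "0 < real (separated_number X n e)" by auto
    then have "ln (real (separated_number X n e)) < h * real n"
      using n0[of n] by (simp add: divide_less_eq)
    then have "real (separated_number X n e) < exp (h * real n)"
      using n(2) by (metis exp_less_mono exp_ln)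
    also have "\<dots> = exp h ^ n" by (rule exp_of_nat2_mult)
    also have "\<dots> \<le> D * exp h ^ n" using D1 by simp
    finally show ?thesis by simp
  qed
  then show thesis using D1 by (intro that[of D]) auto
qed

text \<open>
  The entropy is computed in the metric of \<open>X\<close>, the separation measured in that of \<open>X'\<close>; since both metrics
  induce the same compact topology, points separated for the second are uniformly separated for the first.
\<close>

theorem separated_growth:
  fixes X X' :: "'a smale_data"
  assumes X: "smale_space X" and d': "sdist X' \<in> sM X" and map: "smap X' = smap X"
    and h: "entropy X < ereal h" "0 < h" and e: "0 < e"
  obtains S :: "nat \<Rightarrow> nat" and D where "0 \<le> D" "\<And>n. real (S n) \<le> D * exp h ^ n"
    "\<And>n E. finite E \<Longrightarrow> separated_set X' n e E \<Longrightarrow> card E \<le> S n"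
proof -
  have M: "Metric_space UNIV (sdist X)" and comp: "compact_space (mtop (sdist X))"
    using X unfolding smale_space_def Let_def by blast+
  have M': "Metric_space UNIV (sdist X')" and top: "mtop (sdist X') = mtop (sdist X)"
    using d' unfolding sM_def by blast+
  obtain e' where e': "0 < e'" "\<And>x y. sdist X x y \<le> e' \<Longrightarrow> sdist X' x y \<le> e"
    using finer_metric_uniform[OF M M' top comp e] by blast
  obtain D where D: "0 \<le> D" "\<And>n. real (separated_number X n e') \<le> D * exp h ^ n"
    using separated_number_growth[OF h e'(1)] by blast
  have "card E \<le> separated_number X n e'" if E: "finite E" "separated_set X' n e E" for n E
  proof (rule card_le_separated_number[OF M comp e'(1) E(1)])
    show "separated_set X n e' E"
      using E(2) e'(2) unfolding separated_set_def map by (meson not_le)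
  qed
  then show thesis by (rule that[OF D])
qed

section \<open>The represented algebras\<close>

lemma ipow_eqI:
  assumes "bij F" "G 0 = x" "\<And>j. G (j + 1) = F (G j)"
  shows "ipow F j x = G j"
proof (induction j rule: int_induct[where k = 0])
  case base
  then show ?case by (simp add: assms(2))
next
  case (step1 i)
  then show ?case by (simp add: ipow_Suc[OF assms(1)] assms(3))
next
  case (step2 i)
  have "F (ipow F (i - 1) x) = F (G (i - 1))"
    using step2 ipow_Suc[OF assms(1), of "i - 1" x] assms(3)[of "i - 1"] by simp
  then show ?case using assms(1) by (simp add: bij_is_inj inj_eq)
qed

lemma ipow_amp_Bop: "ipow (amp_right Bop) j \<xi> (x, n) = \<xi> (x, n + j)"
proof -
  have "bij (amp_right Bop :: ('a \<times> int) opr)"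
    by (rule o_bij[of "amp_right Bop_adj"]) (auto simp: fun_eq_iff amp_right_def Bop_def Bop_adj_def)
  then have "ipow (amp_right Bop) j \<xi> = (\<lambda>(x, n). \<xi> (x, n + j))"
    by (rule ipow_eqI[where G = "\<lambda>j (x, n). \<xi> (x, n + j)"])
      (auto simp: fun_eq_iff amp_right_def Bop_def algebra_simps)
  then show ?thesis by simp
qed

lemma ipow_amp_uop:
  assumes h: "bij h"
  shows "ipow (amp_left (uop h) \<circ> amp_right Bop_adj) k \<xi> (x, n) = \<xi> (ipow h (- k) x, n - k)"
proof -
  have inv: "inv h (h x) = x" "h (inv h x) = x" for x
    using h by (simp_all add: bij_is_inj bij_is_surj surj_f_inv_f)
  have bij: "bij (amp_left (uop h) \<circ> amp_right Bop_adj)"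
    by (rule o_bij[of "\<lambda>\<xi> (x, n). \<xi> (h x, n + 1)"])
      (auto simp: fun_eq_iff amp_left_def amp_right_def uop_def Bop_adj_def inv)
  have "ipow h (- (k + 1)) x = ipow h (- k) (inv h x)" for k x
  proof -
    have "ipow h (- k) (inv h x) = ipow h (- (k + 1)) (ipow h 1 (inv h x))"
      using ipow_add[OF h, of "- (k + 1)" 1 "inv h x"] by simp
    then show ?thesis using h by (simp add: inv)
  qed
  then have "ipow (amp_left (uop h) \<circ> amp_right Bop_adj) k \<xi> = (\<lambda>(x, n). \<xi> (ipow h (- k) x, n - k))"
    by (intro ipow_eqI[OF bij, where G = "\<lambda>k (x, n). \<xi> (ipow h (- k) x, n - k)"])
      (auto simp: fun_eq_iff amp_left_def amp_right_def uop_def Bop_adj_def algebra_simps)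
  then show ?thesis by simp
qed

lemma ipow_alpha:
  assumes h: "bij h"
  shows "ipow (alpha h) n T \<xi> v = T (\<lambda>y. \<xi> (ipow h n y)) (ipow h (- n) v)"
proof -
  have inv: "inv h (h x) = x" "h (inv h x) = x" for x
    using h by (simp_all add: bij_is_inj bij_is_surj surj_f_inv_f)
  have al: "alpha h T = (\<lambda>\<xi> v. T (\<lambda>y. \<xi> (h y)) (inv h v))" for T
    unfolding alpha_def inv_uop[OF h] by (simp add: fun_eq_iff uop_def comp_def)
  have bij: "bij (alpha h)"
    by (rule o_bij[of "\<lambda>T \<xi> v. T (\<lambda>y. \<xi> (inv h y)) (h v)"]) (auto simp: fun_eq_iff al inv)
  have 1: "ipow h (- n - 1) v = ipow h (- n) (inv h v)" for n v
  proof -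
    have "ipow h (- n) (inv h v) = ipow h (- (n + 1)) (ipow h 1 (inv h v))"
      using ipow_add[OF h, of "- (n + 1)" 1 "inv h v"] by simp
    then show ?thesis using h by (simp add: inv)
  qed
  have "ipow (alpha h) n T = (\<lambda>\<xi> v. T (\<lambda>y. \<xi> (ipow h n y)) (ipow h (- n) v))"
    by (rule ipow_eqI[OF bij, where G = "\<lambda>n \<xi> v. T (\<lambda>y. \<xi> (ipow h n y)) (ipow h (- n) v)"])
      (simp_all add: al 1 ipow_Suc[OF h])
  then show ?thesis by simp
qed

lemma rho_finite_sum:
  assumes "\<And>a. a \<notin> G \<Longrightarrow> f a = 0" "finite {z. f (v, z) \<noteq> 0}"
  shows "rho I G f \<xi> v = (if v \<in> I then \<Sum>z | f (v, z) \<noteq> 0. f (v, z) * \<xi> z else 0)"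
proof -
  have "(\<Sum>\<^sub>\<infinity>z\<in>{z. (v, z) \<in> G}. f (v, z) * \<xi> z) = (\<Sum>\<^sub>\<infinity>z\<in>{z. f (v, z) \<noteq> 0}. f (v, z) * \<xi> z)"
    by (rule infsum_cong_neutral) (use assms(1) in auto)
  then show ?thesis using assms(2) by (simp add: rho_def)
qed

lemma rhobar_s_apply:
  assumes h: "bij (smap X)"
  shows "rhobar_s X a \<xi> (v, n) =
    (\<Sum>j | a j \<noteq> (\<lambda>_ _. 0). a j (\<lambda>y. \<xi> (ipow (smap X) n y, n + j)) (ipow (smap X) (- n) v))"
  unfolding rhobar_s_def integrated_def dsum_def by (simp add: ipow_alpha[OF h] ipow_amp_Bop)

lemma rhobar_u_apply:
  assumes h: "bij (smap X)"
  shows "rhobar_u X b \<xi> (v, n) =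
    (\<Sum>k | b k \<noteq> (\<lambda>_ _. 0). b k (\<lambda>y. \<xi> (ipow (smap X) (- k) y, n - k)) v)"
  unfolding rhobar_u_def integrated_def amp_left_def[of "b k" for k]
  by (simp add: ipow_amp_uop[OF h])

text \<open>
  Both sides are double sums over the intermediate point \<open>z\<close> and over \<open>w\<close>. The substitution \<open>u = \<phi>\<^sup>-\<^sup>n z\<close>, and
  \<open>u = \<phi>\<^sup>-\<^sup>n w\<close> in the second product, turns the stable matrix into that of \<open>\<alpha>\<^sup>n(\<rho>\<^sub>s(f))\<close>.
\<close>

lemma block_kernel_sum:
  assumes h: "bij h" and inv_I: "\<And>x j. ipow h j x \<in> I \<longleftrightarrow> x \<in> I"
    and fin: "\<And>v. finite {w. f (v, w) \<noteq> 0}" "\<And>v. finite {w. g (v, w) \<noteq> 0}"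
    and v: "v \<in> I" and \<zeta>: "\<And>w. w \<notin> I \<Longrightarrow> \<zeta> w = 0"
  shows "(\<Sum>u | f (ipow h (- n) v, u) \<noteq> 0. f (ipow h (- n) v, u) *
        (\<Sum>w | g (ipow h n u, w) \<noteq> 0. g (ipow h n u, w) * \<zeta> w)) -
      (\<Sum>z | g (v, z) \<noteq> 0. g (v, z) *
        (\<Sum>u | f (ipow h (- n) z, u) \<noteq> 0. f (ipow h (- n) z, u) * \<zeta> (ipow h n u))) =
      (\<Sum>w | block_kernel h I f g n v w \<noteq> 0. block_kernel h I f g n v w * \<zeta> w)"
proof -
  define \<phi> where "\<phi> = ipow h n"
  define \<phi>' where "\<phi>' = ipow h (- n)"
  have \<phi>: "\<phi> (\<phi>' x) = x" "\<phi>' (\<phi> x) = x" for x using h by (simp_all add: \<phi>_def \<phi>'_def)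
  have inj: "inj_on \<phi>' A" for A using \<phi>(1) by (metis inj_on_inverseI)
  have img: "{u. f (x, u) \<noteq> 0} = \<phi>' ` {z. f (x, \<phi>' z) \<noteq> 0}" for x
    by (auto simp: image_iff) (metis \<phi>(2))
  have reindex: "(\<Sum>u | f (x, u) \<noteq> 0. F u) = (\<Sum>z | f (x, \<phi>' z) \<noteq> 0. F (\<phi>' z))" for x and F :: "'a \<Rightarrow> complex"
    unfolding img by (subst sum.reindex[OF inj]) (simp add: comp_def)
  have fin': "finite {z. f (x, \<phi>' z) \<noteq> 0}" for x
    using fin(1)[of x] unfolding img by (rule finite_imageD[OF _ inj])
  define Z1 where "Z1 = {z. f (\<phi>' v, \<phi>' z) \<noteq> 0}"
  define Z2 where "Z2 = {z. g (v, z) \<noteq> 0}"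
  define W where "W = (\<Union>z\<in>Z1. {w. g (z, w) \<noteq> 0}) \<union> (\<Union>z\<in>Z2. {w. f (\<phi>' z, \<phi>' w) \<noteq> 0})"
  have Z: "finite Z1" "finite Z2" unfolding Z1_def Z2_def by (rule fin', rule fin(2))
  have W: "finite W" unfolding W_def using Z fin' fin(2) by blast
  have K: "block_kernel h I f g n v w * \<zeta> w =
      (\<Sum>z\<in>Z1. f (\<phi>' v, \<phi>' z) * (g (z, w) * \<zeta> w)) - (\<Sum>z\<in>Z2. g (v, z) * (f (\<phi>' z, \<phi>' w) * \<zeta> w))" for w
  proof (cases "w \<in> I")
    case True
    then show ?thesis using v unfolding block_kernel_def Z1_def Z2_def \<phi>'_def
      by (simp add: left_diff_distrib sum_distrib_right mult.assoc)
  qed (simp add: \<zeta>)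
  have 1: "(\<Sum>w | g (z, w) \<noteq> 0. g (z, w) * \<zeta> w) = (\<Sum>w\<in>W. g (z, w) * \<zeta> w)" if "z \<in> Z1" for z
    by (rule sum.mono_neutral_left[OF W]) (use that in \<open>auto simp: W_def\<close>)
  have 2: "(\<Sum>w | f (\<phi>' z, \<phi>' w) \<noteq> 0. f (\<phi>' z, \<phi>' w) * \<zeta> w) = (\<Sum>w\<in>W. f (\<phi>' z, \<phi>' w) * \<zeta> w)" if "z \<in> Z2" for z
    by (rule sum.mono_neutral_left[OF W]) (use that in \<open>auto simp: W_def\<close>)
  have K_W: "w \<in> W" if "block_kernel h I f g n v w \<noteq> 0" for w
  proof (rule ccontr)
    assume "w \<notin> W"
    then have "(\<Sum>z\<in>Z1. f (\<phi>' v, \<phi>' z) * g (z, w)) = 0" "(\<Sum>z\<in>Z2. g (v, z) * f (\<phi>' z, \<phi>' w)) = 0"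
      by (auto simp: W_def intro!: sum.neutral)
    then have "block_kernel h I f g n v w = 0"
      unfolding block_kernel_def Z1_def Z2_def \<phi>'_def by (simp only:) simp
    with that show False by contradiction
  qed
  have "(\<Sum>w | block_kernel h I f g n v w \<noteq> 0. block_kernel h I f g n v w * \<zeta> w) =
      (\<Sum>w\<in>W. block_kernel h I f g n v w * \<zeta> w)"
    by (rule sum.mono_neutral_left[OF W]) (use K_W in auto)
  also have "\<dots> = (\<Sum>w\<in>W. \<Sum>z\<in>Z1. f (\<phi>' v, \<phi>' z) * (g (z, w) * \<zeta> w)) -
      (\<Sum>w\<in>W. \<Sum>z\<in>Z2. g (v, z) * (f (\<phi>' z, \<phi>' w) * \<zeta> w))"
    unfolding K by (rule sum_subtractf)
  also have "\<dots> = (\<Sum>z\<in>Z1. f (\<phi>' v, \<phi>' z) * (\<Sum>w\<in>W. g (z, w) * \<zeta> w)) -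
      (\<Sum>z\<in>Z2. g (v, z) * (\<Sum>w\<in>W. f (\<phi>' z, \<phi>' w) * \<zeta> w))"
    unfolding sum_distrib_left by (subst (1 2) sum.swap) (rule refl)
  also have "\<dots> = (\<Sum>z\<in>Z1. f (\<phi>' v, \<phi>' z) * (\<Sum>w | g (z, w) \<noteq> 0. g (z, w) * \<zeta> w)) -
      (\<Sum>z\<in>Z2. g (v, z) * (\<Sum>w | f (\<phi>' z, \<phi>' w) \<noteq> 0. f (\<phi>' z, \<phi>' w) * \<zeta> w))"
    by (simp add: 1 2 cong: sum.cong)
  finally show ?thesis
    unfolding reindex \<phi>_def[symmetric] \<phi>'_def[symmetric] Z1_def Z2_def \<phi>(1) by simp
qed

context hyperbolic
begin

lemma hpts_phi:
  assumes "smap X ` P = P" "smap X ` Q = Q"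
  shows "\<phi> j x \<in> hpts X P Q \<longleftrightarrow> x \<in> hpts X P Q"
proof -
  have P: "smap (flip X) ` P = P"
    using assms(1) bij by (metis flip_sel(2) bij_is_inj image_inv_f_f)
  have "ipow (smap (flip X)) (- j) x \<in> unst_pts (flip X) P \<longleftrightarrow> x \<in> unst_pts (flip X) P"
    by (rule hyperbolic.unst_pts_phi[OF flip_hyperbolic P])
  then have "\<phi> j x \<in> unst_pts (flip X) P \<longleftrightarrow> x \<in> unst_pts (flip X) P"
    by (simp add: flip_sel ipow_inv[OF bij])
  moreover have "hpts X P Q = unst_pts (flip X) P \<inter> unst_pts X Q"
    by (simp add: hpts_def unst_pts_def glob_flip[OF bij])
  ultimately show ?thesis using unst_pts_phi[OF assms(2), of j x] by simp
qed

lemma hpts_G_s: "(v, w) \<in> G_s X Q \<Longrightarrow> v \<in> hpts X P Q \<Longrightarrow> w \<in> hpts X P Q"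
  unfolding hpts_def G_s_def using glob_s_trans by blast

lemma hpts_G_u: "(v, w) \<in> G_u X P \<Longrightarrow> v \<in> hpts X P Q \<Longrightarrow> w \<in> hpts X P Q"
  unfolding hpts_def G_u_eq[OF bij] using glob_u_trans by blast

text \<open>
  The matrix of the commutator of \<open>\<Sum>\<^sub>j a\<^sub>j u\<^sup>j\<close> and \<open>\<Sum>\<^sub>k b\<^sub>k u\<^sup>k\<close>: since \<open>u\<^sup>k \<otimes> B\<^sup>-\<^sup>k\<close> commutes with
  \<open>\<Oplus>\<^sub>n \<alpha>\<^sup>n(a\<^sub>j)\<close> and \<open>1 \<otimes> B\<^sup>j\<close> commutes with \<open>b\<^sub>k \<otimes> 1\<close>, the pair \<open>(j, k)\<close> contributes
  \<open>\<Oplus>\<^sub>n [\<alpha>\<^sup>n(a\<^sub>j), b\<^sub>k]\<close> times a permutation of the basis.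
\<close>

lemma commutator_apply:
  fixes a b :: "int \<Rightarrow> 'a opr" and P Q :: "'a set"
  defines "I \<equiv> hpts X P Q"
  assumes P: "smap X ` P = P" and Q: "smap X ` Q = Q"
    and a: "\<And>j. a j = rho I (G_s X Q) (f j)" and b: "\<And>k. b k = rho I (G_u X P) (g k)"
    and f: "\<And>j p. p \<notin> G_s X Q \<Longrightarrow> f j p = 0" and g: "\<And>k p. p \<notin> G_u X P \<Longrightarrow> g k p = 0"
    and fin: "\<And>j v. finite {w. f j (v, w) \<noteq> 0}" "\<And>k v. finite {w. g k (v, w) \<noteq> 0}"
    and \<xi>: "\<xi> \<in> l2 (I \<times> UNIV)"
  defines "A \<equiv> {j. a j \<noteq> (\<lambda>_ _. 0)}" and "B \<equiv> {k. b k \<noteq> (\<lambda>_ _. 0)}"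
  shows "commutator (rhobar_s X a) (rhobar_u X b) \<xi> (v, n) =
    (\<Sum>(j, k)\<in>A \<times> B. \<Sum>w | block_kernel (smap X) I (f j) (g k) n v w \<noteq> 0.
      block_kernel (smap X) I (f j) (g k) n v w * \<xi> (\<phi> (- k) w, n + (j - k)))"
proof -
  have inv_I: "\<phi> j x \<in> I \<longleftrightarrow> x \<in> I" for j x unfolding I_def by (rule hpts_phi[OF P Q])
  have fI: "w \<in> I" if "f j (v, w) \<noteq> 0" "v \<in> I" for j v w
    using that f hpts_G_s[of v w Q P] unfolding I_def by blast
  have gI: "w \<in> I" if "g k (v, w) \<noteq> 0" "v \<in> I" for k v w
    using that g hpts_G_u[of v w P Q] unfolding I_def by blast
  have a': "a j \<eta> x = (if x \<in> I then \<Sum>z | f j (x, z) \<noteq> 0. f j (x, z) * \<eta> z else 0)" for j \<eta> x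
    unfolding a by (rule rho_finite_sum[OF f fin(1)])
  have b': "b k \<eta> x = (if x \<in> I then \<Sum>z | g k (x, z) \<noteq> 0. g k (x, z) * \<eta> z else 0)" for k \<eta> x
    unfolding b by (rule rho_finite_sum[OF g fin(2)])
  note s = rhobar_s_apply[OF bij, of a, folded A_def] and u = rhobar_u_apply[OF bij, of b, folded B_def]
  show ?thesis
  proof (cases "v \<in> I")
    case False
    then have "block_kernel (smap X) I (f j) (g k) n v w = 0" for j k w by (simp add: block_kernel_def)
    then show ?thesis using False by (simp add: commutator_def s u a' b' inv_I)
  next
    case True
    have vn: "\<phi> (- n) v \<in> I" using True by (simp add: inv_I)
    define \<zeta> where "\<zeta> j k w = \<xi> (\<phi> (- k) w, n + (j - k))" for j k w
    have "rhobar_s X a (rhobar_u X b \<xi>) (v, n) =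
        (\<Sum>j\<in>A. \<Sum>z | f j (\<phi> (- n) v, z) \<noteq> 0. f j (\<phi> (- n) v, z) *
          (\<Sum>k\<in>B. \<Sum>w | g k (\<phi> n z, w) \<noteq> 0. g k (\<phi> n z, w) * \<zeta> j k w))"
      unfolding s a' using vn by (auto simp: u b' inv_I \<zeta>_def add_diff_eq fI intro!: sum.cong)
    also have "\<dots> = (\<Sum>j\<in>A. \<Sum>k\<in>B. \<Sum>z | f j (\<phi> (- n) v, z) \<noteq> 0. f j (\<phi> (- n) v, z) *
          (\<Sum>w | g k (\<phi> n z, w) \<noteq> 0. g k (\<phi> n z, w) * \<zeta> j k w))"
      unfolding sum_distrib_left[of _ _ B] by (intro sum.cong refl sum.swap)
    finally have 1: "rhobar_s X a (rhobar_u X b \<xi>) (v, n) = \<dots>" .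
    have phi: "\<phi> (k - n) (\<phi> (- k) z) = \<phi> (- n) z" "\<phi> (n - k) z = \<phi> (- k) (\<phi> n z)" for k z
      using phi_add[of "k - n" "- k" z] phi_add[of "- k" n z] by simp_all
    have "rhobar_u X b (rhobar_s X a \<xi>) (v, n) =
        (\<Sum>k\<in>B. \<Sum>z | g k (v, z) \<noteq> 0. g k (v, z) *
          (\<Sum>j\<in>A. \<Sum>w | f j (\<phi> (- n) z, w) \<noteq> 0. f j (\<phi> (- n) z, w) * \<zeta> j k (\<phi> n w)))"
      unfolding u b' using True by (auto simp: s a' inv_I \<zeta>_def phi algebra_simps gI intro!: sum.cong)
    also have "\<dots> = (\<Sum>k\<in>B. \<Sum>j\<in>A. \<Sum>z | g k (v, z) \<noteq> 0. g k (v, z) *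
          (\<Sum>w | f j (\<phi> (- n) z, w) \<noteq> 0. f j (\<phi> (- n) z, w) * \<zeta> j k (\<phi> n w)))"
      unfolding sum_distrib_left[of _ _ A] by (intro sum.cong refl sum.swap)
    also have "\<dots> = (\<Sum>j\<in>A. \<Sum>k\<in>B. \<Sum>z | g k (v, z) \<noteq> 0. g k (v, z) *
          (\<Sum>w | f j (\<phi> (- n) z, w) \<noteq> 0. f j (\<phi> (- n) z, w) * \<zeta> j k (\<phi> n w)))"
      by (rule sum.swap)
    finally have 2: "rhobar_u X b (rhobar_s X a \<xi>) (v, n) = \<dots>" .
    have \<zeta>: "\<zeta> j k w = 0" if "w \<notin> I" for j k w
      unfolding \<zeta>_def using that l2_vanish[OF \<xi>] by (simp add: inv_I)
    have 3: "(\<Sum>z | f j (\<phi> (- n) v, z) \<noteq> 0. f j (\<phi> (- n) v, z) *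
          (\<Sum>w | g k (\<phi> n z, w) \<noteq> 0. g k (\<phi> n z, w) * \<zeta> j k w)) -
        (\<Sum>z | g k (v, z) \<noteq> 0. g k (v, z) *
          (\<Sum>w | f j (\<phi> (- n) z, w) \<noteq> 0. f j (\<phi> (- n) z, w) * \<zeta> j k (\<phi> n w))) =
        (\<Sum>w | block_kernel (smap X) I (f j) (g k) n v w \<noteq> 0.
          block_kernel (smap X) I (f j) (g k) n v w * \<zeta> j k w)" for j k
      by (rule block_kernel_sum[OF bij inv_I fin True \<zeta>])
    have "commutator (rhobar_s X a) (rhobar_u X b) \<xi> (v, n) =
      (\<Sum>j\<in>A. \<Sum>k\<in>B. \<Sum>w | block_kernel (smap X) I (f j) (g k) n v w \<noteq> 0.
          block_kernel (smap X) I (f j) (g k) n v w * \<zeta> j k w)"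
      unfolding commutator_def 1 2 sum_subtractf[symmetric] 3 ..
    then show ?thesis by (simp add: sum.cartesian_product \<zeta>_def)
  qed
qed

end

section \<open>Commutation modulo Schatten ideals\<close>

theorem proposition7p9:
  fixes X X' :: "'a smale_data"
    and d' :: "'a \<Rightarrow> 'a \<Rightarrow> real"
    and P Q :: "'a set"
    and p :: real
  assumes "smale_space X" and "irreducible_smale X"
    and "periodic_orbit (smap X) P" and "periodic_orbit (smap X) Q" and "P \<inter> Q = {}"
    and "d' \<in> sM X"
    and "sdist X' = d'" and "smap X' = smap X" and "self_similar X'"
    and "ereal p > 2 * entropy X * ereal (real_of_int \<lceil>log (slam X') 3\<rceil>) / ereal (ln 2)"
  shows "\<forall>x \<in> rhobar_s X' ` Lambda_s X' P Q. \<forall>y \<in> rhobar_u X' ` Lambda_u X' P Q.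
           commutator x y \<in> schatten (hpts X' P Q \<times> (UNIV :: int set)) p"
proof (intro ballI)
  fix x y
  assume x: "x \<in> rhobar_s X' ` Lambda_s X' P Q" and y: "y \<in> rhobar_u X' ` Lambda_u X' P Q"
  interpret hyperbolic X' by (rule self_similar_hyperbolic) fact
  define L where "L = real (scale_step X')"
  have L: "0 < L" using scale_step_pos by (simp add: L_def)
  have L_eq: "real_of_int \<lceil>log (slam X') 3\<rceil> = L"
    using scale_step_pos unfolding L_def scale_step_def by linarith
  have orbits: "periodic_orbit (smap X') P" "periodic_orbit (smap X') Q" using assms by simp_all
  \<comment> \<open>any \<open>h\<close> above the entropy with \<open>h L < p ln 2\<close> would do; this one makes \<open>M \<theta>\<^sup>p\<close> equal to \<open>e\<^sup>-\<^sup>h\<close>\<close>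
  define h where "h = p * ln 2 / (2 * L)"
  have ln2: "0 < ln (2 :: real)" by simp
  obtain r where r: "entropy X = ereal r" "0 \<le> r" "2 * r * L / ln 2 < p"
  proof (cases "entropy X")
    case (real r)
    then show thesis
      using that[of r] entropy_nonneg[of X] assms(10) unfolding L_eq by simp
  next
    case PInf
    then have "2 * entropy X * ereal L / ereal (ln 2) = \<infinity>" using L by simp
    then show thesis using assms(10) unfolding L_eq by simp
  qed (use entropy_nonneg[of X] in simp)
  have "r < h" using r(3) L ln2 by (simp add: h_def field_simps)
  then have h: "entropy X < ereal h" "0 < h" using r by simp_all
  then have p: "0 < p" using L ln2 by (simp add: h_def zero_less_mult_iff zero_less_divide_iff)
  define M where "M = exp h"
  define \<theta> where "\<theta> = (2 :: real) powr (- 1 / L)"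
  have \<theta>: "0 < \<theta>" "\<theta> < 1" using L by (simp_all add: \<theta>_def powr_less_one)
  have M: "1 < M" using h(2) by (simp add: M_def)
  have "M * \<theta> powr p = exp (- h)"
    using L by (simp add: M_def \<theta>_def powr_powr powr_def h_def exp_add[symmetric] field_simps)
  then have M\<theta>: "M * \<theta> powr p < 1" using h(2) by simp
  have dM: "sdist X' \<in> sM X" using assms(6,7) by simp
  obtain S :: "nat \<Rightarrow> nat" and D where D: "0 \<le> D" and growth: "\<And>n. real (S n) \<le> D * M ^ n"
    and sep: "\<And>n E. finite E \<Longrightarrow> separated_set X' n (seps' X') E \<Longrightarrow> card E \<le> S n"
    by (rule separated_growth[OF assms(1) dM assms(8) h eps'_pos, folded M_def]) (rule that)
  define I where "I = hpts X' P Q"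
  obtain a where x: "x = rhobar_s X' a" and a: "a \<in> Lambda_s X' P Q" using x by blast
  obtain b where y: "y = rhobar_u X' b" and b: "b \<in> Lambda_u X' P Q" using y by blast
  define A where "A = {j. a j \<noteq> (\<lambda>_ _. 0)}"
  define B where "B = {k. b k \<noteq> (\<lambda>_ _. 0)}"
  have fin: "finite A" "finite B"
    using a b by (simp_all add: A_def B_def Lambda_s_def Lambda_u_def fin_sums_def)
  have "\<forall>j. \<exists>f. f \<in> Lip_c (G_s X' Q) (top_s X' Q) (D_s X' Q) \<and> a j = rho I (G_s X' Q) f"
    using a unfolding Lambda_s_def fin_sums_def I_def by blast
  then obtain f where f: "\<And>j. f j \<in> Lip_c (G_s X' Q) (top_s X' Q) (D_s X' Q)"
    and af: "\<And>j. a j = rho I (G_s X' Q) (f j)" by metis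
  have "\<forall>k. \<exists>g. g \<in> Lip_c (G_u X' P) (top_u X' P) (D_u X' P) \<and> b k = rho I (G_u X' P) g"
    using b unfolding Lambda_u_def fin_sums_def I_def by blast
  then obtain g where g: "\<And>k. g k \<in> Lip_c (G_u X' P) (top_u X' P) (D_u X' P)"
    and bg: "\<And>k. b k = rho I (G_u X' P) (g k)" by metis
  define K where "K l = block_kernel (smap X') I (f (fst l)) (g (snd l))" for l
  note bounds = block_kernel_bounds[OF orbits assms(5) f g sep growth M D, folded I_def L_def, folded \<theta>_def]
  have "\<forall>l. \<exists>c C E m. block_bounds \<theta> M (K l) c C E m"
    unfolding K_def by (intro allI) (rule bounds(3))
  then obtain c C E m where K_bounds: "\<And>l. block_bounds \<theta> M (K l) (c l) (C l) (E l) (m l)" by metis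
  have "commutator x y \<in> schatten (I \<times> UNIV) p"
  proof (rule block_sum_schatten[where K = K and \<Lambda> = "A \<times> B" and \<psi> = "\<lambda>l. \<phi> (- snd l)"
        and \<kappa> = "\<lambda>l. fst l - snd l" and m' = m
        and c = c and C = C and D = E and M = M and \<theta> = \<theta>])
    show "finite (A \<times> B)" using fin by simp
    show "commutator x y \<xi> (v, n) =
        (\<Sum>l\<in>A \<times> B. \<Sum>w | K l n v w \<noteq> 0. K l n v w * \<xi> (\<phi> (- snd l) w, n + (fst l - snd l)))"
      if "\<xi> \<in> l2 (I \<times> UNIV)" for \<xi> v n
      unfolding x y K_def I_def A_def B_def
      using commutator_apply[OF periodic_orbit_finite_invariant(2)[OF orbits(1)]
          periodic_orbit_finite_invariant(2)[OF orbits(2)] af[unfolded I_def] bg[unfolded I_def]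
          Lip_c_outside[OF f] Lip_c_outside[OF g] bounds(1,2) that[unfolded I_def]]
      by (simp add: case_prod_beta)
    show "bij (\<phi> (- snd l))" for l :: "int \<times> int" by (rule bij_ipow[OF bij])
    show "v \<in> I" if "K l n v w \<noteq> 0" for l n v w
      using that by (auto simp: K_def block_kernel_def split: if_splits)
  qed (rule K_bounds \<theta> M p M\<theta>)+
  then show "commutator x y \<in> schatten (hpts X' P Q \<times> (UNIV :: int set)) p" by (simp add: I_def)
qed

end
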